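(* Let $(\lambda_1,\lambda_2)$ be in the unstable regime, let $c>0$ be arbitrary, and let $$\mathcal M_c=\{u_c\in V(c): E(u_c)=\inf_{u\in V(c)}E(u)\}.$$ Then: (i) If $u_c\in\mathcal M_c$ then also $|u_c|\in\mathcal M_c$. (ii) Any minimizer $u_c\in\mathcal M_c$ has the form $e^{i\theta}|u_c|$ for some $\theta\in\mathbb{S}^1=\mathbb{R}/2\pi\mathbb{Z}$, and $|u_c(x)|>0$ a.e. on $\mathbb{R}^3$.
   Context: $H=H^1(\mathbb{R}^3,\mathbb{C})$. $f\mapsto K\star f$ is the Fourier multiplier with symbol $\hat K(\xi)=\frac43\pi\,\frac{2\xi_3^2-\xi_1^2-\xi_2^2}{|\xi|^2}$ (convolution with the dipolar kernel $K(x)=\frac{1-3\cos^2\theta}{|x|^3}$, $\theta$ the angle between $x$ and $(0,0,1)$). The pair $(\lambda_1,\lambda_2)\in\mathbb{R}^2$ with $\lambda_2\ne0$ is in the unstable regime if $\lambda_1-\frac43\pi\lambda_2<0$ when $\lambda_2>0$, and $\lambda_1+\frac83\pi\lambda_2<0$ when $\lambda_2<0$. For $u\in H$: $A(u)=\|\nabla u\|_2^2$, $B(u)=\lambda_1\|u\|_4^4+\lambda_2\int_{\mathbb{R}^3}(K\star|u|^2)|u|^2dx$, $E(u)=\frac12A(u)+\frac12B(u)$, $Q(u)=A(u)+\frac32B(u)$. $S(c)=\{u\in H:\|u\|_2^2=c\}$ and $V(c)=\{u\in S(c): Q(u)=0\}$. *)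

theory Defs
  imports "HOL-Analysis.Analysis"
begin

text \<open>
  Elements of \<open>L\<^sup>2\<close> and \<open>H\<^sup>1\<close> are represented by Borel measurable functions; equality in these
  spaces is equality almost everywhere.
\<close>

definition L2 :: "(real^3 \<Rightarrow> complex) set" where
  "L2 = {f \<in> borel_measurable lborel. integrable lborel (\<lambda>x. (norm (f x))\<^sup>2)}"

definition pdiff :: "3 \<Rightarrow> (real^3 \<Rightarrow> real) \<Rightarrow> real^3 \<Rightarrow> real" where
  "pdiff j f x = frechet_derivative f (at x) (axis j 1)"

fun Ck :: "nat \<Rightarrow> (real^3 \<Rightarrow> real) \<Rightarrow> bool" where
  "Ck 0 f \<longleftrightarrow> continuous_on UNIV f"
| "Ck (Suc k) f \<longleftrightarrow> f differentiable_on UNIV \<and> (\<forall>j. Ck k (pdiff j f))"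

text \<open>The space \<open>C\<^sub>c\<^sup>\<infinity>(\<real>\<^sup>3)\<close>:\<close>

definition test_functions :: "(real^3 \<Rightarrow> real) set" where
  "test_functions = {\<phi>. (\<forall>k. Ck k \<phi>) \<and> compact (closure {x. \<phi> x \<noteq> 0})}"

definition is_weak_pdiff :: "3 \<Rightarrow> (real^3 \<Rightarrow> complex) \<Rightarrow> (real^3 \<Rightarrow> complex) \<Rightarrow> bool" where
  "is_weak_pdiff j u g \<longleftrightarrow>
     (\<forall>\<phi>\<in>test_functions.
        (LINT x|lborel. u x * of_real (pdiff j \<phi> x)) = - (LINT x|lborel. g x * of_real (\<phi> x)))"

definition H1 :: "(real^3 \<Rightarrow> complex) set" where
  "H1 = {u \<in> L2. \<forall>j. \<exists>g\<in>L2. is_weak_pdiff j u g}"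

text \<open>On \<open>H1\<close> the weak derivative is determined up to a null set.\<close>

definition weak_pdiff :: "3 \<Rightarrow> (real^3 \<Rightarrow> complex) \<Rightarrow> real^3 \<Rightarrow> complex" where
  "weak_pdiff j u = (SOME g. g \<in> L2 \<and> is_weak_pdiff j u g)"

definition fourier :: "(real^3 \<Rightarrow> complex) \<Rightarrow> real^3 \<Rightarrow> complex" where
  "fourier f \<xi> = (LINT x|lborel. cis (- (x \<bullet> \<xi>)) * f x)"

text \<open>
  \<open>is_fourier_L2 f h\<close> says that \<open>h\<close> is the Fourier-Plancherel transform of \<open>f \<in> L\<^sup>2\<close>, that is, the
  \<open>L\<^sup>2\<close> limit of the Fourier integrals of \<open>f\<close> over balls of growing radius.
\<close>

definition is_fourier_L2 :: "(real^3 \<Rightarrow> complex) \<Rightarrow> (real^3 \<Rightarrow> complex) \<Rightarrow> bool" where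
  "is_fourier_L2 f h \<longleftrightarrow> f \<in> L2 \<and> h \<in> L2 \<and>
     (\<lambda>n. \<integral>\<^sup>+ \<xi>. ennreal ((norm (fourier (\<lambda>x. indicator (ball 0 (real n)) x *\<^sub>R f x) \<xi> - h \<xi>))\<^sup>2)
            \<partial>lborel) \<longlonglongrightarrow> 0"

text \<open>
  The Fourier multiplier operator with bounded measurable symbol \<open>m\<close> on \<open>L\<^sup>2\<close>; its value is
  determined up to a null set.
\<close>

definition fourier_multiplier ::
    "(real^3 \<Rightarrow> real) \<Rightarrow> (real^3 \<Rightarrow> complex) \<Rightarrow> real^3 \<Rightarrow> complex" where
  "fourier_multiplier m f =
     (SOME g. \<exists>h. is_fourier_L2 f h \<and> is_fourier_L2 g (\<lambda>\<xi>. of_real (m \<xi>) * h \<xi>))"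

text \<open>
  Fourier transform of the kernel \<open>K x = (1 - 3 cos\<^sup>2 \<theta>) / |x|\<^sup>3\<close>, where \<open>\<theta>\<close> is the angle between
  \<open>x\<close> and \<open>(0,0,1)\<close>; \<open>K\<close> is singular at the origin, so \<open>f \<mapsto> K \<star> f\<close> is defined as the multiplier.
\<close>

definition dipolar_symbol :: "real^3 \<Rightarrow> real" where
  "dipolar_symbol \<xi> =
     4 / 3 * pi * ((2 * (\<xi>$3)\<^sup>2 - (\<xi>$1)\<^sup>2 - (\<xi>$2)\<^sup>2) / (norm \<xi>)\<^sup>2)"

definition dipolar_conv :: "(real^3 \<Rightarrow> complex) \<Rightarrow> real^3 \<Rightarrow> complex" where
  "dipolar_conv = fourier_multiplier dipolar_symbol"

definition unstable_regime :: "real \<Rightarrow> real \<Rightarrow> bool" where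
  "unstable_regime lam1 lam2 \<longleftrightarrow> lam2 \<noteq> 0 \<and>
     (lam2 > 0 \<longrightarrow> lam1 - 4 / 3 * pi * lam2 < 0) \<and>
     (lam2 < 0 \<longrightarrow> lam1 + 8 / 3 * pi * lam2 < 0)"

definition mass :: "(real^3 \<Rightarrow> complex) \<Rightarrow> real" where
  "mass u = (LINT x|lborel. (norm (u x))\<^sup>2)"

definition GP_A :: "(real^3 \<Rightarrow> complex) \<Rightarrow> real" where
  "GP_A u = (LINT x|lborel. (\<Sum>j\<in>UNIV. (norm (weak_pdiff j u x))\<^sup>2))"

text \<open>
  The symbol being real and even, \<open>K \<star> |u|\<^sup>2\<close> is real almost everywhere; \<open>Re\<close> below only
  changes the type.
\<close>

definition GP_B :: "real \<Rightarrow> real \<Rightarrow> (real^3 \<Rightarrow> complex) \<Rightarrow> real" where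
  "GP_B lam1 lam2 u =
     lam1 * (LINT x|lborel. (norm (u x))^4) +
     lam2 * (LINT x|lborel.
              Re (dipolar_conv (\<lambda>y. of_real ((norm (u y))\<^sup>2)) x) * (norm (u x))\<^sup>2)"

definition GP_E :: "real \<Rightarrow> real \<Rightarrow> (real^3 \<Rightarrow> complex) \<Rightarrow> real" where
  "GP_E lam1 lam2 u = 1 / 2 * GP_A u + 1 / 2 * GP_B lam1 lam2 u"

definition GP_Q :: "real \<Rightarrow> real \<Rightarrow> (real^3 \<Rightarrow> complex) \<Rightarrow> real" where
  "GP_Q lam1 lam2 u = GP_A u + 3 / 2 * GP_B lam1 lam2 u"

definition GP_S :: "real \<Rightarrow> (real^3 \<Rightarrow> complex) set" where
  "GP_S c = {u \<in> H1. mass u = c}"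

definition GP_V :: "real \<Rightarrow> real \<Rightarrow> real \<Rightarrow> (real^3 \<Rightarrow> complex) set" where
  "GP_V lam1 lam2 c = {u \<in> GP_S c. GP_Q lam1 lam2 u = 0}"

definition minimizers :: "real \<Rightarrow> real \<Rightarrow> real \<Rightarrow> (real^3 \<Rightarrow> complex) set" where
  "minimizers lam1 lam2 c =
     {u \<in> GP_V lam1 lam2 c. GP_E lam1 lam2 u = (INF v\<in>GP_V lam1 lam2 c. GP_E lam1 lam2 v)}"

end

theory Submission
  imports Defs "HOL-Probability.Characteristic_Functions"
begin

text \<open>
  On \<open>V(c)\<close> one has \<open>E = A / 6\<close>, and every function with \<open>B < 0\<close> can be scaled into \<open>V(c)\<close>; so a
  minimizer minimizes \<open>A\<^sup>3 M / B\<^sup>2\<close>, \<open>M\<close> the mass, over all of \<open>{B < 0}\<close>. Since \<open>B\<close> depends on \<open>|u|\<close>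
  only and \<open>A(|u|) \<le> A(u)\<close>, this gives (i) together with \<open>A(|u|) = A(u)\<close>.

  For positivity, the Euler--Lagrange inequality of \<open>v = |u|\<close> is tested with \<open>\<phi>\<^sup>2 / (v + \<delta>)\<close>, which
  bounds the gradient of \<open>ln (v + \<delta>)\<close> in \<open>L\<^sup>2\<close> on balls, uniformly in \<open>\<delta>\<close>. As \<open>\<delta> \<rightarrow> 0\<close> the zero set of
  \<open>v\<close> is therefore invariant under translations up to null sets, hence null. The equality
  \<open>A(|u|) = A(u)\<close> forces the gradient of \<open>u / v\<close> to vanish; since \<open>v\<close> has no positive lower bound, this
  is carried out for \<open>u / (v + \<delta>)\<close>, the error being controlled by the same logarithmic estimate.

  Derivatives are handled as limits of difference quotients: by Plancherel's theorem, membership in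
  \<open>H\<^sup>1\<close> and \<open>A\<close> are determined by the \<open>L\<^sup>2\<close> norms of \<open>u(x + s e\<^sub>j) - u(x)\<close>, and these norms
  decrease under \<open>u \<mapsto> |u|\<close>.
\<close>

subsection \<open>Translations and dilations\<close>

text \<open>The interaction is nonlocal, of no definite sign, and K \<star> v^2 is only known to lie
  in L^2, so neither elliptic regularity nor a strong maximum principle is at hand. The test
  function \<phi>^2 / (v + \<delta>) avoids both: the interaction sees it only through its product
  with v, which is bounded by a cutoff for every \<delta>, so that Cauchy--Schwarz is enough. The
  quotient A^3 M / B^2 is invariant under w \<mapsto> a w(t x), whose two parameters are used up by
  the conditions mass = c and Q = 0; without constraints, the variations v + t \<psi> become
  admissible. Since every derivative is a limit of differences, chain and product rules turn into
  inequalities between numbers: a discrete Picone inequality for the logarithm, and for the phase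
  the splitting of |p - q|^2 into the square of |p| - |q| and a rest, whose integral divided by s^2
  tends to the defect between the derivatives of u and of |u|. The logarithmic bound enters a second
  time as the integrable majorant |\<nabla>v|^2 / v^2 on balls.\<close>

lemma integrable_translate_iff:
  fixes f :: "'a::euclidean_space \<Rightarrow> 'b::{banach, second_countable_topology}"
  shows "integrable lborel (\<lambda>x. f (x + a)) \<longleftrightarrow> integrable lborel f"
proof -
  have *: "integrable lborel (\<lambda>x. g (x + b))" if "integrable lborel g"
    for g :: "'a \<Rightarrow> 'b" and b
  proof -
    have "integrable (distr lborel borel ((+) b)) g"
      using that by (simp add: lborel_distr_plus)
    then show ?thesis
      by (subst (asm) integrable_distr_eq) (use that in \<open>auto simp: add.commute\<close>)
  qed
  show ?thesis
    using *[of f a] *[of "\<lambda>x. f (x + a)" "- a"] by auto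
qed

lemma integral_translate:
  fixes f :: "'a::euclidean_space \<Rightarrow> 'b::{banach, second_countable_topology}"
  shows "(LINT x|lborel. f (x + a)) = (LINT x|lborel. f x)"
proof (cases "integrable lborel f")
  case True
  have "(LINT x|distr lborel borel ((+) a). f x) = (LINT x|lborel. f (a + x))"
    using True by (subst integral_distr) auto
  then show ?thesis by (simp add: lborel_distr_plus add.commute)
next
  case False
  then show ?thesis
    by (simp add: not_integrable_integral_eq integrable_translate_iff)
qed

lemma nn_integral_translate:
  fixes f :: "'a::euclidean_space \<Rightarrow> ennreal"
  assumes [measurable]: "f \<in> borel_measurable borel"
  shows "(\<integral>\<^sup>+x. f (x + a) \<partial>lborel) = (\<integral>\<^sup>+x. f x \<partial>lborel)"
proof -
  have "(\<integral>\<^sup>+x. f x \<partial>distr lborel borel ((+) a)) = (\<integral>\<^sup>+x. f (a + x) \<partial>lborel)"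
    by (subst nn_integral_distr) auto
  then show ?thesis by (simp add: lborel_distr_plus add.commute)
qed

lemma AE_translate:
  fixes P :: "'a::euclidean_space \<Rightarrow> bool"
  assumes "AE x in lborel. P x"
  shows "AE x in lborel. P (x + a)"
proof -
  have "AE x in distr lborel borel ((+) a). P x"
    unfolding lborel_distr_plus by (rule assms)
  then obtain N where N: "N \<in> null_sets (distr lborel borel ((+) a))" "{x \<in> space lborel. \<not> P x} \<subseteq> N"
    by (auto elim!: AE_E simp: null_sets_def)
  have [measurable]: "N \<in> sets borel" using N by (auto simp: null_sets_def)
  have "AE x in distr lborel borel ((+) a). x \<notin> N"
    using N AE_not_in by blast
  then have "AE x in lborel. a + x \<notin> N"
    by (subst (asm) AE_distr_iff) auto
  then show ?thesis
    by eventually_elim (use N in \<open>auto simp: add.commute\<close>)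
qed

lemma integrable_dilate_iff:
  fixes f :: "'a::euclidean_space \<Rightarrow> 'b::{banach, second_countable_topology}"
  assumes "c \<noteq> 0"
  shows "integrable lborel (\<lambda>x. f (c *\<^sub>R x)) \<longleftrightarrow> integrable lborel f"
proof -
  have *: "integrable lborel (\<lambda>x. g (c *\<^sub>R x))" if "integrable lborel g" "c \<noteq> 0"
    for g :: "'a \<Rightarrow> 'b" and c
  proof -
    have [measurable]: "g \<in> borel_measurable borel" using that by auto
    have "integrable (density (distr lborel borel (\<lambda>x. 0 + c *\<^sub>R x)) (\<lambda>_. \<bar>c\<bar>^DIM('a))) g"
      using that by (simp add: lborel_affine[symmetric, of c 0, simplified])
    then have "integrable lborel (\<lambda>x. \<bar>c\<bar>^DIM('a) *\<^sub>R g (c *\<^sub>R x))"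
      by (subst (asm) integrable_density) (auto simp: integrable_distr_eq)
    then have "integrable lborel (\<lambda>x. (1 / \<bar>c\<bar>^DIM('a)) *\<^sub>R (\<bar>c\<bar>^DIM('a) *\<^sub>R g (c *\<^sub>R x)))"
      by (rule integrable_scaleR_right)
    then show ?thesis
      using that by simp
  qed
  show ?thesis
    using *[of f c] *[of "\<lambda>x. f (c *\<^sub>R x)" "1 / c"] assms by auto
qed

lemma integral_dilate:
  fixes f :: "'a::euclidean_space \<Rightarrow> 'b::{banach, second_countable_topology}"
  assumes "c \<noteq> 0"
  shows "(LINT x|lborel. f (c *\<^sub>R x)) = (1 / \<bar>c\<bar>^DIM('a)) *\<^sub>R (LINT x|lborel. f x)"
proof (cases "integrable lborel f")
  case True
  then have [measurable]: "f \<in> borel_measurable borel" by auto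
  have "(LINT x|lborel. f x) = (LINT x|density (distr lborel borel (\<lambda>x. 0 + c *\<^sub>R x)) (\<lambda>_. \<bar>c\<bar>^DIM('a)). f x)"
    using assms by (simp add: lborel_affine[symmetric, of c 0, simplified])
  also have "\<dots> = (LINT x|lborel. \<bar>c\<bar>^DIM('a) *\<^sub>R f (c *\<^sub>R x))"
    by (subst integral_density) (auto simp: integral_distr)
  finally show ?thesis using assms by simp
next
  case False
  then show ?thesis
    by (simp add: not_integrable_integral_eq integrable_dilate_iff[OF assms])
qed

subsection \<open>Continuity of translations in the mean\<close>

text \<open>Approximation by simple functions: \<open>integrable_induct\<close> leaves indicators,
  sums and dominated limits. For a Borel set of finite measure, outer regularity passes to an open
  superset U of almost the same measure, and for x in the open set U the shifted point x + h n lies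
  in U eventually.\<close>

lemma L1_translate_continuous:
  fixes f :: "'a::euclidean_space \<Rightarrow> 'b::{banach, second_countable_topology}"
  assumes "integrable lborel f" and h: "h \<longlonglongrightarrow> 0"
  shows "(\<lambda>n. LINT x|lborel. norm (f (x + h n) - f x)) \<longlonglongrightarrow> 0"
  using assms(1)
proof (induction rule: integrable_induct)
  case (base A c)
  then have [measurable]: "A \<in> sets borel" by simp
  have diff: "integrable lborel (\<lambda>x. norm (indicator B (x + h n) *\<^sub>R c - indicator B x *\<^sub>R c))"
    if "B \<in> sets borel" "emeasure lborel B < \<infinity>" for B n
    using that integrable_translate_iff[of "\<lambda>x. indicator B x *\<^sub>R c" "h n"]
    by (intro integrable_norm Bochner_Integration.integrable_diff) auto
  show ?case
  proof (rule LIMSEQ_I)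
    fix r :: real assume "r > 0"
    \<comment> \<open>With this e the error 2 |c| e stays below r / 2; the + 1 covers c = 0.\<close>
    define e where "e = r / (4 * (norm c + 1))"
    have "e > 0" using \<open>r > 0\<close> by (auto simp: e_def intro!: divide_pos_pos add_nonneg_pos)
    obtain U where U: "open U" "A \<subseteq> U" "emeasure lborel (U - A) < e"
      using outer_regular_lborel[of A e] \<open>e > 0\<close> by auto
    have [measurable]: "U \<in> sets borel" using U by auto
    have mUA: "measure lborel (U - A) < e"
      using U(3) \<open>e > 0\<close> by (metis emeasure_eq_ennreal_measure ennreal_less_iff measure_nonneg not_less_iff_gr_or_eq order.strict_trans top.extremum_strict ennreal_less_top)
    have fUA: "emeasure lborel (U - A) < \<infinity>" using U(3) by (auto intro: less_trans)
    have "emeasure lborel U \<le> emeasure lborel A + emeasure lborel (U - A)"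
      using U by (metis Diff_partition \<open>A \<in> sets borel\<close> \<open>U \<in> sets borel\<close> emeasure_subadditive sets.Diff sets_lborel)
    then have fU: "emeasure lborel U < \<infinity>"
      using base(2) fUA by (metis ennreal_add_less_top infinity_ennreal_def order_le_less_trans)
    have intU: "integrable lborel (indicator U :: 'a \<Rightarrow> real)" using fU by auto
    let ?D = "\<lambda>B n. LINT x|lborel. norm (indicator B (x + h n) *\<^sub>R c - indicator B x *\<^sub>R c)"
    \<comment> \<open>Openness controls the shifted indicator only at points of U. The product with
      the unshifted indicator vanishes elsewhere and so converges everywhere; the L^1 distance is
      then recovered from |a - b| = a + b - 2 a b for values 0 and 1.\<close>
    have lim: "(\<lambda>n. LINT x|lborel. indicator U (x + h n) * indicator U x) \<longlonglongrightarrow> (LINT x|lborel. indicat_real U x)"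
    proof (rule integral_dominated_convergence[where w="indicator U"])
      show "AE x in lborel. (\<lambda>i. indicat_real U (x + h i) * indicat_real U x) \<longlonglongrightarrow> indicat_real U x"
      proof (intro AE_I2)
        fix x
        show "(\<lambda>i. indicat_real U (x + h i) * indicat_real U x) \<longlonglongrightarrow> indicat_real U x"
        proof (cases "x \<in> U")
          case True
          have "(\<lambda>i. x + h i) \<longlonglongrightarrow> x" using h by (auto intro: tendsto_eq_intros)
          then have "\<forall>\<^sub>F i in sequentially. x + h i \<in> U"
            using U(1) True by (rule topological_tendstoD)
          then have "\<forall>\<^sub>F i in sequentially. indicat_real U (x + h i) * indicat_real U x = indicat_real U x"
            by eventually_elim (use True in auto)
          then show ?thesis by (rule tendsto_eventually)
        qed auto
      qed
    qed (use intU in \<open>auto simp: indicator_def\<close>)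
    have gi: "integrable lborel (\<lambda>x. indicat_real U (x + h n) * indicat_real U x)" for n
      by (rule Bochner_Integration.integrable_bound[OF intU]) (auto simp: indicator_def)
    have eqU: "?D U n = norm c * (2 * (LINT x|lborel. indicat_real U x) - 2 * (LINT x|lborel. indicat_real U (x + h n) * indicat_real U x))" for n
    proof -
      have "?D U n = (LINT x|lborel. norm c * (indicat_real U (x + h n) + indicat_real U x - 2 * (indicat_real U (x + h n) * indicat_real U x)))"
        by (rule Bochner_Integration.integral_cong) (auto simp: indicator_def)
      also have "\<dots> = norm c * ((LINT x|lborel. indicat_real U (x + h n)) + (LINT x|lborel. indicat_real U x) - 2 * (LINT x|lborel. indicat_real U (x + h n) * indicat_real U x))"
        using intU gi[of n] integrable_translate_iff[of "indicat_real U" "h n"]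
        by (simp add: Bochner_Integration.integral_diff Bochner_Integration.integral_add)
      finally show ?thesis
        by (simp add: integral_translate)
    qed
    have "(\<lambda>n. ?D U n) \<longlonglongrightarrow> norm c * (2 * (LINT x|lborel. indicat_real U x) - 2 * (LINT x|lborel. indicat_real U x))"
      unfolding eqU by (intro tendsto_intros lim)
    then have "(\<lambda>n. ?D U n) \<longlonglongrightarrow> 0" by simp
    then obtain no where no: "\<And>n. n \<ge> no \<Longrightarrow> norm (?D U n - 0) < r / 2"
      using LIMSEQ_D[of "\<lambda>n. ?D U n" 0 "r / 2"] \<open>r > 0\<close> by auto
    have le: "?D A n \<le> ?D U n + 2 * norm c * e" for n
    proof -
      have iUA: "integrable lborel (indicat_real (U - A))" using fUA by auto
      have iUA': "integrable lborel (\<lambda>x. indicat_real (U - A) (x + h n))"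
        using iUA integrable_translate_iff by blast
      have m: "(LINT x|lborel. indicat_real (U - A) x) \<le> e"
        using mUA by simp
      have "?D A n \<le> (LINT x|lborel. norm (indicator U (x + h n) *\<^sub>R c - indicator U x *\<^sub>R c)
         + (norm c * indicat_real (U - A) (x + h n) + norm c * indicat_real (U - A) x))"
      proof (rule integral_mono)
        show "integrable lborel (\<lambda>x. norm (indicator A (x + h n) *\<^sub>R c - indicator A x *\<^sub>R c))"
          by (rule diff) (use base in auto)
        show "integrable lborel (\<lambda>x. norm (indicator U (x + h n) *\<^sub>R c - indicator U x *\<^sub>R c)
          + (norm c * indicat_real (U - A) (x + h n) + norm c * indicat_real (U - A) x))"
          by (intro Bochner_Integration.integrable_add integrable_mult_right diff iUA iUA' fU) auto
        show "norm (indicator A (x + h n) *\<^sub>R c - indicator A x *\<^sub>R c) \<le> norm (indicator U (x + h n) *\<^sub>R c - indicator U x *\<^sub>R c)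
         + (norm c * indicat_real (U - A) (x + h n) + norm c * indicat_real (U - A) x)" for x
          using U(2) by (auto simp: indicator_def)
      qed
      also have "\<dots> = ?D U n + (norm c * (LINT x|lborel. indicat_real (U - A) (x + h n)) + norm c * (LINT x|lborel. indicat_real (U - A) x))"
        using diff[of U n] fU iUA iUA' by (simp add: Bochner_Integration.integral_add)
      also have "\<dots> = ?D U n + 2 * norm c * (LINT x|lborel. indicat_real (U - A) x)"
        by (simp add: integral_translate[of "indicat_real (U - A)"] del: indicator_simps)
      also have "\<dots> \<le> ?D U n + 2 * norm c * e"
        using m by (intro add_left_mono mult_left_mono) auto
      finally show ?thesis .
    qed
    have "2 * norm c * e \<le> r / 2"
      using \<open>r > 0\<close> by (auto simp: e_def field_simps add_pos_nonneg)
    then show "\<exists>no. \<forall>n\<ge>no. norm (?D A n - 0) < r"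
      using no le by (intro exI[of _ no]) (auto simp: integral_nonneg_AE intro: le_less_trans[OF le] dest!: no)
  qed
next
  case (add f g)
  show ?case
  proof (rule tendsto_sandwich[OF _ _ tendsto_const tendsto_add_zero[OF add.IH]])
    show "\<forall>\<^sub>F n in sequentially. (LINT x|lborel. norm (f (x + h n) + g (x + h n) - (f x + g x)))
        \<le> (LINT x|lborel. norm (f (x + h n) - f x)) + (LINT x|lborel. norm (g (x + h n) - g x))"
    proof (intro always_eventually allI)
      fix n
      have i: "integrable lborel (\<lambda>x. norm (f (x + h n) - f x))" "integrable lborel (\<lambda>x. norm (g (x + h n) - g x))"
        using add integrable_translate_iff by (auto intro!: integrable_norm Bochner_Integration.integrable_diff)
      show "(LINT x|lborel. norm (f (x + h n) + g (x + h n) - (f x + g x)))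
        \<le> (LINT x|lborel. norm (f (x + h n) - f x)) + (LINT x|lborel. norm (g (x + h n) - g x))"
        unfolding Bochner_Integration.integral_add[OF i, symmetric]
        using add integrable_translate_iff i
        by (intro integral_mono) (auto intro!: integrable_norm Bochner_Integration.integrable_diff Bochner_Integration.integrable_add simp: add_diff_add norm_triangle_ineq)
    qed
  qed (auto intro!: always_eventually integral_nonneg_AE)
next
  case (lim f s)
  note i = lim.hyps(1,4)
  have int: "integrable lborel (\<lambda>x. norm (s i x - f x))" for i
    using i by auto
  have "(\<lambda>i. LINT x|lborel. norm (s i x - f x)) \<longlonglongrightarrow> (LINT x::'a|lborel. (0::real))"
  proof (rule integral_dominated_convergence[where w="\<lambda>x. 3 * norm (f x)"])
    show "AE x in lborel. (\<lambda>i. norm (s i x - f x)) \<longlonglongrightarrow> 0"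
      using lim.hyps(2) by (intro AE_I2 tendsto_norm_zero) (auto simp: LIM_zero)
    show "AE x in lborel. norm (norm (s i x - f x)) \<le> 3 * norm (f x)" for i
    proof (intro AE_I2)
      fix x
      show "norm (norm (s i x - f x)) \<le> 3 * norm (f x)"
        using lim.hyps(3)[of x i] norm_triangle_ineq4[of "s i x" "f x"] by simp
    qed
  qed (use i in auto)
  then have s0: "(\<lambda>i. LINT x|lborel. norm (s i x - f x)) \<longlonglongrightarrow> 0" by simp
  show ?case
  proof (rule LIMSEQ_I)
    fix r :: real assume "r > 0"
    then obtain i where i1: "(LINT x|lborel. norm (s i x - f x)) < r / 4"
      using order_tendstoD(2)[OF s0, of "r / 4"] eventually_sequentially by auto
    obtain no where no: "\<And>n. n \<ge> no \<Longrightarrow> (LINT x|lborel. norm (s i (x + h n) - s i x)) < r / 2"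
      using order_tendstoD(2)[OF lim.IH[of i], of "r / 2"] \<open>r > 0\<close> eventually_sequentially by auto
    have le: "(LINT x|lborel. norm (f (x + h n) - f x)) \<le>
       (LINT x|lborel. norm (s i (x + h n) - s i x)) + 2 * (LINT x|lborel. norm (s i x - f x))" for n
    proof -
      note ints = int[of i] integrable_translate_iff[of "\<lambda>x. norm (s i x - f x)" "h n", THEN iffD2, OF int]
      have int1: "integrable lborel (\<lambda>x. norm (s i (x + h n) - s i x))"
        using i integrable_translate_iff by (auto intro!: integrable_norm Bochner_Integration.integrable_diff)
      have "(LINT x|lborel. norm (f (x + h n) - f x)) \<le>
        (LINT x|lborel. norm (s i (x + h n) - s i x) + (norm (s i (x + h n) - f (x + h n)) + norm (s i x - f x)))"
      proof (intro integral_mono)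
        show "integrable lborel (\<lambda>x. norm (f (x + h n) - f x))"
          using i integrable_translate_iff by (auto intro!: integrable_norm Bochner_Integration.integrable_diff)
        show "norm (f (x + h n) - f x) \<le> norm (s i (x + h n) - s i x) + (norm (s i (x + h n) - f (x + h n)) + norm (s i x - f x))" for x
          by norm
      qed (intro Bochner_Integration.integrable_add ints int1)
      also have "\<dots> = (LINT x|lborel. norm (s i (x + h n) - s i x)) + ((LINT x|lborel. norm (s i (x + h n) - f (x + h n))) + (LINT x|lborel. norm (s i x - f x)))"
        using ints int1 by simp
      also have "(LINT x|lborel. norm (s i (x + h n) - f (x + h n))) = (LINT x|lborel. norm (s i x - f x))"
        by (rule integral_translate)
      finally show ?thesis by simp
    qed
    show "\<exists>no. \<forall>n\<ge>no. norm ((LINT x|lborel. norm (f (x + h n) - f x)) - 0) < r"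
    proof (intro exI[of _ no] allI impI)
      fix n assume "n \<ge> no"
      from no[OF this] le[of n] i1
      have "(LINT x|lborel. norm (f (x + h n) - f x)) < r" by linarith
      moreover have "0 \<le> (LINT x|lborel. norm (f (x + h n) - f x))" by simp
      ultimately show "norm ((LINT x|lborel. norm (f (x + h n) - f x)) - 0) < r" by simp
    qed
  qed
qed

lemma tendsto_zero_le:
  fixes f g :: "nat \<Rightarrow> real"
  assumes "\<And>n. 0 \<le> f n" "\<And>n. f n \<le> g n" "g \<longlonglongrightarrow> 0"
  shows "f \<longlonglongrightarrow> 0"
  by (rule tendsto_sandwich[OF _ _ tendsto_const assms(3)]) (use assms in simp_all)

subsection \<open>The space \<open>L\<^sup>2\<close>\<close>

lemma L2_measurable: "f \<in> L2 \<Longrightarrow> f \<in> borel_measurable borel"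
  by (simp add: L2_def)

lemma L2_integrable: "f \<in> L2 \<Longrightarrow> integrable lborel (\<lambda>x. (norm (f x))\<^sup>2)"
  by (simp add: L2_def)

lemma L2I: "f \<in> borel_measurable borel \<Longrightarrow> integrable lborel (\<lambda>x. (norm (f x))\<^sup>2) \<Longrightarrow> f \<in> L2"
  by (simp add: L2_def)

lemma mass_nonneg [simp]: "0 \<le> mass f"
  by (simp add: mass_def)

lemma nn_integral_mass: "f \<in> L2 \<Longrightarrow> (\<integral>\<^sup>+x. ennreal ((norm (f x))\<^sup>2) \<partial>lborel) = ennreal (mass f)"
  unfolding mass_def by (intro nn_integral_eq_integral L2_integrable) auto

lemma L2_bound:
  assumes "g \<in> L2" "f \<in> borel_measurable borel" "\<And>x. norm (f x) \<le> C * norm (g x)"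
  shows "f \<in> L2"
proof (rule L2I)
  show "integrable lborel (\<lambda>x. (norm (f x))\<^sup>2)"
  proof (rule Bochner_Integration.integrable_bound)
    show "integrable lborel (\<lambda>x. C\<^sup>2 * (norm (g x))\<^sup>2)"
      using L2_integrable[OF assms(1)] by simp
    show "AE x in lborel. norm ((norm (f x))\<^sup>2) \<le> norm (C\<^sup>2 * (norm (g x))\<^sup>2)"
      using power_mono[OF assms(3), of _ 2] by (auto simp: power_mult_distrib)
  qed (use assms(2) in auto)
qed (use assms in auto)

lemma L2_AE_cong:
  assumes "g \<in> L2" "f \<in> borel_measurable borel" "AE x in lborel. f x = g x"
  shows "f \<in> L2"
proof (rule L2I)
  show "integrable lborel (\<lambda>x. (norm (f x))\<^sup>2)"
    using L2_integrable[OF assms(1)]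
    by (rule integrable_cong_AE_imp) (use assms L2_measurable[OF assms(1)] in auto)
qed (use assms in auto)

lemma mass_AE_cong:
  assumes "f \<in> borel_measurable borel" "g \<in> borel_measurable borel" "AE x in lborel. f x = g x"
  shows "mass f = mass g"
  unfolding mass_def by (rule integral_cong_AE) (use assms in auto)

lemma norm_sum_square_le:
  fixes a b :: "'a::real_normed_vector"
  shows "(norm (a + b))\<^sup>2 \<le> 2 * (norm a)\<^sup>2 + 2 * (norm b)\<^sup>2"
proof -
  have "(norm (a + b))\<^sup>2 \<le> (norm a + norm b)\<^sup>2"
    by (intro power_mono norm_triangle_ineq) auto
  also have "\<dots> \<le> 2 * (norm a)\<^sup>2 + 2 * (norm b)\<^sup>2"
    using sum_squares_bound[of "norm a" "norm b"] by (simp add: power2_sum)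
  finally show ?thesis .
qed

lemma L2_add:
  assumes "f \<in> L2" "g \<in> L2"
  shows "(\<lambda>x. f x + g x) \<in> L2"
proof (rule L2I)
  show "integrable lborel (\<lambda>x. (norm (f x + g x))\<^sup>2)"
  proof (rule Bochner_Integration.integrable_bound)
    show "integrable lborel (\<lambda>x. 2 * (norm (f x))\<^sup>2 + 2 * (norm (g x))\<^sup>2)"
      using assms by (auto simp: L2_integrable)
    show "AE x in lborel. norm ((norm (f x + g x))\<^sup>2) \<le> norm (2 * (norm (f x))\<^sup>2 + 2 * (norm (g x))\<^sup>2)"
      using norm_sum_square_le by (auto intro!: AE_I2 order_trans[OF norm_sum_square_le])
  qed (use assms in \<open>auto simp: L2_def\<close>)
qed (use assms in \<open>auto simp: L2_def\<close>)

lemma L2_mult_bounded: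
  assumes "f \<in> L2" "m \<in> borel_measurable borel" "\<And>x. norm (m x) \<le> C"
  shows "(\<lambda>x. m x * f x) \<in> L2"
  using assms L2_measurable[OF assms(1)]
  by (intro L2_bound[OF assms(1), of _ C]) (auto simp: norm_mult intro!: mult_right_mono)

lemma L2_cmult: "f \<in> L2 \<Longrightarrow> (\<lambda>x. c * f x) \<in> L2"
  by (rule L2_mult_bounded[of f "\<lambda>_. c" "norm c"]) auto

lemma L2_diff: "f \<in> L2 \<Longrightarrow> g \<in> L2 \<Longrightarrow> (\<lambda>x. f x - g x) \<in> L2"
  using L2_add[of f "\<lambda>x. (-1) * g x"] L2_cmult[of g "-1"] by simp

lemma L2_cnj: "f \<in> L2 \<Longrightarrow> (\<lambda>x. cnj (f x)) \<in> L2"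
  by (rule L2_bound[of f _ 1]) (auto dest!: L2_measurable intro: borel_measurable_continuous_onI[THEN measurable_compose_rev] continuous_intros)

lemma L2_indicator: "f \<in> L2 \<Longrightarrow> A \<in> sets borel \<Longrightarrow> (\<lambda>x. indicator A x *\<^sub>R f x) \<in> L2"
  by (rule L2_bound[of f _ 1]) (auto dest: L2_measurable simp: indicator_def)

lemma L2_translate: "f \<in> L2 \<Longrightarrow> (\<lambda>x. f (x + a)) \<in> L2"
  using integrable_translate_iff[of "\<lambda>x. (norm (f x))\<^sup>2" a]
  by (auto simp: L2_def)

lemma L2_dilate: "f \<in> L2 \<Longrightarrow> c \<noteq> 0 \<Longrightarrow> (\<lambda>x. f (c *\<^sub>R x)) \<in> L2"
  using integrable_dilate_iff[of c "\<lambda>x. (norm (f x))\<^sup>2"]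
  by (auto simp: L2_def)

lemma mass_translate: "mass (\<lambda>x. f (x + a)) = mass f"
  unfolding mass_def by (rule integral_translate)

lemma mass_dilate: "c \<noteq> 0 \<Longrightarrow> mass (\<lambda>x. f (c *\<^sub>R x)) = mass f / \<bar>c\<bar>^3"
  unfolding mass_def by (subst integral_dilate[of c "\<lambda>x. (norm (f x))\<^sup>2"]) auto

lemma mass_cmult: "mass (\<lambda>x. c * f x) = (norm c)\<^sup>2 * mass f"
  unfolding mass_def by (simp add: norm_mult power_mult_distrib)

lemma mass_minus_commute: "mass (\<lambda>x. f x - g x) = mass (\<lambda>x. g x - f x)"
  unfolding mass_def by (simp add: norm_minus_commute)

lemma mass_mono:
  assumes "g \<in> L2" "f \<in> borel_measurable borel" "\<And>x. norm (f x) \<le> C * norm (g x)"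
  shows "mass f \<le> C\<^sup>2 * mass g"
proof -
  have "mass f \<le> (LINT x|lborel. C\<^sup>2 * (norm (g x))\<^sup>2)"
    unfolding mass_def
    using L2_integrable[OF L2_bound[OF assms]] L2_integrable[OF assms(1)] power_mono[OF assms(3), of _ 2]
    by (intro integral_mono) (auto simp: power_mult_distrib)
  then show ?thesis by (simp add: mass_def)
qed

lemma mass_eq_0_iff: "f \<in> L2 \<Longrightarrow> mass f = 0 \<longleftrightarrow> (AE x in lborel. f x = 0)"
  unfolding mass_def using integral_nonneg_eq_0_iff_AE[OF L2_integrable, of f] by simp

lemma L2_mult_integrable:
  assumes "f \<in> L2" "g \<in> L2"
  shows "integrable lborel (\<lambda>x. f x * g x)"
proof (rule Bochner_Integration.integrable_bound)
  show "integrable lborel (\<lambda>x. (norm (f x))\<^sup>2 + (norm (g x))\<^sup>2)"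
    using assms by (auto simp: L2_integrable)
  show "AE x in lborel. norm (f x * g x) \<le> norm ((norm (f x))\<^sup>2 + (norm (g x))\<^sup>2)"
  proof (intro AE_I2)
    fix x
    have "0 \<le> norm (f x) * norm (g x)" by simp
    then have "norm (f x * g x) \<le> (norm (f x))\<^sup>2 + (norm (g x))\<^sup>2"
      using sum_squares_bound[of "norm (f x)" "norm (g x)"] unfolding norm_mult by linarith
    then show "norm (f x * g x) \<le> norm ((norm (f x))\<^sup>2 + (norm (g x))\<^sup>2)"
      by simp
  qed
qed (use assms in \<open>auto simp: L2_def\<close>)

section \<open>Inner product, Cauchy--Schwarz and convergence in the mean\<close>

definition l2_inner :: "(real^3 \<Rightarrow> complex) \<Rightarrow> (real^3 \<Rightarrow> complex) \<Rightarrow> complex" where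
  "l2_inner f g = (LINT x|lborel. f x * cnj (g x))"

lemma l2_inner_integrable: "f \<in> L2 \<Longrightarrow> g \<in> L2 \<Longrightarrow> integrable lborel (\<lambda>x. f x * cnj (g x))"
  by (intro L2_mult_integrable L2_cnj)

lemma l2_inner_add_left:
  "f \<in> L2 \<Longrightarrow> g \<in> L2 \<Longrightarrow> k \<in> L2 \<Longrightarrow> l2_inner (\<lambda>x. f x + g x) k = l2_inner f k + l2_inner g k"
  by (simp add: l2_inner_def distrib_right l2_inner_integrable)

lemma l2_inner_diff_left:
  "f \<in> L2 \<Longrightarrow> g \<in> L2 \<Longrightarrow> k \<in> L2 \<Longrightarrow> l2_inner (\<lambda>x. f x - g x) k = l2_inner f k - l2_inner g k"
  by (simp add: l2_inner_def left_diff_distrib l2_inner_integrable)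

lemma l2_inner_cnj: "cnj (l2_inner f g) = l2_inner g f"
  unfolding l2_inner_def by (subst Bochner_Integration.integral_cnj[symmetric]) (simp add: mult.commute)

lemma l2_inner_diff_right:
  "f \<in> L2 \<Longrightarrow> g \<in> L2 \<Longrightarrow> k \<in> L2 \<Longrightarrow> l2_inner k (\<lambda>x. f x - g x) = l2_inner k f - l2_inner k g"
  by (simp add: l2_inner_def right_diff_distrib l2_inner_integrable)

lemma l2_inner_add_right:
  "f \<in> L2 \<Longrightarrow> g \<in> L2 \<Longrightarrow> k \<in> L2 \<Longrightarrow> l2_inner k (\<lambda>x. f x + g x) = l2_inner k f + l2_inner k g"
  by (simp add: l2_inner_def distrib_left l2_inner_integrable)

lemma l2_inner_cmult_left: "l2_inner (\<lambda>x. c * f x) g = c * l2_inner f g"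
  by (simp add: l2_inner_def mult.assoc)

lemma l2_inner_cmult_right: "l2_inner f (\<lambda>x. c * g x) = cnj c * l2_inner f g"
  by (simp add: l2_inner_def mult.left_commute)

lemma l2_inner_self: "l2_inner f f = of_real (mass f)"
proof -
  have "(\<lambda>x. f x * cnj (f x)) = (\<lambda>x. complex_of_real ((norm (f x))\<^sup>2))"
    by (simp only: complex_norm_square)
  then show ?thesis
    unfolding l2_inner_def mass_def by (simp only: integral_complex_of_real)
qed

lemma mass_add:
  assumes "f \<in> L2" "g \<in> L2"
  shows "mass (\<lambda>x. f x + g x) = mass f + 2 * Re (l2_inner f g) + mass g"
proof -
  have "l2_inner (\<lambda>x. f x + g x) (\<lambda>x. f x + g x) = l2_inner f f + l2_inner f g + (cnj (l2_inner f g) + l2_inner g g)"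
    using assms by (simp add: l2_inner_add_left l2_inner_add_right L2_add l2_inner_cnj)
  then show ?thesis
    unfolding l2_inner_self by (auto simp: complex_eq_iff)
qed

lemma quadratic_nonneg_discriminant:
  fixes a b I :: real
  assumes "\<And>t. 0 \<le> a + 2 * t * I + t\<^sup>2 * b" "0 \<le> a" "0 \<le> b"
  shows "I\<^sup>2 \<le> a * b"
proof (cases "b = 0")
  case True
  have "I = 0"
  proof (rule ccontr)
    assume "I \<noteq> 0"
    \<comment> \<open>For b = 0 the polynomial is linear in t; this t is the point where it takes
      the value -1.\<close>
    then have "a + 2 * (- (a + 1) / (2 * I)) * I + (- (a + 1) / (2 * I))\<^sup>2 * b = - 1"
      using True by (simp add: field_simps)
    then show False
      using assms(1)[of "- (a + 1) / (2 * I)"] by simp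
  qed
  then show ?thesis using assms by simp
next
  case False
  have "a + 2 * (- I / b) * I + (- I / b)\<^sup>2 * b = a - I\<^sup>2 / b"
    using False by (simp add: power2_eq_square field_simps)
  then have "0 \<le> a - I\<^sup>2 / b"
    using assms(1)[of "- I / b"] by simp
  moreover have "b > 0" using False assms by simp
  ultimately show ?thesis by (simp add: field_simps)
qed

lemma integral_norm_mult_le:
  assumes "f \<in> L2" "g \<in> L2"
  shows "(LINT x|lborel. norm (f x * g x))\<^sup>2 \<le> mass f * mass g"
proof (rule quadratic_nonneg_discriminant)
  fix t :: real
  have i: "integrable lborel (\<lambda>x. norm (f x * g x))"
    using L2_mult_integrable[OF assms] by simp
  have "0 \<le> (LINT x|lborel. (norm (f x) + t * norm (g x))\<^sup>2)"
    by simp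
  also have "\<dots> = (LINT x|lborel. (norm (f x))\<^sup>2 + 2 * t * norm (f x * g x) + t\<^sup>2 * (norm (g x))\<^sup>2)"
    by (intro Bochner_Integration.integral_cong) (auto simp: power2_eq_square norm_mult algebra_simps)
  also have "\<dots> = mass f + 2 * t * (LINT x|lborel. norm (f x * g x)) + t\<^sup>2 * mass g"
    unfolding mass_def using i L2_integrable[OF assms(1)] L2_integrable[OF assms(2)] by simp
  finally show "0 \<le> mass f + 2 * t * (LINT x|lborel. norm (f x * g x)) + t\<^sup>2 * mass g" .
qed auto

lemma l2_inner_Cauchy_Schwarz:
  assumes "f \<in> L2" "g \<in> L2"
  shows "norm (l2_inner f g) \<le> sqrt (mass f) * sqrt (mass g)"
proof -
  have "norm (l2_inner f g) \<le> (LINT x|lborel. norm (f x * cnj (g x)))"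
    unfolding l2_inner_def by simp
  also have "\<dots> = (LINT x|lborel. norm (f x * g x))"
    by (simp add: norm_mult)
  also have "\<dots> \<le> sqrt (mass f * mass g)"
    by (rule real_le_rsqrt) (rule integral_norm_mult_le[OF assms])
  finally show ?thesis by (simp add: real_sqrt_mult)
qed

lemma mass_add_le:
  assumes "f \<in> L2" "g \<in> L2"
  shows "mass (\<lambda>x. f x + g x) \<le> 2 * mass f + 2 * mass g"
proof -
  have "mass (\<lambda>x. f x + g x) \<le> (LINT x|lborel. 2 * (norm (f x))\<^sup>2 + 2 * (norm (g x))\<^sup>2)"
    unfolding mass_def using L2_add[OF assms] assms
    by (intro integral_mono norm_sum_square_le) (auto simp: L2_integrable)
  then show ?thesis
    unfolding mass_def using assms by (simp add: L2_integrable)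
qed

lemma mass_diff_triangle:
  assumes "f \<in> L2" "g \<in> L2" "k \<in> L2"
  shows "mass (\<lambda>x. f x - k x) \<le> 2 * mass (\<lambda>x. f x - g x) + 2 * mass (\<lambda>x. g x - k x)"
  using mass_add_le[OF L2_diff[OF assms(1,2)] L2_diff[OF assms(2,3)]] by simp

lemma l2_inner_tendsto:
  assumes L2: "\<And>n. F n \<in> L2" "\<And>n. G n \<in> L2" "f \<in> L2" "g \<in> L2"
    and F: "(\<lambda>n. mass (\<lambda>x. F n x - f x)) \<longlonglongrightarrow> 0" and G: "(\<lambda>n. mass (\<lambda>x. G n x - g x)) \<longlonglongrightarrow> 0"
  shows "(\<lambda>n. l2_inner (F n) (G n)) \<longlonglongrightarrow> l2_inner f g"
proof -
  let ?b = "\<lambda>n. sqrt (mass (\<lambda>x. F n x - f x)) * sqrt (2 * mass (\<lambda>x. G n x - g x) + 2 * mass g)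
     + sqrt (mass f) * sqrt (mass (\<lambda>x. G n x - g x))"
  have le: "norm (l2_inner (F n) (G n) - l2_inner f g) \<le> ?b n" for n
  proof -
    have "l2_inner (F n) (G n) - l2_inner f g = l2_inner (\<lambda>x. F n x - f x) (G n) + l2_inner f (\<lambda>x. G n x - g x)"
      using L2 by (simp add: l2_inner_diff_left l2_inner_diff_right)
    also have "norm \<dots> \<le> sqrt (mass (\<lambda>x. F n x - f x)) * sqrt (mass (G n)) + sqrt (mass f) * sqrt (mass (\<lambda>x. G n x - g x))"
      using L2 by (intro norm_triangle_le add_mono l2_inner_Cauchy_Schwarz L2_diff)
    also have "\<dots> \<le> ?b n"
      using mass_add_le[OF L2_diff[OF L2(2)[of n] L2(4)] L2(4)]
      by (intro add_mono mult_left_mono) auto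
    finally show ?thesis .
  qed
  have "?b \<longlonglongrightarrow> sqrt 0 * sqrt (2 * 0 + 2 * mass g) + sqrt (mass f) * sqrt 0"
    by (intro tendsto_intros F G)
  then have "?b \<longlonglongrightarrow> 0" by simp
  then have "(\<lambda>n. l2_inner (F n) (G n) - l2_inner f g) \<longlonglongrightarrow> 0"
    by (rule Lim_null_comparison[rotated]) (intro always_eventually allI le)
  then show ?thesis by (simp add: LIM_zero_iff)
qed

lemma mass_tendsto:
  assumes "\<And>n. F n \<in> L2" "f \<in> L2" "(\<lambda>n. mass (\<lambda>x. F n x - f x)) \<longlonglongrightarrow> 0"
  shows "(\<lambda>n. mass (F n)) \<longlonglongrightarrow> mass f"
  using tendsto_Re[OF l2_inner_tendsto[OF assms(1,1,2,2,3,3)]] by (simp add: l2_inner_self)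

lemma L2_limit_unique:
  assumes "\<And>n. F n \<in> L2" "f \<in> L2" "g \<in> L2"
    and "(\<lambda>n. mass (\<lambda>x. F n x - f x)) \<longlonglongrightarrow> 0" "(\<lambda>n. mass (\<lambda>x. F n x - g x)) \<longlonglongrightarrow> 0"
  shows "AE x in lborel. f x = g x"
proof -
  have "(\<lambda>n. 2 * mass (\<lambda>x. F n x - f x) + 2 * mass (\<lambda>x. F n x - g x)) \<longlonglongrightarrow> 2 * 0 + 2 * 0"
    by (intro tendsto_intros assms)
  then have "mass (\<lambda>x. f x - g x) \<le> 2 * 0 + 2 * 0"
    using mass_diff_triangle[OF assms(2,1,3)] mass_minus_commute[of f]
    by (intro LIMSEQ_le_const[where X="\<lambda>n. 2 * mass (\<lambda>x. F n x - f x) + 2 * mass (\<lambda>x. F n x - g x)"])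
       auto
  then have "mass (\<lambda>x. f x - g x) = 0"
    using mass_nonneg[of "\<lambda>x. f x - g x"] by linarith
  then show ?thesis
    using mass_eq_0_iff[OF L2_diff[OF assms(2,3)]] by auto
qed

section \<open>Almost everywhere limits, continuity of translations and completeness\<close>

lemma L2_Fatou:
  assumes "\<And>n. G n \<in> L2" "g \<in> borel_measurable borel" "AE x in lborel. (\<lambda>n. G n x) \<longlonglongrightarrow> g x"
    and le: "\<And>n::nat. mass (G n) \<le> C"
  shows "g \<in> L2" "mass g \<le> C"
proof -
  have [measurable]: "g \<in> borel_measurable borel" "\<And>n. G n \<in> borel_measurable borel"
    using assms by (auto dest: L2_measurable)
  have C: "0 \<le> C" using le[of 0] mass_nonneg[of "G 0"] by linarith
  have "(\<integral>\<^sup>+x. ennreal ((norm (g x))\<^sup>2) \<partial>lborel) = (\<integral>\<^sup>+x. liminf (\<lambda>n. ennreal ((norm (G n x))\<^sup>2)) \<partial>lborel)"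
  proof (rule nn_integral_cong_AE)
    show "AE x in lborel. ennreal ((norm (g x))\<^sup>2) = liminf (\<lambda>n. ennreal ((norm (G n x))\<^sup>2))"
      using assms(3)
    proof eventually_elim
      case (elim x)
      then have "(\<lambda>n. ennreal ((norm (G n x))\<^sup>2)) \<longlonglongrightarrow> ennreal ((norm (g x))\<^sup>2)"
        by (intro tendsto_ennrealI tendsto_power tendsto_norm)
      from lim_imp_Liminf[OF _ this] show ?case by simp
    qed
  qed
  also have "\<dots> \<le> liminf (\<lambda>n. \<integral>\<^sup>+x. ennreal ((norm (G n x))\<^sup>2) \<partial>lborel)"
    by (rule nn_integral_liminf) measurable
  also have "\<dots> \<le> ennreal C"
    using le by (intro Liminf_le always_eventually allI) (auto simp: nn_integral_mass[OF assms(1)] intro: ennreal_leI)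
  finally have *: "(\<integral>\<^sup>+x. ennreal ((norm (g x))\<^sup>2) \<partial>lborel) \<le> ennreal C" .
  then have "integrable lborel (\<lambda>x. (norm (g x))\<^sup>2)"
    by (intro integrableI_bounded) (auto intro: le_less_trans)
  then show g: "g \<in> L2" by (intro L2I) auto
  show "mass g \<le> C"
    using * C unfolding nn_integral_mass[OF g] by simp
qed

lemma L2_AE_subseq:
  assumes "\<And>n. F n \<in> L2" "f \<in> L2" "(\<lambda>n. mass (\<lambda>x. F n x - f x)) \<longlonglongrightarrow> 0"
  shows "\<exists>r::nat\<Rightarrow>nat. strict_mono r \<and> (AE x in lborel. (\<lambda>n. F (r n) x) \<longlonglongrightarrow> f x)"
proof -
  have "\<exists>r::nat\<Rightarrow>nat. strict_mono r \<and> (AE x in lborel. (\<lambda>n. (norm (F (r n) x - f x))\<^sup>2) \<longlonglongrightarrow> 0)"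
    using assms(3) L2_diff[OF assms(1,2)]
    by (intro tendsto_L1_AE_subseq) (auto simp: L2_integrable mass_def)
  then obtain r :: "nat \<Rightarrow> nat" where r: "strict_mono r" "AE x in lborel. (\<lambda>n. (norm (F (r n) x - f x))\<^sup>2) \<longlonglongrightarrow> 0"
    by blast
  from r(2) have "AE x in lborel. (\<lambda>n. F (r n) x) \<longlonglongrightarrow> f x"
  proof eventually_elim
    case (elim x)
    then have "(\<lambda>n. sqrt ((norm (F (r n) x - f x))\<^sup>2)) \<longlonglongrightarrow> sqrt 0"
      by (intro tendsto_intros)
    then show ?case
      by (simp add: tendsto_norm_zero_iff LIM_zero_iff)
  qed
  with r(1) show ?thesis by blast
qed

text \<open>The map x \<mapsto> |x| x sends square integrable functions to integrable ones. This
  inequality brings the continuity of translations back from L^1 to L^2, applied to real and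
  imaginary parts separately.\<close>

lemma abs_diff_square_le:
  fixes x y :: real
  shows "(x - y)\<^sup>2 \<le> 2 * \<bar>\<bar>x\<bar> * x - \<bar>y\<bar> * y\<bar>"
proof -
  have same: "(x - y)\<^sup>2 \<le> 2 * \<bar>x * x - y * y\<bar>" if "0 \<le> x * y" for x y :: real
  proof -
    have "\<bar>x - y\<bar> \<le> \<bar>x + y\<bar>" using that by (auto simp: zero_le_mult_iff)
    then have "\<bar>x - y\<bar> * \<bar>x - y\<bar> \<le> \<bar>x - y\<bar> * \<bar>x + y\<bar>" by (intro mult_left_mono) auto
    also have "\<dots> = \<bar>x * x - y * y\<bar>" by (simp add: algebra_simps flip: abs_mult)
    finally have "(x - y)\<^sup>2 \<le> \<bar>x * x - y * y\<bar>" by (simp add: power2_eq_square)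
    then show ?thesis by (rule order_trans) simp
  qed
  have opp: "(x - y)\<^sup>2 \<le> 2 * (x * x + y * y)" for x y :: real
    using zero_le_power2[of "x + y"] by (simp add: power2_eq_square algebra_simps)
  consider "0 \<le> x" "0 \<le> y" | "0 \<le> x" "y < 0" | "x < 0" "0 \<le> y" | "x < 0" "y < 0" by linarith
  then show ?thesis
  proof cases
    case 1 then show ?thesis using same[of x y] by simp
  next
    case 2 then show ?thesis using opp[of x y] by (simp add: abs_real_def zero_le_mult_iff)
  next
    case 3
    have "0 \<le> x * x + y * y" by simp
    with 3 show ?thesis using opp[of x y] by (simp add: abs_real_def)
  next
    case 4 then show ?thesis using same[of x y] mult_nonpos_nonpos[of x y] by (simp add: abs_minus_commute)
  qed
qed

lemma L2_translate_continuous: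
  assumes f: "f \<in> L2" and h: "h \<longlonglongrightarrow> 0"
  shows "(\<lambda>n. mass (\<lambda>x. f (x + h n) - f x)) \<longlonglongrightarrow> 0"
proof -
  have [measurable]: "f \<in> borel_measurable borel" by (rule L2_measurable[OF f])
  define q where "q = (\<lambda>P x. \<bar>P (f x)\<bar> * P (f x) :: real)"
  have iq: "integrable lborel (q P)" if "P = Re \<or> P = Im" for P
  proof (rule Bochner_Integration.integrable_bound[OF L2_integrable[OF f]])
    show "AE x in lborel. norm (q P x) \<le> norm ((norm (f x))\<^sup>2)"
      using that by (auto simp: q_def abs_mult cmod_power2 simp flip: power2_eq_square)
  qed (use that in \<open>auto simp: q_def\<close>)
  let ?d = "\<lambda>P n. LINT x|lborel. norm (q P (x + h n) - q P x)"
  have d: "?d P \<longlonglongrightarrow> 0" if "P = Re \<or> P = Im" for P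
    by (rule L1_translate_continuous[OF iq[OF that] h])
  have le: "mass (\<lambda>x. f (x + h n) - f x) \<le> 2 * ?d Re n + 2 * ?d Im n" for n
  proof -
    have i: "integrable lborel (\<lambda>x. norm (q P (x + h n) - q P x))" if "P = Re \<or> P = Im" for P
      using iq[OF that] integrable_translate_iff[of "q P" "h n"] by auto
    have "mass (\<lambda>x. f (x + h n) - f x) \<le> (LINT x|lborel. 2 * norm (q Re (x + h n) - q Re x) + 2 * norm (q Im (x + h n) - q Im x))"
      unfolding mass_def
    proof (intro integral_mono)
      show "integrable lborel (\<lambda>x. (norm (f (x + h n) - f x))\<^sup>2)"
        by (intro L2_integrable L2_diff L2_translate f)
      show "(norm (f (x + h n) - f x))\<^sup>2 \<le> 2 * norm (q Re (x + h n) - q Re x) + 2 * norm (q Im (x + h n) - q Im x)" for x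
        using abs_diff_square_le[of "Re (f (x + h n))" "Re (f x)"] abs_diff_square_le[of "Im (f (x + h n))" "Im (f x)"]
        by (simp add: q_def cmod_power2)
    qed (use i in auto)
    also have "\<dots> = 2 * ?d Re n + 2 * ?d Im n"
      using i by simp
    finally show ?thesis .
  qed
  have "(\<lambda>n. 2 * ?d Re n + 2 * ?d Im n) \<longlonglongrightarrow> 2 * 0 + 2 * 0"
    by (intro tendsto_intros d) auto
  then have "(\<lambda>n. 2 * ?d Re n + 2 * ?d Im n) \<longlonglongrightarrow> 0" by simp
  then show ?thesis
    by (rule tendsto_zero_le[OF mass_nonneg le])
qed

text \<open>Riesz--Fischer with squared norms only. Along a subsequence the increments d k have mass
  at most 8^-k, so the sum of 2^k |d k|^2 has finite integral. Where it converges, |d k| \<le> 2^k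
  |d k|^2 + 2^-k, which is 2 b \<le> b^2 + 1 for b = 2^k |d k|, gives absolute convergence of the
  increments.\<close>

theorem L2_complete:
  assumes F: "\<And>n. F n \<in> L2"
    and Cauchy: "\<And>e. e > 0 \<Longrightarrow> \<exists>N. \<forall>m\<ge>N. \<forall>n\<ge>N. mass (\<lambda>x. F m x - F n x) \<le> e"
  shows "\<exists>f\<in>L2. (\<lambda>n. mass (\<lambda>x. F n x - f x)) \<longlonglongrightarrow> 0"
proof -
  have [measurable]: "F n \<in> borel_measurable borel" for n using F by (rule L2_measurable)
  have ex: "\<exists>N>M. \<forall>m\<ge>N. \<forall>n\<ge>N. mass (\<lambda>x. F m x - F n x) \<le> (1/8)^k" for k M
  proof -
    have "(0::real) < (1/8)^k" by simp
    from Cauchy[OF this] obtain N where "\<forall>m\<ge>N. \<forall>n\<ge>N. mass (\<lambda>x. F m x - F n x) \<le> (1/8)^k" ..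
    then have "Suc (max N M) > M \<and> (\<forall>m\<ge>Suc (max N M). \<forall>n\<ge>Suc (max N M). mass (\<lambda>x. F m x - F n x) \<le> (1/8)^k)"
      by simp
    then show ?thesis by blast
  qed
  have "\<exists>N::nat\<Rightarrow>nat. \<forall>k. (\<forall>m\<ge>N k. \<forall>n\<ge>N k. mass (\<lambda>x. F m x - F n x) \<le> (1/8)^k) \<and> N k < N (Suc k)"
  proof (rule dependent_nat_choice)
    show "\<exists>N. \<forall>m\<ge>N. \<forall>n\<ge>N. mass (\<lambda>x. F m x - F n x) \<le> (1/8)^0"
      using ex[of 0 0] by blast
    show "\<exists>N'. (\<forall>m\<ge>N'. \<forall>n\<ge>N'. mass (\<lambda>x. F m x - F n x) \<le> (1/8)^Suc k) \<and> N < N'" for N k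
      using ex[of N "Suc k"] by blast
  qed
  then obtain N :: "nat \<Rightarrow> nat" where N: "\<And>k m n. m \<ge> N k \<Longrightarrow> n \<ge> N k \<Longrightarrow> mass (\<lambda>x. F m x - F n x) \<le> (1/8)^k"
    and Nmono: "\<And>k. N k < N (Suc k)" by blast
  define d where "d = (\<lambda>k x. F (N (Suc k)) x - F (N k) x)"
  have dL2: "d k \<in> L2" for k unfolding d_def by (intro L2_diff F)
  have [measurable]: "d k \<in> borel_measurable borel" for k using dL2 by (rule L2_measurable)
  have dm: "mass (d k) \<le> (1/8)^k" for k
    unfolding d_def using Nmono[of k] by (intro N) auto
  have "(\<integral>\<^sup>+x. (\<Sum>k. ennreal (2^k * (norm (d k x))\<^sup>2)) \<partial>lborel) = (\<Sum>k. \<integral>\<^sup>+x. ennreal (2^k * (norm (d k x))\<^sup>2) \<partial>lborel)"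
    by (rule nn_integral_suminf) measurable
  also have "\<dots> = (\<Sum>k. ennreal (2^k * mass (d k)))"
    by (simp add: ennreal_mult nn_integral_cmult nn_integral_mass[OF dL2])
  also have "\<dots> \<le> (\<Sum>k. ennreal ((1/4)^k))"
  proof (intro suminf_le ennreal_leI)
    show "2^k * mass (d k) \<le> (1/4)^k" for k
      using mult_left_mono[OF dm[of k], of "2^k"] by (simp flip: power_mult_distrib)
  qed auto
  also have "\<dots> < \<infinity>"
    by (simp add: suminf_ennreal2 summable_geometric)
  finally have "AE x in lborel. (\<Sum>k. ennreal (2^k * (norm (d k x))\<^sup>2)) \<noteq> \<infinity>"
    by (intro nn_integral_noteq_infinite) auto
  then have conv: "AE x in lborel. convergent (\<lambda>k. F (N k) x)"
  proof eventually_elim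
    case (elim x)
    then have s: "summable (\<lambda>k. 2^k * (norm (d k x))\<^sup>2)"
      by (intro summable_suminf_not_top) auto
    have "summable (\<lambda>k. norm (d k x))"
    proof (rule summable_comparison_test)
      show "summable (\<lambda>k. 2^k * (norm (d k x))\<^sup>2 + (1/2)^k)"
        by (intro summable_add s summable_geometric) auto
      show "\<exists>N. \<forall>n\<ge>N. norm (norm (d n x)) \<le> 2 ^ n * (norm (d n x))\<^sup>2 + (1 / 2) ^ n"
      proof (intro exI allI impI)
        fix n
        let ?a = "norm (d n x)"
        have "2 * (2^n * ?a) \<le> (2^n * ?a)\<^sup>2 + 1"
          using sum_squares_bound[of "2^n * ?a" 1] by simp
        then have "(1/2)^n * (2 * (2^n * ?a)) \<le> (1/2)^n * ((2^n * ?a)\<^sup>2 + 1)"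
          by (intro mult_left_mono) auto
        moreover have "(1/2)^n * (2 * (2^n * ?a)) = 2 * ?a"
          by (simp add: power_divide)
        moreover have "(1/2)^n * ((2^n * ?a)\<^sup>2 + 1) = 2^n * ?a\<^sup>2 + (1/2)^n"
          by (simp add: power_divide power_mult_distrib field_simps power2_eq_square)
        ultimately have "2 * ?a \<le> 2^n * ?a\<^sup>2 + (1/2)^n" by linarith
        then have "?a \<le> 2 ^ n * ?a\<^sup>2 + (1 / 2) ^ n"
          using norm_ge_zero[of "d n x"] by linarith
        then show "norm (norm (d n x)) \<le> 2 ^ n * (norm (d n x))\<^sup>2 + (1 / 2) ^ n"
          by simp
      qed
    qed
    then have "summable (\<lambda>k. d k x)" by (rule summable_norm_cancel)
    then have "convergent (\<lambda>n. (\<Sum>k<n. d k x) + F (N 0) x)"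
      by (intro convergent_add convergent_const) (simp add: summable_iff_convergent)
    moreover have "(\<Sum>k<n. d k x) + F (N 0) x = F (N n) x" for n
      unfolding d_def by (induction n) (auto simp: algebra_simps)
    ultimately show ?case by simp
  qed
  define f where "f = (\<lambda>x. lim (\<lambda>k. F (N k) x))"
  have [measurable]: "f \<in> borel_measurable borel"
    unfolding f_def by (rule borel_measurable_lim_metric) measurable
  have lim: "AE x in lborel. (\<lambda>k. F (N k) x) \<longlonglongrightarrow> f x"
    using conv by eventually_elim (simp add: f_def convergent_LIMSEQ_iff)
  have Nk: "k \<le> N k" for k
  proof (induction k)
    case (Suc k) then show ?case using Nmono[of k] by simp
  qed simp
  \<comment> \<open>Fatou's lemma in the second index of the Cauchy condition. It yields both that f
    is in L^2, as a difference of two such functions, and the rate of convergence of the whole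
    sequence.\<close>
  have key: "(\<lambda>x. F n x - f x) \<in> L2 \<and> mass (\<lambda>x. F n x - f x) \<le> e"
    if e: "e > 0" and n: "\<And>m. m \<ge> M \<Longrightarrow> mass (\<lambda>x. F n x - F m x) \<le> e" for n M e
  proof -
    let ?G = "\<lambda>k x. F n x - F (N (k + M)) x"
    have 1: "?G k \<in> L2" for k by (intro L2_diff F)
    have 2: "AE x in lborel. (\<lambda>k. ?G k x) \<longlonglongrightarrow> F n x - f x"
      using lim by eventually_elim (intro tendsto_intros LIMSEQ_ignore_initial_segment)
    have 3: "mass (?G k) \<le> e" for k
      using Nk[of "k + M"] by (intro n) auto
    show ?thesis using L2_Fatou[OF 1 _ 2 3] by auto
  qed
  obtain M where "\<And>m n. m \<ge> M \<Longrightarrow> n \<ge> M \<Longrightarrow> mass (\<lambda>x. F n x - F m x) \<le> 1"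
    using Cauchy[of 1] by auto
  then have "(\<lambda>x. F M x - f x) \<in> L2" using key[of 1 M M] by auto
  then have fL2: "f \<in> L2"
    using L2_diff[OF F[of M], of "\<lambda>x. F M x - f x"] by simp
  have "(\<lambda>n. mass (\<lambda>x. F n x - f x)) \<longlonglongrightarrow> 0"
  proof (rule LIMSEQ_I)
    fix r :: real assume "r > 0"
    then obtain M where M: "\<forall>m\<ge>M. \<forall>n\<ge>M. mass (\<lambda>x. F m x - F n x) \<le> r / 2"
      using Cauchy[of "r / 2"] by auto
    have "mass (\<lambda>x. F n x - f x) \<le> r / 2" if "n \<ge> M" for n
      using key[of "r / 2" M n] M that \<open>r > 0\<close> by simp
    then have "mass (\<lambda>x. F n x - f x) < r" if "n \<ge> M" for n
      using \<open>r > 0\<close> that by fastforce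
    then have "\<forall>n\<ge>M. norm (mass (\<lambda>x. F n x - f x) - 0) < r"
      by simp
    then show "\<exists>no. \<forall>n\<ge>no. norm (mass (\<lambda>x. F n x - f x) - 0) < r" ..
  qed
  with fL2 show ?thesis by blast
qed

subsection \<open>The Fourier transform on \<open>L\<^sup>1\<close>\<close>

text \<open>Lebesgue measure is the image of the product measure under the coordinate map, so
  integrals of products of functions of one coordinate factor. This reduces the three-dimensional
  Gaussian to the one-dimensional one.\<close>

lemma lborel_prod_Basis:
  fixes f :: "'a::euclidean_space \<Rightarrow> real \<Rightarrow> complex"
  assumes "\<And>b. b \<in> Basis \<Longrightarrow> integrable lborel (f b)"
  shows "integrable lborel (\<lambda>x::'a. \<Prod>b\<in>Basis. f b (x \<bullet> b))" (is ?I)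
    and "(LINT x::'a|lborel. (\<Prod>b\<in>Basis. f b (x \<bullet> b))) = (\<Prod>b\<in>Basis. LINT t|lborel. f b t)" (is ?E)
proof -
  interpret product_sigma_finite "\<lambda>b::'a. lborel :: real measure" by standard
  have [measurable]: "f b \<in> borel_measurable borel" if "b \<in> Basis" for b
    using assms[OF that] by auto
  have m [measurable]: "(\<lambda>x::'a. \<Prod>b\<in>Basis. f b (x \<bullet> b)) \<in> borel_measurable borel"
    by measurable
  have eq: "(\<Prod>b\<in>Basis. f b ((\<Sum>c\<in>Basis. g c *\<^sub>R c) \<bullet> b)) = (\<Prod>b\<in>Basis. f b (g b))" for g :: "'a \<Rightarrow> real"
    by (intro prod.cong) auto
  have "integrable (distr (\<Pi>\<^sub>M b\<in>Basis. lborel) borel (\<lambda>g. \<Sum>b\<in>Basis. g b *\<^sub>R b)) (\<lambda>x::'a. \<Prod>b\<in>Basis. f b (x \<bullet> b))"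
    by (subst integrable_distr_eq) (auto simp: eq intro!: product_integrable_prod assms)
  then show ?I by (subst lborel_eq)
  have "(LINT x|distr (\<Pi>\<^sub>M b\<in>Basis. lborel) borel (\<lambda>g. \<Sum>b\<in>Basis. g b *\<^sub>R b). (\<Prod>b\<in>Basis. f b ((x::'a) \<bullet> b)))
     = (\<Prod>b\<in>Basis. LINT t|lborel. f b t)"
    by (subst integral_distr) (auto simp: eq intro!: product_integral_prod assms)
  then show ?E by (subst lborel_eq)
qed

lemma borel_measurable_cis [measurable]: "f \<in> borel_measurable M \<Longrightarrow> (\<lambda>x. cis (f x)) \<in> borel_measurable M"
  unfolding cis_conv_exp by measurable

definition gauss :: "'a::euclidean_space \<Rightarrow> real" where
  "gauss x = exp (- (norm x)\<^sup>2 / 2)"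

lemma gauss_prod: "gauss (x::'a::euclidean_space) = (\<Prod>b\<in>Basis. exp (- (x \<bullet> b)\<^sup>2 / 2))"
proof -
  have "(norm x)\<^sup>2 = (\<Sum>b\<in>Basis. (x \<bullet> b)\<^sup>2)"
    unfolding power2_norm_eq_inner by (subst euclidean_inner) (simp add: power2_eq_square)
  then show ?thesis
    by (simp add: gauss_def sum_divide_distrib exp_sum flip: sum_negf)
qed

lemma gauss_bounds: "0 < gauss x" "gauss x \<le> 1"
  by (auto simp: gauss_def)

lemma gauss_measurable [measurable]: "gauss \<in> borel_measurable borel"
  unfolding gauss_def by measurable

text \<open>Up to the normalization sqrt (2 \<pi>) this is the characteristic function of the
  standard normal law, taken at -t because of the sign convention in \<open>fourier\<close>.\<close>

lemma gauss_fourier_1: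
  "integrable lborel (\<lambda>x::real. cis (- (x * t)) * of_real (exp (- x\<^sup>2 / 2)))"
  "(LINT x::real|lborel. cis (- (x * t)) * of_real (exp (- x\<^sup>2 / 2))) = of_real (sqrt (2 * pi) * exp (- t\<^sup>2 / 2))"
proof -
  have d: "exp (- x\<^sup>2 / 2) = sqrt (2 * pi) * std_normal_density x" for x :: real
    by (simp add: std_normal_density_def)
  have "integrable lborel (\<lambda>x::real. of_real (sqrt (2 * pi)) * (of_real (std_normal_density x) :: complex))"
    using integrable_std_normal_moment[of 0] by (intro integrable_mult_right integrable_of_real) simp
  then have i0: "integrable lborel (\<lambda>x::real. complex_of_real (exp (- x\<^sup>2 / 2)))"
    unfolding d by simp
  show i: "integrable lborel (\<lambda>x::real. cis (- (x * t)) * of_real (exp (- x\<^sup>2 / 2)))"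
    by (rule Bochner_Integration.integrable_bound[OF i0]) (auto simp: norm_mult)
  have "char std_normal_distribution (- t) = (LINT x|lborel. std_normal_density x *\<^sub>R cis (- (x * t)))"
    unfolding char_def
    by (subst integral_density) (auto simp: cis_conv_exp normal_density_nonneg mult.commute)
  then have "(LINT x|lborel. std_normal_density x *\<^sub>R cis (- (x * t))) = of_real (exp (- t\<^sup>2 / 2))"
    by (simp add: char_std_normal_distribution)
  moreover have "(LINT x::real|lborel. cis (- (x * t)) * of_real (exp (- x\<^sup>2 / 2))) =
     (LINT x|lborel. of_real (sqrt (2 * pi)) * (std_normal_density x *\<^sub>R cis (- (x * t))))"
    unfolding d by (intro Bochner_Integration.integral_cong) (auto simp: scaleR_conv_of_real)
  ultimately show "(LINT x::real|lborel. cis (- (x * t)) * of_real (exp (- x\<^sup>2 / 2))) = of_real (sqrt (2 * pi) * exp (- t\<^sup>2 / 2))"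
    by (simp only: integral_mult_right_zero of_real_mult)
qed

lemma cis_sum: "finite A \<Longrightarrow> cis (\<Sum>a\<in>A. f a) = (\<Prod>a\<in>A. cis (f a))"
  by (induction A rule: finite_induct) (auto simp: cis_mult[symmetric])

lemma integrable_gauss: "integrable lborel (\<lambda>x::real^3. complex_of_real (gauss x))"
  and fourier_gauss: "fourier (\<lambda>x. of_real (gauss x)) \<xi> = of_real (sqrt (2 * pi) ^ 3 * gauss \<xi>)"
proof -
  have c: "cis (- (x \<bullet> \<xi>)) * of_real (gauss x) = (\<Prod>b\<in>Basis. cis (- ((x \<bullet> b) * (\<xi> \<bullet> b))) * of_real (exp (- (x \<bullet> b)\<^sup>2 / 2)))"
    for x \<xi> :: "real^3"
    unfolding gauss_prod prod.distrib of_real_prod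
    by (subst euclidean_inner) (simp add: cis_sum[symmetric] sum_negf)
  show "integrable lborel (\<lambda>x::real^3. complex_of_real (gauss x))"
    using lborel_prod_Basis(1)[of "\<lambda>b::real^3. \<lambda>x. cis (- (x * (0 \<bullet> b))) * of_real (exp (- x\<^sup>2 / 2))", OF gauss_fourier_1(1)]
      c[of _ 0] by simp
  show "fourier (\<lambda>x. of_real (gauss x)) \<xi> = of_real (sqrt (2 * pi) ^ 3 * gauss \<xi>)"
    unfolding fourier_def c
    by (subst lborel_prod_Basis(2)[OF gauss_fourier_1(1)])
       (simp only: gauss_fourier_1(2), simp add: gauss_prod prod.distrib)
qed

lemma integral_gauss: "(LINT x::real^3|lborel. gauss x) = sqrt (2 * pi) ^ 3"
proof -
  have "complex_of_real (LINT x::real^3|lborel. gauss x) = complex_of_real (sqrt (2 * pi) ^ 3 * gauss (0::real^3))"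
    unfolding fourier_gauss[symmetric] by (simp add: fourier_def)
  then show ?thesis by (simp only: of_real_eq_iff) (simp add: gauss_def)
qed

lemma fourier_integrable: "integrable lborel f \<Longrightarrow> integrable lborel (\<lambda>x. cis (- (x \<bullet> \<xi>)) * f x)"
  by (rule Bochner_Integration.integrable_bound[of _ f]) (auto simp: norm_mult)

lemma fourier_add:
  "integrable lborel f \<Longrightarrow> integrable lborel g \<Longrightarrow> fourier (\<lambda>x. f x + g x) \<xi> = fourier f \<xi> + fourier g \<xi>"
  by (simp add: fourier_def distrib_left fourier_integrable)

lemma fourier_diff:
  "integrable lborel f \<Longrightarrow> integrable lborel g \<Longrightarrow> fourier (\<lambda>x. f x - g x) \<xi> = fourier f \<xi> - fourier g \<xi>"
  by (simp add: fourier_def right_diff_distrib fourier_integrable)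

lemma fourier_cmult: "fourier (\<lambda>x. c * f x) \<xi> = c * fourier f \<xi>"
  by (simp add: fourier_def mult.left_commute)

lemma norm_fourier_le: "norm (fourier f \<xi>) \<le> (LINT x|lborel. norm (f x))"
proof -
  have "norm (fourier f \<xi>) \<le> (LINT x|lborel. norm (cis (- (x \<bullet> \<xi>)) * f x))"
    unfolding fourier_def by (rule integral_norm_bound)
  then show ?thesis by (simp add: norm_mult)
qed

lemma fourier_measurable [measurable]:
  assumes [measurable]: "f \<in> borel_measurable borel"
  shows "fourier f \<in> borel_measurable borel"
  unfolding fourier_def[abs_def] by measurable

lemma fourier_dilate:
  assumes "c \<noteq> 0"
  shows "fourier (\<lambda>x. f (c *\<^sub>R x)) \<xi> = fourier f ((1 / c) *\<^sub>R \<xi>) / \<bar>c\<bar>^3"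
proof -
  have "fourier (\<lambda>x. f (c *\<^sub>R x)) \<xi> = (LINT x|lborel. cis (- ((c *\<^sub>R x) \<bullet> ((1 / c) *\<^sub>R \<xi>))) * f (c *\<^sub>R x))"
    using assms unfolding fourier_def by simp
  also have "\<dots> = (1 / \<bar>c\<bar>^3) *\<^sub>R fourier f ((1 / c) *\<^sub>R \<xi>)"
    unfolding fourier_def
    by (subst integral_dilate[OF assms, of "\<lambda>x. cis (- (x \<bullet> ((1 / c) *\<^sub>R \<xi>))) * f x"]) simp
  finally show ?thesis by (simp add: scaleR_conv_of_real)
qed

lemma fourier_translate: "fourier (\<lambda>x. f (x + a)) \<xi> = cis (a \<bullet> \<xi>) * fourier f \<xi>"
proof -
  have "fourier (\<lambda>x. f (x + a)) \<xi> = (LINT x|lborel. cis (a \<bullet> \<xi>) * (cis (- ((x + a) \<bullet> \<xi>)) * f (x + a)))"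
    unfolding fourier_def
    by (intro Bochner_Integration.integral_cong) (auto simp: inner_add_left cis_mult mult.assoc[symmetric])
  also have "\<dots> = cis (a \<bullet> \<xi>) * fourier f \<xi>"
    unfolding fourier_def integral_mult_right_zero
    by (subst integral_translate[of "\<lambda>x. cis (- (x \<bullet> \<xi>)) * f x"]) simp
  finally show ?thesis .
qed

lemma integrable_fourier_kernel:
  assumes "integrable lborel f" "integrable lborel g"
  shows "integrable (lborel \<Otimes>\<^sub>M lborel) (\<lambda>(x, y). cis (- (x \<bullet> y)) * f x * g y :: complex)"
proof (rule lborel_pair.Fubini_integrable)
  have [measurable]: "f \<in> borel_measurable borel" "g \<in> borel_measurable borel" using assms by auto
  show "(\<lambda>(x, y). cis (- (x \<bullet> y)) * f x * g y) \<in> borel_measurable (lborel \<Otimes>\<^sub>M lborel)" by measurable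
  show "integrable lborel (\<lambda>x. LINT y|lborel. norm (case (x, y) of (x, y) \<Rightarrow> cis (- (x \<bullet> y)) * f x * g y))"
    using assms by (simp add: norm_mult)
  show "AE x in lborel. integrable lborel (\<lambda>y. case (x, y) of (x, y) \<Rightarrow> cis (- (x \<bullet> y)) * f x * g y)"
  proof (intro AE_I2)
    fix x :: 'a
    show "integrable lborel (\<lambda>y. case (x, y) of (x, y) \<Rightarrow> cis (- (x \<bullet> y)) * f x * g y)"
      by (rule Bochner_Integration.integrable_bound[of _ "\<lambda>y. f x * g y"]) (use assms in \<open>auto simp: norm_mult\<close>)
  qed
qed

text \<open>The kernel cis (- x \<bullet> y) is symmetric, so Fubini moves the transform from one
  factor to the other. With a Gaussian as g this is the regularized inversion formula behind
  Plancherel's theorem.\<close>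

lemma fourier_multiplication:
  assumes "integrable lborel f" "integrable lborel g"
  shows "(LINT \<xi>|lborel. fourier f \<xi> * g \<xi>) = (LINT x|lborel. f x * fourier g x)"
proof -
  have "(LINT \<xi>|lborel. fourier f \<xi> * g \<xi>) = (LINT y|lborel. LINT x|lborel. cis (- (x \<bullet> y)) * f x * g y)"
    by (simp add: fourier_def)
  also have "\<dots> = (LINT x|lborel. LINT y|lborel. cis (- (x \<bullet> y)) * f x * g y)"
    by (rule lborel_pair.Fubini_integral[OF integrable_fourier_kernel[OF assms]])
  also have "\<dots> = (LINT x|lborel. LINT y|lborel. f x * (cis (- (y \<bullet> x)) * g y))"
    by (intro Bochner_Integration.integral_cong refl) (auto simp: inner_commute)
  finally show ?thesis by (simp add: fourier_def)
qed

subsection \<open>Plancherel's theorem\<close>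

lemma autocorrelation_integrable:
  assumes "integrable lborel f"
  shows "integrable (lborel \<Otimes>\<^sub>M lborel) (\<lambda>(x::real^3, z). cis (- (z \<bullet> \<xi>)) * (f (x + z) * cnj (f x)))"
proof (rule lborel_pair.Fubini_integrable)
  have [measurable]: "f \<in> borel_measurable borel" using assms by auto
  have [measurable]: "cnj \<in> borel_measurable borel"
    by (intro borel_measurable_continuous_onI continuous_intros)
  show "(\<lambda>(x, z). cis (- (z \<bullet> \<xi>)) * (f (x + z) * cnj (f x))) \<in> borel_measurable (lborel \<Otimes>\<^sub>M lborel)"
    by measurable
  have "(LINT z|lborel. norm (f (x + z))) = (LINT z|lborel. norm (f z))" for x
    using integral_translate[of "\<lambda>z. norm (f z)" x] by (simp add: add.commute)
  then show "integrable lborel (\<lambda>x. LINT z|lborel. norm (case (x, z) of (x, z) \<Rightarrow> cis (- (z \<bullet> \<xi>)) * (f (x + z) * cnj (f x))))"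
    using assms by (simp add: norm_mult)
  show "AE x in lborel. integrable lborel (\<lambda>z. case (x, z) of (x, z) \<Rightarrow> cis (- (z \<bullet> \<xi>)) * (f (x + z) * cnj (f x)))"
  proof (intro AE_I2)
    fix x :: "real^3"
    have "integrable lborel (\<lambda>z. f (x + z) * cnj (f x))"
      using integrable_translate_iff[of f x] assms by (simp add: add.commute)
    from fourier_integrable[OF this, of \<xi>]
    show "integrable lborel (\<lambda>z. case (x, z) of (x, z) \<Rightarrow> cis (- (z \<bullet> \<xi>)) * (f (x + z) * cnj (f x)))"
      by simp
  qed
qed

text \<open>The autocorrelation \<rho> has transform |F f|^2, where F f is the transform of f, and
  takes the value \<open>mass f\<close> at 0. Plancherel's theorem thus becomes the inversion
  formula for \<rho> at the single point 0.\<close>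

lemma fourier_autocorrelation:
  assumes "integrable lborel f"
  defines "\<rho> \<equiv> \<lambda>z. l2_inner (\<lambda>x. f (x + z)) f"
  shows "integrable lborel \<rho>" "fourier \<rho> \<xi> = of_real ((norm (fourier f \<xi>))\<^sup>2)"
proof -
  show "integrable lborel \<rho>"
    using lborel_pair.integrable_snd[OF autocorrelation_integrable[OF assms(1), of 0]]
    by (simp add: \<rho>_def l2_inner_def)
  have "fourier \<rho> \<xi> = (LINT z|lborel. LINT x|lborel. cis (- (z \<bullet> \<xi>)) * (f (x + z) * cnj (f x)))"
    by (simp add: \<rho>_def l2_inner_def fourier_def)
  also have "\<dots> = (LINT x|lborel. LINT z|lborel. cis (- (z \<bullet> \<xi>)) * (f (x + z) * cnj (f x)))"
    by (rule lborel_pair.Fubini_integral[OF autocorrelation_integrable[OF assms(1), of \<xi>]])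
  also have "\<dots> = (LINT x|lborel. fourier (\<lambda>z. f (z + x)) \<xi> * cnj (f x))"
    by (simp add: fourier_def mult.assoc[symmetric] add.commute)
  also have "\<dots> = (LINT x|lborel. fourier f \<xi> * cnj (cis (- (x \<bullet> \<xi>)) * f x))"
    by (simp add: fourier_translate cis_cnj mult_ac)
  also have "\<dots> = fourier f \<xi> * cnj (fourier f \<xi>)"
    unfolding integral_mult_right_zero fourier_def by (subst Bochner_Integration.integral_cnj) simp
  finally show "fourier \<rho> \<xi> = of_real ((norm (fourier f \<xi>))\<^sup>2)"
    by (simp only: complex_norm_square)
qed

text \<open>|F f|^2 is integrated against the wide Gaussian
  \<open>gauss (\<eta> n *\<^sub>R \<xi>)\<close>. By the multiplication formula this is an average
  of the autocorrelation \<rho> against a narrow Gaussian, which tends to a multiple of \<rho> 0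
  because \<rho> is bounded and continuous at 0.\<close>

theorem Plancherel_L1_L2:
  assumes i: "integrable lborel f" and f: "f \<in> L2"
  shows "fourier f \<in> L2" "mass (fourier f) = (2 * pi)^3 * mass f"
proof -
  have [measurable]: "f \<in> borel_measurable borel" using i by auto
  define \<rho> where "\<rho> = (\<lambda>z. l2_inner (\<lambda>x. f (x + z)) f)"
  have \<rho>i: "integrable lborel \<rho>" and \<rho>F: "fourier \<rho> \<xi> = of_real ((norm (fourier f \<xi>))\<^sup>2)" for \<xi>
    using fourier_autocorrelation[OF i] unfolding \<rho>_def by auto
  have [measurable]: "\<rho> \<in> borel_measurable borel" using \<rho>i by auto
  have \<rho>b: "norm (\<rho> z) \<le> mass f" for z
    using l2_inner_Cauchy_Schwarz[OF L2_translate[OF f] f, of z] unfolding \<rho>_def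
    by (simp add: mass_translate)
  define \<eta> where "\<eta> = (\<lambda>n. 1 / real (Suc n))"
  have \<eta>: "\<eta> n > 0" for n by (simp add: \<eta>_def)
  have \<eta>0: "\<eta> \<longlonglongrightarrow> 0" unfolding \<eta>_def using LIMSEQ_inverse_real_of_nat by (simp add: inverse_eq_divide)
  have \<rho>lim: "(\<lambda>n. \<rho> (\<eta> n *\<^sub>R z)) \<longlonglongrightarrow> \<rho> 0" for z
  proof -
    have "(\<lambda>n. \<eta> n *\<^sub>R z) \<longlonglongrightarrow> 0" using tendsto_scaleR[OF \<eta>0 tendsto_const[of z]] by simp
    from L2_translate_continuous[OF f this] show ?thesis
      unfolding \<rho>_def by (intro l2_inner_tendsto) (auto intro: L2_translate f simp: mass_def)
  qed
  let ?I = "\<lambda>n. LINT \<xi>|lborel. complex_of_real (gauss (\<eta> n *\<^sub>R \<xi>)) * of_real ((norm (fourier f \<xi>))\<^sup>2)"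
  let ?c = "complex_of_real (sqrt (2 * pi) ^ 3)"
  have gi: "integrable lborel (\<lambda>x::real^3. complex_of_real (gauss (\<eta> n *\<^sub>R x)))" for n
    using integrable_dilate_iff[of "\<eta> n" "\<lambda>x::real^3. complex_of_real (gauss x)"] \<eta>[of n] integrable_gauss by simp
  have eq: "?I n = ?c * (LINT z|lborel. of_real (gauss z) * \<rho> (\<eta> n *\<^sub>R z))" for n
  proof -
    have "?I n = (LINT \<xi>|lborel. fourier \<rho> \<xi> * of_real (gauss (\<eta> n *\<^sub>R \<xi>)))"
      by (simp add: \<rho>F mult.commute)
    also have "\<dots> = (LINT z|lborel. \<rho> z * fourier (\<lambda>\<xi>. of_real (gauss (\<eta> n *\<^sub>R \<xi>))) z)"
      by (rule fourier_multiplication[OF \<rho>i gi])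
    also have "\<dots> = (LINT z|lborel. (?c / \<bar>\<eta> n\<bar>^3) * (of_real (gauss ((1 / \<eta> n) *\<^sub>R z)) * \<rho> z))"
      using \<eta>[of n] by (subst fourier_dilate[of "\<eta> n" "\<lambda>x. of_real (gauss x)"]) (auto simp: fourier_gauss mult_ac)
    also have "\<dots> = (?c / \<bar>\<eta> n\<bar>^3) * (LINT z|lborel. of_real (gauss ((1 / \<eta> n) *\<^sub>R z)) * \<rho> z)"
      by (rule integral_mult_right_zero)
    also have "(LINT z|lborel. of_real (gauss ((1 / \<eta> n) *\<^sub>R z)) * \<rho> z) = \<bar>\<eta> n\<bar>^3 *\<^sub>R (LINT z|lborel. of_real (gauss z) * \<rho> (\<eta> n *\<^sub>R z))"
      using \<eta>[of n] integral_dilate[of "1 / \<eta> n" "\<lambda>z. of_real (gauss z) * \<rho> (\<eta> n *\<^sub>R z)"]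
      by (simp add: power_one_over)
    finally show ?thesis using \<eta>[of n] by (simp add: scaleR_conv_of_real)
  qed
  have "(\<lambda>n. LINT z|lborel. of_real (gauss z) * \<rho> (\<eta> n *\<^sub>R z)) \<longlonglongrightarrow> (LINT z::real^3|lborel. of_real (gauss z) * \<rho> 0)"
  proof (rule integral_dominated_convergence[where w="\<lambda>z. norm (complex_of_real (gauss z)) * mass f"])
    show "integrable lborel (\<lambda>z::real^3. norm (complex_of_real (gauss z)) * mass f)"
      using integrable_gauss by (intro integrable_mult_left integrable_norm)
    show "AE z in lborel. (\<lambda>n. complex_of_real (gauss z) * \<rho> (\<eta> n *\<^sub>R z)) \<longlonglongrightarrow> complex_of_real (gauss z) * \<rho> 0"
      by (intro AE_I2 tendsto_intros \<rho>lim)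
    show "AE z in lborel. norm (complex_of_real (gauss z) * \<rho> (\<eta> n *\<^sub>R z)) \<le> norm (complex_of_real (gauss z)) * mass f" for n
      unfolding norm_mult by (intro AE_I2 mult_left_mono \<rho>b) auto
  qed measurable
  also have "(LINT z|lborel. of_real (gauss (z::real^3)) * \<rho> 0) = ?c * of_real (mass f)"
    by (simp add: integral_gauss \<rho>_def l2_inner_self)
  finally have Ilim0: "?I \<longlonglongrightarrow> ?c * (?c * of_real (mass f))"
    unfolding eq by (intro tendsto_intros)
  have c2: "?c * (?c * of_real (mass f)) = of_real ((2 * pi)^3 * mass f)"
  proof -
    have "sqrt (2 * pi) ^ 3 * sqrt (2 * pi) ^ 3 = (sqrt (2 * pi) * sqrt (2 * pi))^3"
      by (rule power_mult_distrib[symmetric])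
    also have "\<dots> = (2 * pi)^3" by simp
    finally have "sqrt (2 * pi) ^ 3 * (sqrt (2 * pi) ^ 3 * mass f) = (2 * pi)^3 * mass f"
      by (simp only: mult.assoc[symmetric])
    then show ?thesis by (simp only: of_real_mult[symmetric])
  qed
  \<comment> \<open>The square root gives the squared norm of G the full Gaussian weight. Fatou's
    lemma then applies to G although \<open>fourier f\<close> is not yet known to be in L^2.\<close>
  let ?G = "\<lambda>n \<xi>. complex_of_real (sqrt (gauss (\<eta> n *\<^sub>R \<xi>))) * fourier f \<xi>"
  have nG: "(norm (?G n \<xi>))\<^sup>2 = gauss (\<eta> n *\<^sub>R \<xi>) * (norm (fourier f \<xi>))\<^sup>2" for n \<xi>
    using gauss_bounds(1)[of "\<eta> n *\<^sub>R \<xi>"] by (simp add: norm_mult power_mult_distrib)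
  have GL2: "?G n \<in> L2" for n
  proof (rule L2I)
    have gir: "integrable lborel (\<lambda>x::real^3. gauss (\<eta> n *\<^sub>R x))"
      using gi[of n] by (simp add: complex_of_real_integrable_eq)
    show "integrable lborel (\<lambda>x. (norm (?G n x))\<^sup>2)"
      unfolding nG
    proof (rule Bochner_Integration.integrable_bound[OF integrable_mult_left[OF gir]])
      show "AE x in lborel. norm (gauss (\<eta> n *\<^sub>R x) * (norm (fourier f x))\<^sup>2) \<le> norm (gauss (\<eta> n *\<^sub>R x) * (LINT x|lborel. norm (f x))\<^sup>2)"
        using norm_fourier_le[of f]
        by (intro AE_I2) (auto simp: abs_mult intro!: mult_left_mono power_mono)
    qed measurable
  qed measurable
  have Im: "?I n = of_real (mass (?G n))" for n
    unfolding mass_def nG by (simp flip: integral_complex_of_real)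
  have "(\<lambda>n. complex_of_real (mass (?G n))) \<longlonglongrightarrow> of_real ((2 * pi)^3 * mass f)"
    using Ilim0 unfolding Im c2 .
  then have mlim: "(\<lambda>n. mass (?G n)) \<longlonglongrightarrow> (2 * pi)^3 * mass f"
    by (simp only: tendsto_of_real_iff)
  have glim: "(\<lambda>n. gauss (\<eta> n *\<^sub>R \<xi>)) \<longlonglongrightarrow> 1" for \<xi> :: "real^3"
  proof -
    have "(\<lambda>n. gauss (\<eta> n *\<^sub>R \<xi>)) \<longlonglongrightarrow> exp (- (norm (0 *\<^sub>R \<xi>))\<^sup>2 / 2)"
      unfolding gauss_def by (intro tendsto_intros \<eta>0) auto
    then show ?thesis by simp
  qed
  obtain C where C: "\<And>n. mass (?G n) \<le> C"
  proof -
    have "Bseq (\<lambda>n. mass (?G n))" by (rule convergent_imp_Bseq[OF convergentI[OF mlim]])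
    then obtain K where "\<forall>n. norm (mass (?G n)) \<le> K" by (rule BseqE)
    then have "mass (?G n) \<le> K" for n by (metis abs_le_D1 real_norm_def)
    then show ?thesis by (rule that)
  qed
  have "AE \<xi> in lborel. (\<lambda>n. ?G n \<xi>) \<longlonglongrightarrow> fourier f \<xi>"
  proof (intro AE_I2)
    fix \<xi>
    have "(\<lambda>n. ?G n \<xi>) \<longlonglongrightarrow> complex_of_real (sqrt 1) * fourier f \<xi>"
      by (intro tendsto_intros glim)
    then show "(\<lambda>n. ?G n \<xi>) \<longlonglongrightarrow> fourier f \<xi>" by simp
  qed
  from L2_Fatou(1)[OF GL2 _ this C] show L: "fourier f \<in> L2" by measurable
  \<comment> \<open>Now that \<open>fourier f\<close> is in L^2, its squared norm serves as the
    majorant that turns the bound into the exact value.\<close>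
  have "(\<lambda>n. LINT \<xi>|lborel. gauss (\<eta> n *\<^sub>R \<xi>) * (norm (fourier f \<xi>))\<^sup>2) \<longlonglongrightarrow> (LINT \<xi>|lborel. (norm (fourier f \<xi>))\<^sup>2)"
  proof (rule integral_dominated_convergence[where w="\<lambda>\<xi>. (norm (fourier f \<xi>))\<^sup>2"])
    show "AE \<xi> in lborel. (\<lambda>n. gauss (\<eta> n *\<^sub>R \<xi>) * (norm (fourier f \<xi>))\<^sup>2) \<longlonglongrightarrow> (norm (fourier f \<xi>))\<^sup>2"
    proof (intro AE_I2)
      fix \<xi>
      show "(\<lambda>n. gauss (\<eta> n *\<^sub>R \<xi>) * (norm (fourier f \<xi>))\<^sup>2) \<longlonglongrightarrow> (norm (fourier f \<xi>))\<^sup>2"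
        using tendsto_mult_right[OF glim[of \<xi>], of "(norm (fourier f \<xi>))\<^sup>2"] by simp
    qed
    show "AE \<xi> in lborel. norm (gauss (\<eta> n *\<^sub>R \<xi>) * (norm (fourier f \<xi>))\<^sup>2) \<le> (norm (fourier f \<xi>))\<^sup>2" for n
      by (intro AE_I2) (auto simp: abs_mult abs_of_pos[OF gauss_bounds(1)] gauss_bounds(2) gauss_bounds(1)[THEN less_imp_le]
          intro!: mult_left_le_one_le)
  qed (use L2_integrable[OF L] in measurable)
  then have "(\<lambda>n. mass (?G n)) \<longlonglongrightarrow> mass (fourier f)"
    unfolding mass_def nG .
  then show "mass (fourier f) = (2 * pi)^3 * mass f"
    by (rule LIMSEQ_unique[OF _ mlim])
qed

subsection \<open>The Fourier--Plancherel transform\<close>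

abbreviation trunc :: "nat \<Rightarrow> (real^3 \<Rightarrow> complex) \<Rightarrow> real^3 \<Rightarrow> complex" where
  "trunc n f \<equiv> \<lambda>x. indicator (ball 0 (real n)) x *\<^sub>R f x"

lemma L2_indicator_bounded: "bounded A \<Longrightarrow> A \<in> sets borel \<Longrightarrow> (\<lambda>x. indicator A x :: complex) \<in> L2"
proof (rule L2I)
  assume "bounded A" "A \<in> sets borel"
  then have "emeasure lborel A < \<infinity>" by (intro emeasure_bounded_finite)
  then have "integrable lborel (indicat_real A)" using \<open>A \<in> sets borel\<close> by auto
  moreover have "(\<lambda>x. (norm (indicator A x :: complex))\<^sup>2) = indicat_real A"
    by (auto simp: indicator_def)
  ultimately show "integrable lborel (\<lambda>x. (norm (indicator A x :: complex))\<^sup>2)" by simp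
qed auto

lemma L2_integrable_on_bounded:
  assumes "f \<in> L2" "bounded A" "A \<in> sets borel"
  shows "integrable lborel (\<lambda>x. indicator A x *\<^sub>R f x)"
proof -
  have "(\<lambda>x. indicator A x * f x) = (\<lambda>x. indicator A x *\<^sub>R f x)"
    by (auto simp: indicator_def)
  then show ?thesis
    using L2_mult_integrable[OF L2_indicator_bounded[OF assms(2,3)] assms(1)] by simp
qed

lemma trunc_L2: "f \<in> L2 \<Longrightarrow> trunc n f \<in> L2"
  by (rule L2_indicator) auto

lemma trunc_integrable: "f \<in> L2 \<Longrightarrow> integrable lborel (trunc n f)"
  by (rule L2_integrable_on_bounded) auto

lemma trunc_tendsto:
  assumes "f \<in> L2"
  shows "(\<lambda>n. mass (\<lambda>x. trunc n f x - f x)) \<longlonglongrightarrow> 0"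
proof -
  have [measurable]: "f \<in> borel_measurable borel" by (rule L2_measurable[OF assms])
  have "(\<lambda>n. LINT x|lborel. (norm (trunc n f x - f x))\<^sup>2) \<longlonglongrightarrow> (LINT x::real^3|lborel. 0)"
  proof (rule integral_dominated_convergence[where w="\<lambda>x. (norm (f x))\<^sup>2"])
    show "AE x in lborel. (\<lambda>n. (norm (trunc n f x - f x))\<^sup>2) \<longlonglongrightarrow> 0"
    proof (intro AE_I2)
      fix x :: "real^3"
      obtain N :: nat where "norm x < real N" using reals_Archimedean2 by blast
      then have "\<forall>\<^sub>F n in sequentially. (norm (trunc n f x - f x))\<^sup>2 = 0"
        by (intro eventually_sequentiallyI[of N]) (auto simp: indicator_def)
      then show "(\<lambda>n. (norm (trunc n f x - f x))\<^sup>2) \<longlonglongrightarrow> 0" by (rule tendsto_eventually)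
    qed
    show "AE x in lborel. norm ((norm (trunc n f x - f x))\<^sup>2) \<le> (norm (f x))\<^sup>2" for n
      by (intro AE_I2) (auto simp: indicator_def)
    show "(\<lambda>x. (norm (trunc n f x - f x))\<^sup>2) \<in> borel_measurable lborel" for n
      by (rule borel_measurable_integrable[OF L2_integrable[OF L2_diff[OF trunc_L2[OF assms] assms]]])
  qed (use L2_integrable[OF assms] in auto)
  then show ?thesis by (simp add: mass_def)
qed

text \<open>The definition measures the distance by a nonnegative integral, whereas
  \<open>mass\<close> is a Bochner integral and takes the default value 0 on functions that are not
  square integrable. The two agree here since Plancherel puts the transforms of the truncations into
  L^2.\<close>

lemma is_fourier_L2_iff:
  "is_fourier_L2 f h \<longleftrightarrow> f \<in> L2 \<and> h \<in> L2 \<and> (\<lambda>n. mass (\<lambda>\<xi>. fourier (trunc n f) \<xi> - h \<xi>)) \<longlonglongrightarrow> 0"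
proof (cases "f \<in> L2 \<and> h \<in> L2")
  case True
  then have "(\<lambda>\<xi>. fourier (trunc n f) \<xi> - h \<xi>) \<in> L2" for n
    using Plancherel_L1_L2(1)[OF trunc_integrable trunc_L2] by (intro L2_diff) auto
  then have "(\<integral>\<^sup>+\<xi>. ennreal ((norm (fourier (trunc n f) \<xi> - h \<xi>))\<^sup>2) \<partial>lborel) =
      ennreal (mass (\<lambda>\<xi>. fourier (trunc n f) \<xi> - h \<xi>))" for n
    by (rule nn_integral_mass)
  then show ?thesis
    unfolding is_fourier_L2_def using True tendsto_ennreal_iff[of _ sequentially 0]
    by (simp add: ennreal_0[symmetric] del: ennreal_0)
qed (auto simp: is_fourier_L2_def)

lemma is_fourier_L2D: "is_fourier_L2 f h \<Longrightarrow> f \<in> L2" "is_fourier_L2 f h \<Longrightarrow> h \<in> L2"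
  by (auto simp: is_fourier_L2_def)

lemma mass_fourier_diff:
  assumes "f \<in> L2" "integrable lborel f" "g \<in> L2" "integrable lborel g"
  shows "mass (\<lambda>\<xi>. fourier f \<xi> - fourier g \<xi>) = (2 * pi)^3 * mass (\<lambda>x. f x - g x)"
proof -
  have "(\<lambda>\<xi>. fourier f \<xi> - fourier g \<xi>) = fourier (\<lambda>x. f x - g x)"
    using assms by (simp add: fourier_diff fun_eq_iff)
  then show ?thesis
    using Plancherel_L1_L2(2)[of "\<lambda>x. f x - g x"] assms by (simp add: L2_diff)
qed

text \<open>Frees the transform from the balls in its definition: a translate or dilate of a
  truncation is not the truncation of the translate or dilate, but it is an integrable
  approximation, and any such sequence determines the transform.\<close>

lemma is_fourier_L2I:
  assumes f: "f \<in> L2" and h: "h \<in> L2"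
    and F: "\<And>n. F n \<in> L2" "\<And>n. integrable lborel (F n)"
    and lim: "(\<lambda>n. mass (\<lambda>x. F n x - f x)) \<longlonglongrightarrow> 0" "(\<lambda>n. mass (\<lambda>\<xi>. fourier (F n) \<xi> - h \<xi>)) \<longlonglongrightarrow> 0"
  shows "is_fourier_L2 f h"
proof -
  note t = trunc_L2[OF f] trunc_integrable[OF f]
  let ?b = "\<lambda>n. 2 * ((2 * pi)^3 * (2 * mass (\<lambda>x. trunc n f x - f x) + 2 * mass (\<lambda>x. F n x - f x)))
     + 2 * mass (\<lambda>\<xi>. fourier (F n) \<xi> - h \<xi>)"
  have le: "mass (\<lambda>\<xi>. fourier (trunc n f) \<xi> - h \<xi>) \<le> ?b n" for n
  proof -
    have "mass (\<lambda>\<xi>. fourier (trunc n f) \<xi> - h \<xi>) \<le> 2 * mass (\<lambda>\<xi>. fourier (trunc n f) \<xi> - fourier (F n) \<xi>)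
       + 2 * mass (\<lambda>\<xi>. fourier (F n) \<xi> - h \<xi>)"
      using t F h by (intro mass_diff_triangle Plancherel_L1_L2) auto
    moreover have "mass (\<lambda>\<xi>. fourier (trunc n f) \<xi> - fourier (F n) \<xi>) = (2 * pi)^3 * mass (\<lambda>x. trunc n f x - F n x)"
      using t F by (intro mass_fourier_diff)
    moreover have "mass (\<lambda>x. trunc n f x - F n x) \<le> 2 * mass (\<lambda>x. trunc n f x - f x) + 2 * mass (\<lambda>x. F n x - f x)"
      using mass_diff_triangle[OF t(1)[of n] f F(1)[of n]] mass_minus_commute[of f "F n"] by simp
    then have "(2 * pi)^3 * mass (\<lambda>x. trunc n f x - F n x) \<le> (2 * pi)^3 * (2 * mass (\<lambda>x. trunc n f x - f x) + 2 * mass (\<lambda>x. F n x - f x))"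
      by (intro mult_left_mono) auto
    ultimately show ?thesis by linarith
  qed
  have "?b \<longlonglongrightarrow> 2 * ((2 * pi)^3 * (2 * 0 + 2 * 0)) + 2 * 0"
    by (intro tendsto_intros lim trunc_tendsto[OF f])
  then have "?b \<longlonglongrightarrow> 0" by simp
  from tendsto_zero_le[OF mass_nonneg le this] show ?thesis
    unfolding is_fourier_L2_iff using f h by simp
qed

lemma is_fourier_L2_fourier:
  assumes "f \<in> L2" "integrable lborel f"
  shows "is_fourier_L2 f (fourier f)"
  by (rule is_fourier_L2I[where F="\<lambda>_. f"]) (use assms Plancherel_L1_L2 in \<open>auto simp: mass_def\<close>)

lemma is_fourier_L2_exists:
  assumes f: "f \<in> L2"
  shows "\<exists>h. is_fourier_L2 f h"
proof -
  note t = trunc_L2[OF f] trunc_integrable[OF f]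
  have "\<exists>h\<in>L2. (\<lambda>n. mass (\<lambda>\<xi>. fourier (trunc n f) \<xi> - h \<xi>)) \<longlonglongrightarrow> 0"
  proof (rule L2_complete)
    fix e :: real assume "e > 0"
    then have "e / (4 * (2 * pi)^3) > 0" by simp
    from order_tendstoD(2)[OF trunc_tendsto[OF f] this]
    obtain N where N: "\<And>n. n \<ge> N \<Longrightarrow> mass (\<lambda>x. trunc n f x - f x) < e / (4 * (2 * pi)^3)"
      unfolding eventually_sequentially by blast
    have "mass (\<lambda>\<xi>. fourier (trunc m f) \<xi> - fourier (trunc n f) \<xi>) \<le> e" if "m \<ge> N" "n \<ge> N" for m n
    proof -
      have "mass (\<lambda>x. trunc m f x - trunc n f x) \<le> 2 * mass (\<lambda>x. trunc m f x - f x) + 2 * mass (\<lambda>x. trunc n f x - f x)"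
        using mass_diff_triangle[OF t(1)[of m] f t(1)[of n]] mass_minus_commute[of f "trunc n f"] by simp
      also have "\<dots> \<le> e / (2 * pi)^3"
        using N[OF that(1)] N[OF that(2)] by (simp add: field_simps)
      finally show ?thesis
        by (simp add: mass_fourier_diff[OF t t] field_simps)
    qed
    then show "\<exists>N. \<forall>m\<ge>N. \<forall>n\<ge>N. mass (\<lambda>\<xi>. fourier (trunc m f) \<xi> - fourier (trunc n f) \<xi>) \<le> e"
      by blast
  qed (rule Plancherel_L1_L2[OF t(2,1)])
  then show ?thesis unfolding is_fourier_L2_iff using f by blast
qed

lemma is_fourier_L2_unique:
  assumes "is_fourier_L2 f h" "is_fourier_L2 f k"
  shows "AE \<xi> in lborel. h \<xi> = k \<xi>"
  using assms unfolding is_fourier_L2_iff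
  by (intro L2_limit_unique[where F="\<lambda>n. fourier (trunc n f)"] Plancherel_L1_L2 trunc_integrable trunc_L2) auto

lemma is_fourier_L2_cong_AE:
  assumes "is_fourier_L2 f h" "AE \<xi> in lborel. h \<xi> = k \<xi>" "k \<in> borel_measurable borel"
  shows "is_fourier_L2 f k"
proof -
  have L: "f \<in> L2" "h \<in> L2" using assms by (auto dest: is_fourier_L2D)
  have k: "k \<in> L2" using L2_AE_cong[OF L(2) assms(3)] assms(2) by (auto simp: eq_commute)
  have "mass (\<lambda>\<xi>. fourier (trunc n f) \<xi> - k \<xi>) = mass (\<lambda>\<xi>. fourier (trunc n f) \<xi> - h \<xi>)" for n
    using assms(2) Plancherel_L1_L2(1)[OF trunc_integrable trunc_L2, OF L(1) L(1)] L(2) assms(3)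
    by (intro mass_AE_cong borel_measurable_diff) (auto dest: L2_measurable)
  then show ?thesis using assms(1) L k by (simp add: is_fourier_L2_iff)
qed

lemma is_fourier_L2_add:
  assumes "is_fourier_L2 f h" "is_fourier_L2 g k"
  shows "is_fourier_L2 (\<lambda>x. f x + g x) (\<lambda>\<xi>. h \<xi> + k \<xi>)"
proof -
  have L: "f \<in> L2" "g \<in> L2" "h \<in> L2" "k \<in> L2" using assms by (auto dest: is_fourier_L2D)
  have t: "trunc n f \<in> L2" "trunc n g \<in> L2" "integrable lborel (trunc n f)" "integrable lborel (trunc n g)"
    "fourier (trunc n f) \<in> L2" "fourier (trunc n g) \<in> L2" for n
    using L by (auto intro: trunc_L2 trunc_integrable Plancherel_L1_L2)
  have lim: "(\<lambda>n. 2 * mass (\<lambda>x. F n x - f x) + 2 * mass (\<lambda>x. G n x - g x)) \<longlonglongrightarrow> 0"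
    if "(\<lambda>n. mass (\<lambda>x. F n x - f x)) \<longlonglongrightarrow> 0" "(\<lambda>n. mass (\<lambda>x. G n x - g x)) \<longlonglongrightarrow> 0"
    for F G :: "nat \<Rightarrow> real^3 \<Rightarrow> complex" and f g
    using tendsto_add[OF tendsto_mult_left[OF that(1)] tendsto_mult_left[OF that(2)], of 2 2] by simp
  have sum: "mass (\<lambda>x. F x + G x - (f x + g x)) \<le> 2 * mass (\<lambda>x. F x - f x) + 2 * mass (\<lambda>x. G x - g x)"
    if "F \<in> L2" "G \<in> L2" "f \<in> L2" "g \<in> L2" for F G f g
    using mass_add_le[OF L2_diff[OF that(1,3)] L2_diff[OF that(2,4)]] by (simp add: add_diff_add)
  show ?thesis
  proof (rule is_fourier_L2I[where F="\<lambda>n x. trunc n f x + trunc n g x"])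
    show "(\<lambda>n. mass (\<lambda>x. trunc n f x + trunc n g x - (f x + g x))) \<longlonglongrightarrow> 0"
    proof (rule tendsto_zero_le[OF mass_nonneg])
      show "mass (\<lambda>x. trunc n f x + trunc n g x - (f x + g x)) \<le> 2 * mass (\<lambda>x. trunc n f x - f x) + 2 * mass (\<lambda>x. trunc n g x - g x)" for n
        by (rule sum[OF t(1,2) L(1,2)])
    qed (rule lim[OF trunc_tendsto[OF L(1)] trunc_tendsto[OF L(2)]])
    have "(\<lambda>n. mass (\<lambda>\<xi>. fourier (trunc n f) \<xi> + fourier (trunc n g) \<xi> - (h \<xi> + k \<xi>))) \<longlonglongrightarrow> 0"
    proof (rule tendsto_zero_le[OF mass_nonneg])
      show "mass (\<lambda>x. fourier (trunc n f) x + fourier (trunc n g) x - (h x + k x)) \<le> 2 * mass (\<lambda>x. fourier (trunc n f) x - h x) + 2 * mass (\<lambda>x. fourier (trunc n g) x - k x)" for n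
        by (rule sum[OF t(5,6) L(3,4)])
    qed (rule lim, use assms in \<open>auto simp: is_fourier_L2_iff\<close>)
    then show "(\<lambda>n. mass (\<lambda>\<xi>. fourier (\<lambda>x. trunc n f x + trunc n g x) \<xi> - (h \<xi> + k \<xi>))) \<longlonglongrightarrow> 0"
      using t by (simp add: fourier_add)
  qed (use t L in \<open>auto intro!: L2_add\<close>)
qed

text \<open>Common scheme for multiples, translations and dilations: an operation T on functions and
  its counterpart S on transforms, both Lipschitz in the mean, so that the identity for integrable
  functions passes to the limit.\<close>

lemma is_fourier_L2_transform:
  assumes "is_fourier_L2 f h"
    and T: "\<And>f. f \<in> L2 \<Longrightarrow> T f \<in> L2" "\<And>f. integrable lborel f \<Longrightarrow> integrable lborel (T f)"
    and S: "\<And>h. h \<in> L2 \<Longrightarrow> S h \<in> L2" "\<And>f. fourier (T f) = S (fourier f)"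
    and d: "\<And>f g. f \<in> L2 \<Longrightarrow> g \<in> L2 \<Longrightarrow> mass (\<lambda>x. T f x - T g x) \<le> C * mass (\<lambda>x. f x - g x)"
      "\<And>f g. f \<in> L2 \<Longrightarrow> g \<in> L2 \<Longrightarrow> mass (\<lambda>x. S f x - S g x) \<le> D * mass (\<lambda>x. f x - g x)"
  shows "is_fourier_L2 (T f) (S h)"
proof -
  have L: "f \<in> L2" "h \<in> L2" using assms(1) by (auto dest: is_fourier_L2D)
  have t: "trunc n f \<in> L2" "integrable lborel (trunc n f)" "fourier (trunc n f) \<in> L2" for n
    using L by (auto intro: trunc_L2 trunc_integrable Plancherel_L1_L2)
  show ?thesis
  proof (rule is_fourier_L2I[where F="\<lambda>n. T (trunc n f)"])
    have "(\<lambda>n. C * mass (\<lambda>x. trunc n f x - f x)) \<longlonglongrightarrow> C * 0"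
      by (intro tendsto_intros trunc_tendsto L)
    then show "(\<lambda>n. mass (\<lambda>x. T (trunc n f) x - T f x)) \<longlonglongrightarrow> 0"
      using tendsto_zero_le[OF mass_nonneg d(1)[OF t(1) L(1)]] by simp
    have "(\<lambda>n. D * mass (\<lambda>x. fourier (trunc n f) x - h x)) \<longlonglongrightarrow> D * 0"
      using assms(1) unfolding is_fourier_L2_iff by (intro tendsto_intros) auto
    then show "(\<lambda>n. mass (\<lambda>x. fourier (T (trunc n f)) x - S h x)) \<longlonglongrightarrow> 0"
      using tendsto_zero_le[OF mass_nonneg d(2)[OF t(3) L(2)]] by (simp add: S(2))
  qed (use t L T S in auto)
qed

lemma is_fourier_L2_cmult:
  assumes "is_fourier_L2 f h"
  shows "is_fourier_L2 (\<lambda>x. c * f x) (\<lambda>\<xi>. c * h \<xi>)"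
  using assms
  by (rule is_fourier_L2_transform[where C="(norm c)\<^sup>2" and D="(norm c)\<^sup>2"])
     (auto intro: L2_cmult simp: fourier_cmult[abs_def] mass_cmult simp flip: right_diff_distrib)

lemma is_fourier_L2_diff:
  assumes "is_fourier_L2 f h" "is_fourier_L2 g k"
  shows "is_fourier_L2 (\<lambda>x. f x - g x) (\<lambda>\<xi>. h \<xi> - k \<xi>)"
  using is_fourier_L2_add[OF assms(1) is_fourier_L2_cmult[OF assms(2), of "-1"]] by simp

lemma is_fourier_L2_translate:
  assumes "is_fourier_L2 f h"
  shows "is_fourier_L2 (\<lambda>x. f (x + a)) (\<lambda>\<xi>. cis (a \<bullet> \<xi>) * h \<xi>)"
  using assms
proof (rule is_fourier_L2_transform[where C=1 and D=1])
  show "mass (\<lambda>x. f (x + a) - g (x + a)) \<le> 1 * mass (\<lambda>x. f x - g x)" for f g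
    using mass_translate[of "\<lambda>x. f x - g x" a] by simp
  show "mass (\<lambda>\<xi>. cis (a \<bullet> \<xi>) * f \<xi> - cis (a \<bullet> \<xi>) * g \<xi>) \<le> 1 * mass (\<lambda>x. f x - g x)" for f g
    by (simp add: mass_def norm_mult flip: right_diff_distrib)
  show "(\<lambda>\<xi>. cis (a \<bullet> \<xi>) * h \<xi>) \<in> L2" if "h \<in> L2" for h
    by (rule L2_mult_bounded[OF that, of _ 1]) auto
qed (auto intro: L2_translate simp: fourier_translate[abs_def] integrable_translate_iff)

lemma is_fourier_L2_dilate:
  assumes "is_fourier_L2 f h" "c \<noteq> 0"
  shows "is_fourier_L2 (\<lambda>x. f (c *\<^sub>R x)) (\<lambda>\<xi>. h ((1 / c) *\<^sub>R \<xi>) / \<bar>c\<bar>^3)"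
  using assms(1)
proof (rule is_fourier_L2_transform[where C="1 / \<bar>c\<bar>^3" and D="(1 / \<bar>c\<bar>^3)\<^sup>2 * \<bar>c\<bar>^3"])
  show "mass (\<lambda>x. f (c *\<^sub>R x) - g (c *\<^sub>R x)) \<le> 1 / \<bar>c\<bar> ^ 3 * mass (\<lambda>x. f x - g x)" for f g
    using mass_dilate[OF assms(2), of "\<lambda>x. f x - g x"] by simp
  show "mass (\<lambda>x. f ((1 / c) *\<^sub>R x) / \<bar>c\<bar> ^ 3 - g ((1 / c) *\<^sub>R x) / \<bar>c\<bar> ^ 3) \<le> (1 / \<bar>c\<bar>^3)\<^sup>2 * \<bar>c\<bar>^3 * mass (\<lambda>x. f x - g x)" for f g :: "real^3 \<Rightarrow> complex"
  proof -
    have "mass (\<lambda>x. f ((1 / c) *\<^sub>R x) / \<bar>c\<bar> ^ 3 - g ((1 / c) *\<^sub>R x) / \<bar>c\<bar> ^ 3)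
       = mass (\<lambda>x. of_real (1 / \<bar>c\<bar>^3) * (f ((1 / c) *\<^sub>R x) - g ((1 / c) *\<^sub>R x)))"
      by (simp add: diff_divide_distrib)
    also have "\<dots> = (1 / \<bar>c\<bar>^3)\<^sup>2 * mass (\<lambda>x. f ((1 / c) *\<^sub>R x) - g ((1 / c) *\<^sub>R x))"
      unfolding mass_cmult norm_of_real by simp
    also have "\<dots> = (1 / \<bar>c\<bar>^3)\<^sup>2 * \<bar>c\<bar>^3 * mass (\<lambda>x. f x - g x)"
      using mass_dilate[of "1 / c" "\<lambda>x. f x - g x"] assms(2) by (simp add: power_one_over)
    finally show ?thesis by simp
  qed
  show "(\<lambda>\<xi>. h ((1 / c) *\<^sub>R \<xi>) / \<bar>c\<bar>^3) \<in> L2" if "h \<in> L2" for h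
    using L2_cmult[OF L2_dilate[OF that, of "1 / c"], of "of_real (1 / \<bar>c\<bar>^3)"] assms(2) by simp
qed (use assms(2) in \<open>auto intro: L2_dilate simp: fourier_dilate fun_eq_iff integrable_dilate_iff\<close>)

lemma is_fourier_L2_mass:
  assumes "is_fourier_L2 f h"
  shows "mass h = (2 * pi)^3 * mass f"
proof -
  have L: "f \<in> L2" "h \<in> L2" using assms by (auto dest: is_fourier_L2D)
  have t: "trunc n f \<in> L2" "integrable lborel (trunc n f)" "fourier (trunc n f) \<in> L2" for n
    using L by (auto intro: trunc_L2 trunc_integrable Plancherel_L1_L2)
  have "(\<lambda>n. mass (fourier (trunc n f))) \<longlonglongrightarrow> mass h"
    using t L assms by (intro mass_tendsto) (auto simp: is_fourier_L2_iff)
  moreover have "(\<lambda>n. mass (fourier (trunc n f))) \<longlonglongrightarrow> (2 * pi)^3 * mass f"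
    unfolding Plancherel_L1_L2(2)[OF t(2,1)]
    by (intro tendsto_intros mass_tendsto trunc_tendsto t L)
  ultimately show ?thesis by (rule LIMSEQ_unique)
qed

text \<open>Polarization of \<open>is_fourier_L2_mass\<close>: the mass of f + g determines the real
  part of the inner product, and the multiple -\<i> f turns the imaginary part into a real
  part.\<close>

theorem Parseval:
  assumes "is_fourier_L2 f h" "is_fourier_L2 g k"
  shows "l2_inner h k = (2 * pi)^3 * l2_inner f g"
proof -
  have Re: "Re (l2_inner h k) = (2 * pi)^3 * Re (l2_inner f g)"
    if "is_fourier_L2 f h" "is_fourier_L2 g k" for f g h k
  proof -
    have L: "f \<in> L2" "h \<in> L2" "g \<in> L2" "k \<in> L2" using that by (auto dest: is_fourier_L2D)
    have "mass h + 2 * Re (l2_inner h k) + mass k = (2 * pi)^3 * (mass f + 2 * Re (l2_inner f g) + mass g)"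
      using is_fourier_L2_mass[OF is_fourier_L2_add[OF that]] L by (simp add: mass_add)
    then show ?thesis
      unfolding is_fourier_L2_mass[OF that(1)] is_fourier_L2_mass[OF that(2)] by (simp add: distrib_left)
  qed
  have "Re (l2_inner (\<lambda>\<xi>. - \<i> * h \<xi>) k) = (2 * pi)^3 * Re (l2_inner (\<lambda>x. - \<i> * f x) g)"
    by (intro Re is_fourier_L2_cmult assms)
  then have "Im (l2_inner h k) = (2 * pi)^3 * Im (l2_inner f g)"
    unfolding l2_inner_cmult_left by simp
  with Re[OF assms] have "l2_inner h k = of_real ((2 * pi)^3) * l2_inner f g"
    by (intro complex_eqI) (simp_all only: Re_complex_of_real Im_complex_of_real times_complex.sel)
  then show ?thesis by simp
qed

lemma fourier_cnj: "fourier (\<lambda>x. cnj (f x)) \<xi> = cnj (fourier f (- \<xi>))"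
  unfolding fourier_def by (subst Bochner_Integration.integral_cnj[symmetric]) (simp add: cis_cnj)

text \<open>The multiplication formula for truncations, passed to the limit. The conjugate in
  \<open>l2_inner\<close> changes the sign in the exponent of the kernel, which is why the adjoint
  is the transform followed by a reflection.\<close>

lemma fourier_L2_adjoint:
  assumes "is_fourier_L2 f h" "is_fourier_L2 g k"
  shows "l2_inner h g = l2_inner f (\<lambda>x. k (- x))"
proof -
  have L: "f \<in> L2" "h \<in> L2" "g \<in> L2" "k \<in> L2" using assms by (auto dest: is_fourier_L2D)
  have t: "trunc n f \<in> L2" "integrable lborel (trunc n f)" "fourier (trunc n f) \<in> L2" if "f \<in> L2" for f n
    using that by (auto intro: trunc_L2 trunc_integrable Plancherel_L1_L2)
  have refl: "(\<lambda>x. u (- x)) \<in> L2" "mass (\<lambda>x. u (- x)) = mass u" if "u \<in> L2" for u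
    using L2_dilate[OF that, of "-1"] mass_dilate[of "-1" u] by auto
  have eq: "l2_inner (fourier (trunc n f)) (trunc n g) = l2_inner (trunc n f) (\<lambda>x. fourier (trunc n g) (- x))" for n
    unfolding l2_inner_def
    using fourier_multiplication[OF t(2)[OF L(1), of n] integrable_cnj[OF t(2)[OF L(3), of n]]]
    by (simp only: fourier_cnj)
  have "(\<lambda>n. l2_inner (fourier (trunc n f)) (trunc n g)) \<longlonglongrightarrow> l2_inner h g"
    using assms L t by (intro l2_inner_tendsto trunc_tendsto) (auto simp: is_fourier_L2_iff)
  moreover have "(\<lambda>n. l2_inner (trunc n f) (\<lambda>x. fourier (trunc n g) (- x))) \<longlonglongrightarrow> l2_inner f (\<lambda>x. k (- x))"
  proof (intro l2_inner_tendsto trunc_tendsto)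
    have "mass (\<lambda>x. fourier (trunc n g) (- x) - k (- x)) = mass (\<lambda>x. fourier (trunc n g) x - k x)" for n
      using L t by (intro refl(2)[of "\<lambda>x. fourier (trunc n g) x - k x"] L2_diff) auto
    then show "(\<lambda>n. mass (\<lambda>x. fourier (trunc n g) (- x) - k (- x))) \<longlonglongrightarrow> 0"
      using assms(2) by (simp add: is_fourier_L2_iff)
  qed (use L t refl in auto)
  ultimately show ?thesis unfolding eq by (rule LIMSEQ_unique)
qed

text \<open>
  The transform \<open>F\<close> is an isometry up to the factor \<open>(2 \<pi>)\<^sup>3\<close>, and so is its adjoint; expanding
  \<open>\<parallel>F F\<^sup>* h - (2 \<pi>)\<^sup>3 h\<parallel>\<^sup>2\<close> then gives the inversion formula.
\<close>

theorem fourier_L2_inversion: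
  assumes "is_fourier_L2 h k"
  shows "is_fourier_L2 (\<lambda>x. k (- x) / (2 * pi)^3) h"
proof -
  define c where "c = complex_of_real (1 / (2 * pi)^3)"
  define g where "g = (\<lambda>x. c * k (- x))"
  have L: "h \<in> L2" "k \<in> L2" using assms by (auto dest: is_fourier_L2D)
  have r: "(\<lambda>x. k (- x)) \<in> L2" "mass (\<lambda>x. k (- x)) = mass k"
    using L2_dilate[OF L(2), of "-1"] mass_dilate[of "-1" k] by auto
  have gL: "g \<in> L2" unfolding g_def by (rule L2_cmult[OF r(1)])
  obtain g' where g': "is_fourier_L2 g g'" using is_fourier_L2_exists[OF gL] by blast
  have g'L: "g' \<in> L2" using g' by (rule is_fourier_L2D)
  have k: "mass k = (2 * pi)^3 * mass h" by (rule is_fourier_L2_mass[OF assms])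
  have nc: "norm c = 1 / (2 * pi)^3" unfolding c_def norm_of_real by simp
  have mg: "mass g' = mass h"
  proof -
    have "P * ((1 / P)\<^sup>2 * (P * m)) = m" if "P \<noteq> 0" for P m :: real
      using that by (simp add: power2_eq_square)
    then show ?thesis
      unfolding is_fourier_L2_mass[OF g'] g_def mass_cmult nc r(2) k by this simp
  qed
  have "l2_inner g' h = c * of_real (mass k)"
    unfolding fourier_L2_adjoint[OF g' assms] unfolding g_def l2_inner_cmult_left l2_inner_self r(2) ..
  also have "\<dots> = of_real (1 / (2 * pi)^3 * mass k)"
    unfolding c_def by (rule of_real_mult[symmetric])
  also have "1 / (2 * pi)^3 * mass k = mass h" unfolding k by simp
  finally have ip: "l2_inner g' h = of_real (mass h)" .
  have "mass (\<lambda>x. g' x + (-1) * h x) = mass g' + 2 * Re (l2_inner g' (\<lambda>x. (-1) * h x)) + mass (\<lambda>x. (-1) * h x)"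
    by (intro mass_add g'L L2_cmult L)
  also have "\<dots> = 0"
    unfolding l2_inner_cmult_right mass_cmult ip mg by simp
  finally have "AE x in lborel. g' x = h x"
    using mass_eq_0_iff[OF L2_diff[OF g'L L(1)]] by simp
  then have "is_fourier_L2 g h"
    by (rule is_fourier_L2_cong_AE[OF g']) (rule L2_measurable[OF L(1)])
  then show ?thesis by (simp add: g_def c_def mult.commute)
qed

lemma fourier_L2_surj: "h \<in> L2 \<Longrightarrow> \<exists>g. is_fourier_L2 g h"
  using is_fourier_L2_exists fourier_L2_inversion by blast

subsection \<open>The dipolar interaction\<close>

text \<open>The choice in \<open>fourier_multiplier\<close> may go with another representative of
  the transform of f. Surjectivity of the transform provides a candidate, and uniqueness up to null
  sets allows the return to the given h.\<close>

lemma fourier_multiplier_spec: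
  assumes m: "m \<in> borel_measurable borel" "\<And>\<xi>. \<bar>m \<xi>\<bar> \<le> C" and f: "is_fourier_L2 f h"
  shows "is_fourier_L2 (fourier_multiplier m f) (\<lambda>\<xi>. of_real (m \<xi>) * h \<xi>)"
proof -
  have [measurable]: "m \<in> borel_measurable borel" by (rule m)
  have mL: "(\<lambda>\<xi>. of_real (m \<xi>) * k \<xi>) \<in> L2" if "k \<in> L2" for k
    by (rule L2_mult_bounded[OF that, of _ C]) (use m in auto)
  have L: "h \<in> L2" by (rule is_fourier_L2D[OF f])
  obtain g where "is_fourier_L2 g (\<lambda>\<xi>. of_real (m \<xi>) * h \<xi>)"
    using fourier_L2_surj[OF mL[OF L]] by blast
  with f have "\<exists>g h. is_fourier_L2 f h \<and> is_fourier_L2 g (\<lambda>\<xi>. of_real (m \<xi>) * h \<xi>)" by blast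
  then have "\<exists>h. is_fourier_L2 f h \<and> is_fourier_L2 (fourier_multiplier m f) (\<lambda>\<xi>. of_real (m \<xi>) * h \<xi>)"
    unfolding fourier_multiplier_def by (rule someI_ex)
  then obtain k where k: "is_fourier_L2 f k" "is_fourier_L2 (fourier_multiplier m f) (\<lambda>\<xi>. of_real (m \<xi>) * k \<xi>)"
    by blast
  have "AE \<xi> in lborel. k \<xi> = h \<xi>" by (rule is_fourier_L2_unique[OF k(1) f])
  then have "AE \<xi> in lborel. of_real (m \<xi>) * k \<xi> = of_real (m \<xi>) * h \<xi>" by eventually_elim simp
  then show ?thesis
    by (rule is_fourier_L2_cong_AE[OF k(2)]) (rule L2_measurable[OF mL[OF L]])
qed

lemma dipolar_symbol_measurable [measurable]: "dipolar_symbol \<in> borel_measurable borel"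
  unfolding dipolar_symbol_def by measurable

lemma norm_vec3_square: "(norm (\<xi>::real^3))\<^sup>2 = (\<xi>$1)\<^sup>2 + (\<xi>$2)\<^sup>2 + (\<xi>$3)\<^sup>2"
  unfolding power2_norm_eq_inner by (simp add: inner_vec_def sum_3 power2_eq_square)

text \<open>The quotient ranges from -1, on the plane \<xi>_3 = 0, to 2, on the third axis. At \<xi>
  = 0 division by zero makes the symbol 0.\<close>

lemma dipolar_symbol_bounded: "\<bar>dipolar_symbol \<xi>\<bar> \<le> 8 / 3 * pi"
proof (cases "\<xi> = 0")
  case False
  have "\<bar>(2 * (\<xi>$3)\<^sup>2 - (\<xi>$1)\<^sup>2 - (\<xi>$2)\<^sup>2) / (norm \<xi>)\<^sup>2\<bar> \<le> 2"
    using False by (simp add: abs_divide divide_le_eq, simp add: norm_vec3_square abs_le_iff)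
  then have "4 / 3 * pi * \<bar>(2 * (\<xi>$3)\<^sup>2 - (\<xi>$1)\<^sup>2 - (\<xi>$2)\<^sup>2) / (norm \<xi>)\<^sup>2\<bar> \<le> 4 / 3 * pi * 2"
    by (intro mult_left_mono) auto
  then show ?thesis unfolding dipolar_symbol_def abs_mult by simp
qed (simp add: dipolar_symbol_def)

lemma dipolar_symbol_scale: "t \<noteq> 0 \<Longrightarrow> dipolar_symbol (t *\<^sub>R \<xi>) = dipolar_symbol \<xi>"
  by (simp add: dipolar_symbol_def power_mult_distrib mult.left_commute[of 2]
      flip: right_diff_distrib)

text \<open>Polarization of the dipolar part of B. The real part makes it a symmetric form over the
  reals, the symbol being real; on |u|^2 it is the integral in \<open>GP_B\<close>.\<close>

definition dipolar_form :: "(real^3 \<Rightarrow> complex) \<Rightarrow> (real^3 \<Rightarrow> complex) \<Rightarrow> real" where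
  "dipolar_form f g = Re (l2_inner (dipolar_conv f) g)"

lemma dipolar_form_fourier:
  assumes "is_fourier_L2 f h" "is_fourier_L2 g k"
  shows "dipolar_form f g = Re (l2_inner (\<lambda>\<xi>. of_real (dipolar_symbol \<xi>) * h \<xi>) k) / (2 * pi)^3"
proof -
  have "is_fourier_L2 (dipolar_conv f) (\<lambda>\<xi>. of_real (dipolar_symbol \<xi>) * h \<xi>)"
    unfolding dipolar_conv_def
    by (rule fourier_multiplier_spec[OF _ dipolar_symbol_bounded assms(1)]) measurable
  from Parseval[OF this assms(2)]
  have "l2_inner (\<lambda>\<xi>. of_real (dipolar_symbol \<xi>) * h \<xi>) k = of_real ((2 * pi)^3) * l2_inner (dipolar_conv f) g"
    by simp
  then have "Re (l2_inner (\<lambda>\<xi>. of_real (dipolar_symbol \<xi>) * h \<xi>) k) = (2 * pi)^3 * dipolar_form f g"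
    unfolding dipolar_form_def by (simp only: times_complex.sel Re_complex_of_real Im_complex_of_real)
  then show ?thesis by simp
qed

lemma L2_dipolar_mult: "h \<in> L2 \<Longrightarrow> (\<lambda>\<xi>. of_real (dipolar_symbol \<xi>) * h \<xi>) \<in> L2"
  by (rule L2_mult_bounded[of _ _ "8 / 3 * pi"]) (use dipolar_symbol_bounded in auto)

lemma dipolar_form_commute:
  assumes "f \<in> L2" "g \<in> L2"
  shows "dipolar_form f g = dipolar_form g f"
proof -
  obtain h k where hk: "is_fourier_L2 f h" "is_fourier_L2 g k"
    using assms[THEN is_fourier_L2_exists] by metis
  have "l2_inner (\<lambda>\<xi>. of_real (dipolar_symbol \<xi>) * h \<xi>) k = cnj (l2_inner (\<lambda>\<xi>. of_real (dipolar_symbol \<xi>) * k \<xi>) h)"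
    unfolding l2_inner_def by (subst Bochner_Integration.integral_cnj[symmetric]) (simp add: mult_ac)
  then show ?thesis
    unfolding dipolar_form_fourier[OF hk] dipolar_form_fourier[OF hk(2,1)] by simp
qed

lemma dipolar_form_add_left:
  assumes "f \<in> L2" "g \<in> L2" "w \<in> L2"
  shows "dipolar_form (\<lambda>x. f x + g x) w = dipolar_form f w + dipolar_form g w"
proof -
  obtain h k l where hk: "is_fourier_L2 f h" "is_fourier_L2 g k" "is_fourier_L2 w l"
    using assms[THEN is_fourier_L2_exists] by metis
  note L = is_fourier_L2D(2)[OF hk(1)] is_fourier_L2D(2)[OF hk(2)] is_fourier_L2D(2)[OF hk(3)]
  have "l2_inner (\<lambda>\<xi>. of_real (dipolar_symbol \<xi>) * (h \<xi> + k \<xi>)) l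
     = l2_inner (\<lambda>\<xi>. of_real (dipolar_symbol \<xi>) * h \<xi>) l + l2_inner (\<lambda>\<xi>. of_real (dipolar_symbol \<xi>) * k \<xi>) l"
    unfolding distrib_left by (intro l2_inner_add_left L2_dipolar_mult L)
  then show ?thesis
    unfolding dipolar_form_fourier[OF hk(1,3)] dipolar_form_fourier[OF hk(2,3)]
      dipolar_form_fourier[OF is_fourier_L2_add[OF hk(1,2)] hk(3)]
    by (simp add: add_divide_distrib)
qed

lemma dipolar_form_cmult_left:
  assumes "f \<in> L2" "g \<in> L2"
  shows "dipolar_form (\<lambda>x. of_real c * f x) g = c * dipolar_form f g"
proof -
  obtain h k where hk: "is_fourier_L2 f h" "is_fourier_L2 g k"
    using assms[THEN is_fourier_L2_exists] by metis
  have "l2_inner (\<lambda>\<xi>. of_real (dipolar_symbol \<xi>) * (of_real c * h \<xi>)) k = of_real c * l2_inner (\<lambda>\<xi>. of_real (dipolar_symbol \<xi>) * h \<xi>) k"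
    unfolding mult.left_commute[of _ "of_real c"] l2_inner_cmult_left ..
  then show ?thesis
    unfolding dipolar_form_fourier[OF hk] dipolar_form_fourier[OF is_fourier_L2_cmult[OF hk(1)] hk(2)]
    by simp
qed

lemma dipolar_form_bound:
  assumes "f \<in> L2" "g \<in> L2"
  shows "\<bar>dipolar_form f g\<bar> \<le> 8 / 3 * pi * (sqrt (mass f) * sqrt (mass g))"
proof -
  obtain h k where hk: "is_fourier_L2 f h" "is_fourier_L2 g k"
    using assms[THEN is_fourier_L2_exists] by metis
  note L = is_fourier_L2D(2)[OF hk(1)] is_fourier_L2D(2)[OF hk(2)]
  let ?mh = "\<lambda>\<xi>. of_real (dipolar_symbol \<xi>) * h \<xi>"
  have "mass ?mh \<le> (8 / 3 * pi)\<^sup>2 * mass h"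
    by (rule mass_mono[OF L(1) L2_measurable[OF L2_dipolar_mult[OF L(1)]]])
      (simp only: norm_mult norm_of_real, intro mult_right_mono dipolar_symbol_bounded norm_ge_zero)
  then have "sqrt (mass ?mh) \<le> sqrt ((8 / 3 * pi)\<^sup>2 * mass h)" by (rule real_sqrt_le_mono)
  also have "\<dots> = 8 / 3 * pi * sqrt (mass h)" by (simp add: real_sqrt_mult)
  finally have 1: "sqrt (mass ?mh) \<le> 8 / 3 * pi * sqrt (mass h)" .
  have "\<bar>Re (l2_inner ?mh k)\<bar> \<le> norm (l2_inner ?mh k)" by (rule abs_Re_le_cmod)
  also have "\<dots> \<le> sqrt (mass ?mh) * sqrt (mass k)"
    by (intro l2_inner_Cauchy_Schwarz L2_dipolar_mult L)
  also have "\<dots> \<le> 8 / 3 * pi * sqrt (mass h) * sqrt (mass k)"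
    using 1 by (rule mult_right_mono) simp
  also have "\<dots> = 8 / 3 * pi * (sqrt (mass h) * sqrt (mass k))"
    by (rule mult.assoc)
  also have "sqrt (mass h) * sqrt (mass k) = (2 * pi)^3 * (sqrt (mass f) * sqrt (mass g))"
    unfolding is_fourier_L2_mass[OF hk(1)] is_fourier_L2_mass[OF hk(2)] real_sqrt_mult by simp
  finally have le: "\<bar>Re (l2_inner ?mh k)\<bar> \<le> 8 / 3 * pi * ((2 * pi)^3 * (sqrt (mass f) * sqrt (mass g)))" .
  have "r / P \<le> a * X" if "r \<le> a * (P * X)" "P > 0" for r a P X :: real
    using that by (simp add: divide_le_eq mult_ac)
  from this[OF le] have "\<bar>Re (l2_inner ?mh k)\<bar> / (2 * pi)^3 \<le> 8 / 3 * pi * (sqrt (mass f) * sqrt (mass g))"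
    by simp
  then show ?thesis unfolding dipolar_form_fourier[OF hk] by (simp add: abs_divide)
qed

text \<open>The symbol is homogeneous of degree 0, so the dipolar energy scales like the squared L^2
  norm. Hence both terms of B scale alike, and B behaves under dilations as if it were
  local.\<close>

lemma dipolar_form_dilate:
  assumes "f \<in> L2" "t > 0"
  shows "dipolar_form (\<lambda>x. f (t *\<^sub>R x)) (\<lambda>x. f (t *\<^sub>R x)) = dipolar_form f f / t^3"
proof -
  obtain h where h: "is_fourier_L2 f h" using assms is_fourier_L2_exists by blast
  have t0: "t \<noteq> 0" using assms by simp
  let ?a = "\<lambda>\<xi>. of_real (dipolar_symbol \<xi>) * h \<xi> * cnj (h \<xi>)"
  have "l2_inner (\<lambda>\<xi>. of_real (dipolar_symbol \<xi>) * (h ((1 / t) *\<^sub>R \<xi>) / \<bar>t\<bar>^3)) (\<lambda>\<xi>. h ((1 / t) *\<^sub>R \<xi>) / \<bar>t\<bar>^3)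
     = (LINT \<xi>|lborel. of_real (1 / (t^3 * t^3)) * ?a ((1 / t) *\<^sub>R \<xi>))"
    unfolding l2_inner_def using assms(2) t0
    by (intro Bochner_Integration.integral_cong refl) (simp add: dipolar_symbol_scale[of "1 / t"])
  also have "\<dots> = of_real (1 / (t^3 * t^3)) * (LINT \<xi>|lborel. ?a ((1 / t) *\<^sub>R \<xi>))"
    by (rule integral_mult_right_zero)
  also have "(LINT \<xi>|lborel. ?a ((1 / t) *\<^sub>R \<xi>)) = t^3 *\<^sub>R (LINT \<xi>|lborel. ?a \<xi>)"
    using assms(2) by (subst integral_dilate[of "1 / t" ?a]) (auto simp: power_one_over)
  also have "of_real (1 / (t^3 * t^3)) * (t^3 *\<^sub>R (LINT \<xi>|lborel. ?a \<xi>)) = (1 / t^3) *\<^sub>R (LINT \<xi>|lborel. ?a \<xi>)"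
  proof -
    have "of_real (1 / (s * s)) * (s *\<^sub>R z) = (1 / s) *\<^sub>R z" if "s \<noteq> 0" for s :: real and z :: complex
      using that by (simp add: scaleR_conv_of_real)
    then show ?thesis by this (use t0 in simp)
  qed
  finally show ?thesis
    unfolding dipolar_form_fourier[OF h h] dipolar_form_fourier[OF is_fourier_L2_dilate[OF h t0] is_fourier_L2_dilate[OF h t0]]
    by (simp add: l2_inner_def)
qed

subsection \<open>Test functions\<close>

lemma pdiff_eqI: "(f has_derivative D) (at x) \<Longrightarrow> pdiff j f x = D (axis j 1)"
  unfolding pdiff_def by (drule frechet_derivative_at) simp

lemma Ck_Suc_differentiable: "Ck (Suc k) f \<Longrightarrow> f differentiable (at x)"
  by (simp add: differentiable_on_def)

lemma Ck_SucD: "Ck (Suc k) f \<Longrightarrow> Ck k f"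
proof (induction k arbitrary: f)
  case 0
  then show ?case by (simp add: differentiable_imp_continuous_on)
next
  case (Suc k)
  have "Ck k (pdiff j f)" "Ck (Suc k) (pdiff j f)" for j
    using Suc.prems Suc.IH[of "pdiff j f"] unfolding Ck.simps(2)[of "Suc k" f] by blast+
  moreover have "f differentiable_on UNIV" using Suc.prems unfolding Ck.simps(2)[of "Suc k" f] by blast
  ultimately show ?case by simp
qed

lemma Ck_add: "Ck k f \<Longrightarrow> Ck k g \<Longrightarrow> Ck k (\<lambda>x. f x + g x)"
proof (induction k arbitrary: f g)
  case 0
  then show ?case by (auto intro: continuous_intros)
next
  case (Suc k)
  have d: "f differentiable (at x)" "g differentiable (at x)" for x
    using Suc.prems Ck_Suc_differentiable by blast+
  have "pdiff j (\<lambda>x. f x + g x) = (\<lambda>x. pdiff j f x + pdiff j g x)" for j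
  proof
    fix x
    show "pdiff j (\<lambda>x. f x + g x) x = pdiff j f x + pdiff j g x"
      using d[THEN frechet_derivative_works[THEN iffD1], of x]
      by (subst pdiff_eqI[OF has_derivative_add]) (auto simp: pdiff_def)
  qed
  then show ?case
    using Suc.IH Suc.prems by (auto intro: differentiable_on_add)
qed

lemma Ck_mult: "Ck k f \<Longrightarrow> Ck k g \<Longrightarrow> Ck k (\<lambda>x. f x * g x)"
proof (induction k arbitrary: f g)
  case 0
  then show ?case by (auto intro: continuous_intros)
next
  case (Suc k)
  have d: "f differentiable (at x)" "g differentiable (at x)" for x
    using Suc.prems Ck_Suc_differentiable by blast+
  have "pdiff j (\<lambda>x. f x * g x) = (\<lambda>x. f x * pdiff j g x + pdiff j f x * g x)" for j
  proof
    fix x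
    show "pdiff j (\<lambda>x. f x * g x) x = f x * pdiff j g x + pdiff j f x * g x"
      using d[THEN frechet_derivative_works[THEN iffD1], of x]
      by (subst pdiff_eqI[OF has_derivative_mult]) (auto simp: pdiff_def)
  qed
  moreover have "Ck k f" "Ck k g" using Suc.prems Ck_SucD by blast+
  ultimately show ?case
    using Suc.IH Suc.prems by (auto intro!: Ck_add differentiable_on_mult)
qed

lemma pdiff_shift: "f differentiable (at (x + a)) \<Longrightarrow> pdiff j (\<lambda>y. f (y + a)) x = pdiff j f (x + a)"
proof -
  assume "f differentiable (at (x + a))"
  then have "(f has_derivative frechet_derivative f (at (x + a))) (at (x + a))"
    by (simp add: frechet_derivative_works)
  moreover have "((\<lambda>y. y + a) has_derivative (\<lambda>v. v)) (at x)"
    by (auto intro!: derivative_eq_intros)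
  ultimately have "((\<lambda>y. f (y + a)) has_derivative (\<lambda>v. frechet_derivative f (at (x + a)) v)) (at x)"
    by (intro has_derivative_compose[where f="\<lambda>y. y + a" and g=f])
  from pdiff_eqI[OF this] show ?thesis by (simp add: pdiff_def)
qed

lemma Ck_shift: "Ck k f \<Longrightarrow> Ck k (\<lambda>x. f (x + a))"
proof (induction k arbitrary: f)
  case 0
  have "continuous_on UNIV (f \<circ> (\<lambda>x. x + a))"
    using 0 by (intro continuous_on_compose continuous_intros) (auto intro: continuous_on_subset)
  then show ?case by (simp add: o_def)
next
  case (Suc k)
  have d: "f differentiable (at x)" for x
    using Suc.prems Ck_Suc_differentiable by blast
  have "pdiff j (\<lambda>x. f (x + a)) = (\<lambda>x. pdiff j f (x + a))" for j
    using pdiff_shift[OF d] by auto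
  moreover have "(\<lambda>x. f (x + a)) differentiable (at x)" for x
    using differentiable_chain_at[of "\<lambda>x. x + a" x f] d by (simp add: o_def)
  ultimately show ?case
    using Suc.IH Suc.prems by (auto simp: differentiable_on_def)
qed

lemma test_function_shift:
  assumes "\<phi> \<in> test_functions"
  shows "(\<lambda>x. \<phi> (x + a)) \<in> test_functions"
proof -
  have "{x. \<phi> (x + a) \<noteq> 0} = (\<lambda>y. y - a) ` {x. \<phi> x \<noteq> 0}"
    by (auto simp: image_iff) (metis add_diff_cancel_right')
  moreover have "bounded {x. \<phi> x \<noteq> 0}"
    using assms by (simp add: test_functions_def)
  ultimately show ?thesis
    using assms by (auto simp: test_functions_def bounded_translation_minus intro: Ck_shift)
qed

lemma test_function_differentiable: "\<phi> \<in> test_functions \<Longrightarrow> \<phi> differentiable (at x)"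
  unfolding test_functions_def using Ck_Suc_differentiable[of 0 \<phi> x] by blast

lemma test_function_continuous:
  assumes "\<phi> \<in> test_functions"
  shows "continuous_on UNIV \<phi>" "continuous_on UNIV (pdiff j \<phi>)"
proof -
  have "Ck (Suc 0) \<phi>" using assms by (simp only: test_functions_def mem_Collect_eq)
  then show "continuous_on UNIV \<phi>" "continuous_on UNIV (pdiff j \<phi>)"
    by (auto simp: differentiable_imp_continuous_on)
qed

lemma test_function_support:
  assumes "\<phi> \<in> test_functions"
  shows "\<exists>r>0. \<forall>x. norm x \<ge> r \<longrightarrow> \<phi> x = 0 \<and> (\<forall>j. pdiff j \<phi> x = 0)"
proof -
  have "bounded {x. \<phi> x \<noteq> 0}" using assms by (simp add: test_functions_def)
  then obtain r where r: "r > 0" "\<And>x. \<phi> x \<noteq> 0 \<Longrightarrow> norm x \<le> r"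
    unfolding bounded_pos by blast
  have p: "pdiff j \<phi> x = 0" if "norm x > r" for x j
  proof -
    have "open {y::real^3. norm y > r}" by (intro open_Collect_less continuous_intros)
    moreover have "0 = \<phi> y" if "y \<in> {y. norm y > r}" for y using r(2)[of y] that by force
    ultimately have "(\<phi> has_derivative (\<lambda>v. 0)) (at x)"
      using that by (intro has_derivative_transform_within_open[OF has_derivative_const]) auto
    then show ?thesis by (rule pdiff_eqI)
  qed
  \<comment> \<open>The partial derivatives are known to vanish on an open set only, outside the
    closed ball of radius r; enlarging the radius by 1 gives one bound for \<phi> and its
    derivatives.\<close>
  show ?thesis
  proof (intro exI[of _ "r + 1"] conjI allI impI)
    show "\<phi> x = 0" if "norm x \<ge> r + 1" for x using r(2)[of x] that by force
    show "pdiff j \<phi> x = 0" if "norm x \<ge> r + 1" for x j using p[of x j] that by simp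
  qed (use r in simp)
qed

lemma compactly_supported_L2:
  fixes g :: "real^3 \<Rightarrow> real"
  assumes "continuous_on UNIV g" "\<And>x. norm x \<ge> r \<Longrightarrow> g x = 0"
  shows "(\<lambda>x. complex_of_real (g x)) \<in> L2" "integrable lborel (\<lambda>x. complex_of_real (g x))"
    "\<exists>M. \<forall>x. \<bar>g x\<bar> \<le> M"
proof -
  have [measurable]: "g \<in> borel_measurable borel"
    using assms(1) by (rule borel_measurable_continuous_onI)
  have "bounded (g ` cball 0 r)"
    using continuous_on_subset[OF assms(1)] by (intro compact_imp_bounded compact_continuous_image) auto
  then obtain M where M: "M > 0" "\<And>x. norm x \<le> r \<Longrightarrow> \<bar>g x\<bar> \<le> M"
    unfolding bounded_pos by auto
  have le: "\<bar>g x\<bar> \<le> M * indicator (cball 0 r) x" for x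
    using M assms(2)[of x] by (cases "norm x \<le> r") auto
  have "\<bar>g x\<bar> \<le> M" for x using M assms(2)[of x] by (cases "norm x \<le> r") auto
  then show "\<exists>M. \<forall>x. \<bar>g x\<bar> \<le> M" by blast
  show L: "(\<lambda>x. complex_of_real (g x)) \<in> L2"
  proof (rule L2_bound[OF L2_indicator_bounded, of "cball 0 r" _ M])
    show "norm (complex_of_real (g x)) \<le> M * norm (indicator (cball 0 r) x :: complex)" for x
      using le[of x] by (cases "norm x \<le> r") auto
  qed auto
  have eq: "indicator (cball 0 r) x *\<^sub>R complex_of_real (g x) = complex_of_real (g x)" for x
    using assms(2)[of x] by (cases "norm x \<le> r") auto
  have "integrable lborel (\<lambda>x. indicator (cball 0 r) x *\<^sub>R complex_of_real (g x))"
    by (rule L2_integrable_on_bounded[OF L]) auto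
  then show "integrable lborel (\<lambda>x. complex_of_real (g x))" unfolding eq .
qed

lemma test_function_L2:
  assumes "\<phi> \<in> test_functions"
  shows "(\<lambda>x. complex_of_real (\<phi> x)) \<in> L2" "integrable lborel (\<lambda>x. complex_of_real (\<phi> x))"
    "(\<lambda>x. complex_of_real (pdiff j \<phi> x)) \<in> L2" "integrable lborel (\<lambda>x. complex_of_real (pdiff j \<phi> x))"
    "\<exists>M. \<forall>x. \<bar>pdiff j \<phi> x\<bar> \<le> M"
proof -
  obtain r where "r > 0" and r: "\<And>x. norm x \<ge> r \<Longrightarrow> \<phi> x = 0" "\<And>x j. norm x \<ge> r \<Longrightarrow> pdiff j \<phi> x = 0"
    using test_function_support[OF assms] by metis
  note c = test_function_continuous[OF assms]
  show "(\<lambda>x. complex_of_real (\<phi> x)) \<in> L2" "integrable lborel (\<lambda>x. complex_of_real (\<phi> x))"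
    using compactly_supported_L2[OF c(1) r(1)] by auto
  show "(\<lambda>x. complex_of_real (pdiff j \<phi> x)) \<in> L2" "integrable lborel (\<lambda>x. complex_of_real (pdiff j \<phi> x))"
    "\<exists>M. \<forall>x. \<bar>pdiff j \<phi> x\<bar> \<le> M"
    using compactly_supported_L2[OF c(2) r(2)] by auto
qed

section \<open>The Fourier transform of a partial derivative\<close>

lemma norm_cis_minus_1: "norm (cis t - 1) \<le> \<bar>t\<bar>"
proof -
  have "norm (cis t - 1) = 2 * \<bar>sin (t / 2)\<bar>"
  proof -
    have "(norm (cis t - 1))\<^sup>2 = (2 * \<bar>sin (t / 2)\<bar>)\<^sup>2"
      using cos_double_sin[of "t / 2"] sin_cos_squared_add[of t]
      by (simp add: cmod_power2 power_mult_distrib power2_diff)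
    then show ?thesis by (rule power2_eq_imp_eq) auto
  qed
  also have "\<dots> \<le> 2 * \<bar>t / 2\<bar>" by (intro mult_left_mono abs_sin_x_le_abs_x) auto
  finally show ?thesis by simp
qed

lemma cis_quotient_tendsto:
  assumes "s \<longlonglongrightarrow> 0" "\<And>n. s n \<noteq> 0"
  shows "(\<lambda>n. (cis (s n * t) - 1) / of_real (s n)) \<longlonglongrightarrow> \<i> * of_real t"
proof -
  let ?w = "\<i> * of_real t"
  have "((\<lambda>z. exp (z * ?w)) has_field_derivative ?w) (at 0)"
    by (auto intro!: derivative_eq_intros)
  then have "((\<lambda>h. (exp (h * ?w) - 1) / h) \<longlongrightarrow> ?w) (at 0)"
    by (simp add: DERIV_def)
  moreover have "filterlim (\<lambda>n. complex_of_real (s n)) (at 0) sequentially"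
    using assms by (auto simp: filterlim_at intro!: tendsto_eq_intros)
  ultimately have "(\<lambda>n. (exp (of_real (s n) * ?w) - 1) / of_real (s n)) \<longlonglongrightarrow> ?w"
    by (rule filterlim_compose)
  then show ?thesis by (simp add: cis_conv_exp mult_ac)
qed

lemma norm_cis_quotient_le: "s \<noteq> 0 \<Longrightarrow> norm ((cis (s * t) - 1) / of_real s) \<le> \<bar>t\<bar>"
  using norm_cis_minus_1[of "s * t"] by (simp add: norm_divide divide_le_eq abs_mult mult.commute)

lemma inner_axis_vec: "(s *\<^sub>R axis j 1) \<bullet> \<xi> = s * (\<xi>::real^3)$j"
  by (simp add: inner_axis' )

text \<open>Difference quotients replace integration by parts: the translation rule gives the
  transform of the quotient exactly, and dominated convergence, with the mean value theorem for the
  majorant, passes to the derivative.\<close>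

lemma fourier_pdiff:
  assumes \<phi>: "\<phi> \<in> test_functions"
  shows "fourier (\<lambda>x. of_real (pdiff j \<phi> x)) \<xi> = \<i> * of_real (\<xi>$j) * fourier (\<lambda>x. of_real (\<phi> x)) \<xi>"
proof -
  define s where "s = (\<lambda>n. 1 / real (Suc n))"
  have s: "s \<longlonglongrightarrow> 0" "s n \<noteq> 0" "0 < s n" "s n \<le> 1" for n
    unfolding s_def using LIMSEQ_inverse_real_of_nat by (auto simp: inverse_eq_divide)
  let ?e = "axis j 1 :: real^3"
  let ?q = "\<lambda>n x. (\<phi> (x + s n *\<^sub>R ?e) - \<phi> x) / s n"
  obtain r where r: "r > 0" "\<And>x. norm x \<ge> r \<Longrightarrow> \<phi> x = 0" "\<And>x j. norm x \<ge> r \<Longrightarrow> pdiff j \<phi> x = 0"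
    using test_function_support[OF \<phi>] by metis
  obtain M where M: "\<And>x. \<bar>pdiff j \<phi> x\<bar> \<le> M" using test_function_L2(5)[OF \<phi>] by blast
  have M0: "0 \<le> M" using M[of 0] by linarith
  have [measurable]: "\<phi> \<in> borel_measurable borel" "pdiff j \<phi> \<in> borel_measurable borel"
    using test_function_continuous[OF \<phi>] by (auto intro: borel_measurable_continuous_onI)
  have der: "((\<lambda>t. \<phi> (x + t *\<^sub>R ?e)) has_real_derivative pdiff j \<phi> (x + t *\<^sub>R ?e)) (at t)" for x t
  proof -
    have "(\<phi> has_derivative frechet_derivative \<phi> (at (x + t *\<^sub>R ?e))) (at (x + t *\<^sub>R ?e))"
      using test_function_differentiable[OF \<phi>] by (simp add: frechet_derivative_works)
    moreover have "((\<lambda>t. x + t *\<^sub>R ?e) has_derivative (\<lambda>v. v *\<^sub>R ?e)) (at t)"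
      by (auto intro!: derivative_eq_intros)
    ultimately have "((\<lambda>t. \<phi> (x + t *\<^sub>R ?e)) has_derivative (\<lambda>v. frechet_derivative \<phi> (at (x + t *\<^sub>R ?e)) (v *\<^sub>R ?e))) (at t)"
      by (intro has_derivative_compose[where f="\<lambda>t. x + t *\<^sub>R ?e" and g=\<phi>])
    moreover have "linear (frechet_derivative \<phi> (at (x + t *\<^sub>R ?e)))"
      using test_function_differentiable[OF \<phi>] by (rule linear_frechet_derivative)
    then have "(\<lambda>v. frechet_derivative \<phi> (at (x + t *\<^sub>R ?e)) (v *\<^sub>R ?e)) = (*) (pdiff j \<phi> (x + t *\<^sub>R ?e))"
      by (auto simp: linear_scale pdiff_def fun_eq_iff)
    ultimately show ?thesis
      unfolding has_field_derivative_def by simp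
  qed
  \<comment> \<open>Radius r + 1, because the step is at most 1 and can carry the support no
    further.\<close>
  have le: "\<bar>?q n x\<bar> \<le> M * indicator (cball 0 (r + 1)) x" for n x
  proof (cases "norm x \<le> r + 1")
    case True
    obtain z where "\<phi> (x + s n *\<^sub>R ?e) - \<phi> (x + 0 *\<^sub>R ?e) = (s n - 0) * pdiff j \<phi> (x + z *\<^sub>R ?e)"
      using MVT2[of 0 "s n" "\<lambda>t. \<phi> (x + t *\<^sub>R ?e)" "\<lambda>t. pdiff j \<phi> (x + t *\<^sub>R ?e)"] s(3) der by blast
    then have "?q n x = pdiff j \<phi> (x + z *\<^sub>R ?e)" using s(2) by simp
    then show ?thesis using M True by simp
  next
    case False
    have "norm (x + s n *\<^sub>R ?e) \<ge> norm x - norm (s n *\<^sub>R ?e)" by (rule norm_diff_ineq)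
    then have "norm (x + s n *\<^sub>R ?e) \<ge> r" using False s(3,4)[of n] by simp
    then show ?thesis using r(2) False M0 by simp
  qed
  have lim: "(\<lambda>n. LINT x|lborel. cis (- (x \<bullet> \<xi>)) * complex_of_real (?q n x)) \<longlonglongrightarrow> (LINT x|lborel. cis (- (x \<bullet> \<xi>)) * of_real (pdiff j \<phi> x))"
  proof (rule integral_dominated_convergence[where w="\<lambda>x. M * indicator (cball 0 (r + 1)) x"])
    show "integrable lborel (\<lambda>x::real^3. M * indicator (cball 0 (r + 1)) x)"
      using emeasure_bounded_finite[of "cball (0::real^3) (r + 1)"]
      by (intro integrable_mult_right) (auto simp: integrable_indicator_iff)
    show "AE x in lborel. norm (cis (- (x \<bullet> \<xi>)) * complex_of_real (?q n x)) \<le> M * indicator (cball 0 (r + 1)) x" for n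
      by (intro AE_I2) (simp only: norm_mult norm_cis mult_1 norm_of_real le)
    show "AE x in lborel. (\<lambda>n. cis (- (x \<bullet> \<xi>)) * complex_of_real (?q n x)) \<longlonglongrightarrow> cis (- (x \<bullet> \<xi>)) * of_real (pdiff j \<phi> x)"
    proof (intro AE_I2 tendsto_intros)
      fix x
      have "((\<lambda>h. (\<phi> (x + (0 + h) *\<^sub>R ?e) - \<phi> (x + 0 *\<^sub>R ?e)) / h) \<longlongrightarrow> pdiff j \<phi> (x + 0 *\<^sub>R ?e)) (at 0)"
        using der[of x 0] unfolding DERIV_def .
      moreover have "filterlim s (at 0) sequentially"
        using s(1,2) by (simp add: filterlim_at)
      ultimately have "(\<lambda>n. (\<phi> (x + (0 + s n) *\<^sub>R ?e) - \<phi> (x + 0 *\<^sub>R ?e)) / s n) \<longlonglongrightarrow> pdiff j \<phi> (x + 0 *\<^sub>R ?e)"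
        by (rule filterlim_compose)
      then show "(\<lambda>n. ?q n x) \<longlonglongrightarrow> pdiff j \<phi> x" by simp
    qed
  qed measurable
  have eq: "(LINT x|lborel. cis (- (x \<bullet> \<xi>)) * complex_of_real (?q n x)) = (cis (s n * \<xi>$j) - 1) / of_real (s n) * fourier (\<lambda>x. of_real (\<phi> x)) \<xi>" for n
  proof -
    let ?\<Phi> = "\<lambda>x. complex_of_real (\<phi> x)"
    have i: "integrable lborel ?\<Phi>" "integrable lborel (\<lambda>x. ?\<Phi> (x + s n *\<^sub>R ?e))"
      using test_function_L2(2)[OF \<phi>] integrable_translate_iff[of ?\<Phi>] by auto
    have "(LINT x|lborel. cis (- (x \<bullet> \<xi>)) * complex_of_real (?q n x)) = fourier (\<lambda>x. (1 / of_real (s n)) * (?\<Phi> (x + s n *\<^sub>R ?e) - ?\<Phi> x)) \<xi>"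
      by (simp add: fourier_def)
    also have "\<dots> = (1 / of_real (s n)) * (cis (s n * \<xi>$j) * fourier ?\<Phi> \<xi> - fourier ?\<Phi> \<xi>)"
      unfolding fourier_cmult fourier_diff[OF i(2,1)] fourier_translate[of ?\<Phi>] inner_axis_vec ..
    finally show ?thesis by (simp add: field_simps)
  qed
  have "(\<lambda>n. (cis (s n * \<xi>$j) - 1) / of_real (s n) * fourier (\<lambda>x. of_real (\<phi> x)) \<xi>) \<longlonglongrightarrow> \<i> * of_real (\<xi>$j) * fourier (\<lambda>x. of_real (\<phi> x)) \<xi>"
    by (intro tendsto_intros cis_quotient_tendsto s)
  from LIMSEQ_unique[OF lim[unfolded eq] this] show ?thesis
    by (simp only: fourier_def)
qed

subsection \<open>Existence of bump functions\<close>

text \<open>The n-th derivative of exp (-1/x) on x > 0 is P_n(y) exp (-y) at y = 1/x. Since dy/dx =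
  -y^2, differentiating once more gives the recursion P_(n+1) = y^2 (P_n - P_n').\<close>

fun bump_poly :: "nat \<Rightarrow> real poly" where
  "bump_poly 0 = 1"
| "bump_poly (Suc n) = [:0, 0, 1:] * (bump_poly n - pderiv (bump_poly n))"

definition bump_deriv :: "nat \<Rightarrow> real \<Rightarrow> real" where
  "bump_deriv n x = (if x > 0 then poly (bump_poly n) (1 / x) * exp (- (1 / x)) else 0)"

lemma poly_exp_tendsto_0: "((\<lambda>y::real. poly p y * exp (- y)) \<longlongrightarrow> 0) at_top"
proof -
  have "((\<lambda>y. \<Sum>i\<le>degree p. coeff p i * (y ^ i / exp y)) \<longlongrightarrow> (\<Sum>i\<le>degree p. coeff p i * 0)) at_top"
    by (intro tendsto_intros tendsto_power_div_exp_0)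
  then show ?thesis
    by (simp add: poly_altdef sum_distrib_right exp_minus divide_inverse mult.assoc)
qed

lemma bump_deriv_has_derivative: "(bump_deriv n has_real_derivative bump_deriv (Suc n) x) (at x)"
proof -
  consider "x > 0" | "x < 0" | "x = 0" by linarith
  then show ?thesis
  proof cases
    case 1
    have "((\<lambda>x. poly (bump_poly n) (1 / x) * exp (- (1 / x))) has_real_derivative bump_deriv (Suc n) x) (at x)"
      using 1 by (auto intro!: derivative_eq_intros poly_DERIV[THEN DERIV_chain2] simp: bump_deriv_def power2_eq_square field_simps)
    then show ?thesis
      by (rule has_field_derivative_transform_within_open[of _ _ _ "{0<..}"]) (use 1 in \<open>auto simp: bump_deriv_def\<close>)
  next
    case 2
    have "((\<lambda>x. 0) has_real_derivative bump_deriv (Suc n) x) (at x)"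
      using 2 by (simp add: bump_deriv_def)
    then show ?thesis
      by (rule has_field_derivative_transform_within_open[of _ _ _ "{..<0}"]) (use 2 in \<open>auto simp: bump_deriv_def\<close>)
  next
    case 3
    have "((\<lambda>h. bump_deriv n h / h) \<longlongrightarrow> 0) (at 0)"
    proof (rule filterlim_split_at)
      show "((\<lambda>h. bump_deriv n h / h) \<longlongrightarrow> 0) (at_left 0)"
        by (rule tendsto_eventually) (auto simp: eventually_at_left_field bump_deriv_def intro: exI[of _ "-1"])
      \<comment> \<open>The extra factor \<open>[:0, 1:]\<close> is the 1 / h of the difference
        quotient, written as a polynomial in the inverse of h.\<close>
      have "((\<lambda>h::real. poly ([:0, 1:] * bump_poly n) (inverse h) * exp (- inverse h)) \<longlongrightarrow> 0) (at_right 0)"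
        by (rule filterlim_compose[OF poly_exp_tendsto_0 filterlim_inverse_at_top_right])
      moreover have "\<forall>\<^sub>F h in at_right 0. poly ([:0, 1:] * bump_poly n) (inverse h) * exp (- inverse h) = bump_deriv n h / h"
        unfolding eventually_at_right_field
        by (intro exI[of _ 1]) (auto simp: bump_deriv_def divide_inverse)
      ultimately show "((\<lambda>h. bump_deriv n h / h) \<longlongrightarrow> 0) (at_right 0)"
        by (rule Lim_transform_eventually)
    qed
    then show ?thesis
      unfolding DERIV_def 3 by (simp add: bump_deriv_def)
  qed
qed

text \<open>The order n and the scalar c are general so that the family is closed under partial
  derivatives: the derivative in direction i raises n and multiplies c by b, every other one sets c
  to 0.\<close>

lemma Ck_coordinate:
  "Ck k (\<lambda>x::real^3. c * bump_deriv n (a + b * x$i))"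
proof (induction k arbitrary: c n)
  case 0
  have "continuous_on UNIV (bump_deriv n)"
    using bump_deriv_has_derivative by (intro DERIV_continuous_on) (auto intro: has_field_derivative_at_within)
  then show ?case
    by (auto intro!: continuous_intros continuous_on_compose2[of UNIV "bump_deriv n"])
next
  case (Suc k)
  let ?f = "\<lambda>x::real^3. c * bump_deriv n (a + b * x$i)"
  have d: "(?f has_derivative (\<lambda>v. c * ((b * v$i) * bump_deriv (Suc n) (a + b * x$i)))) (at x)" for x
  proof -
    have "((\<lambda>x. a + b * x$i) has_derivative (\<lambda>v. b * v$i)) (at x)"
      by (auto intro!: derivative_eq_intros bounded_linear.has_derivative[OF bounded_linear_vec_nth])
    from has_derivative_mult_right[OF DERIV_compose_FDERIV[OF bump_deriv_has_derivative this], of c n]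
    show ?thesis .
  qed
  have "pdiff j ?f = (\<lambda>x. (if i = j then c * b else 0) * bump_deriv (Suc n) (a + b * x$i))" for j
    using pdiff_eqI[OF d] by (auto simp: axis_def fun_eq_iff)
  then have "Ck k (pdiff j ?f)" for j
    using Suc.IH[of "if i = j then c * b else 0" "Suc n"] by simp
  moreover have "?f differentiable_on UNIV"
    unfolding differentiable_on_def using d differentiableI by blast
  ultimately show ?case by simp
qed

text \<open>A smooth profile in one coordinate, positive exactly for |x_i| < 1 / N. The product over
  the coordinates lives on a cube, and its smoothness needs no smoothness of the norm. The first
  argument is written with \<open>+ - N\<close> to match \<open>Ck_coordinate\<close>.\<close>

definition bump1 :: "real \<Rightarrow> 3 \<Rightarrow> real^3 \<Rightarrow> real" where
  "bump1 N i x = bump_deriv 0 (1 + - N * x$i) * bump_deriv 0 (1 + N * x$i)"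

definition bump :: "real \<Rightarrow> real^3 \<Rightarrow> real" where
  "bump N x = bump1 N 1 x * (bump1 N 2 x * bump1 N 3 x)"

lemma bump_deriv_0_nonneg: "bump_deriv 0 x \<ge> 0"
  by (simp add: bump_deriv_def)

lemma bump_nonneg: "bump N x \<ge> 0"
  by (simp add: bump_def bump1_def bump_deriv_0_nonneg)

lemma bump_0: "bump N 0 > 0"
  by (simp add: bump_def bump1_def bump_deriv_def)

lemma bump_support: "bump N x \<noteq> 0 \<Longrightarrow> N > 0 \<Longrightarrow> \<bar>x$i\<bar> < 1 / N"
proof -
  assume b: "bump N x \<noteq> 0" and N: "N > 0"
  have "bump1 N i x \<noteq> 0"
    using b exhaust_3[of i] by (auto simp: bump_def)
  then have "- N * x$i > -1" "N * x$i > -1"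
    by (auto simp: bump1_def bump_deriv_def split: if_splits)
  then have "N * \<bar>x$i\<bar> < 1" by (auto simp: abs_real_def)
  then show ?thesis using N by (simp add: field_simps)
qed

lemma bump_test_function:
  assumes "N > 0"
  shows "bump N \<in> test_functions"
proof -
  have "Ck k (\<lambda>x. bump1 N i x)" for k i
    unfolding bump1_def using Ck_coordinate[of k 1 0 1 "- N" i] Ck_coordinate[of k 1 0 1 N i]
    by (intro Ck_mult) simp_all
  then have "Ck k (bump N)" for k
    unfolding bump_def[abs_def] by (intro Ck_mult)
  moreover have "bounded {x. bump N x \<noteq> 0}"
  proof (rule boundedI)
    fix x assume "x \<in> {x. bump N x \<noteq> 0}"
    then have "\<bar>x$i\<bar> < 1 / N" for i using bump_support assms by blast
    then have "(\<Sum>i\<in>UNIV. \<bar>x$i\<bar>) \<le> (\<Sum>i\<in>(UNIV::3 set). 1 / N)" by (intro sum_mono) (simp add: less_imp_le)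
    with norm_le_l1_cart[of x] show "norm x \<le> 3 / N" by simp
  qed
  ultimately show ?thesis by (simp add: test_functions_def)
qed

lemma integral_continuous_pos:
  fixes f :: "real^3 \<Rightarrow> real"
  assumes "continuous_on UNIV f" "integrable lborel f" "\<And>x. f x \<ge> 0" "f 0 > 0"
  shows "(LINT x|lborel. f x) > 0"
proof (rule ccontr)
  assume "\<not> ?thesis"
  moreover have "0 \<le> (LINT x|lborel. f x)" using assms(3) by simp
  ultimately have "(LINT x|lborel. f x) = 0" by simp
  then have ae: "AE x in lborel. f x = 0"
    using integral_nonneg_eq_0_iff_AE[OF assms(2)] assms(3) by auto
  let ?S = "{x. f x > 0}"
  have "open ?S" using assms(1) by (intro open_Collect_less continuous_intros) auto
  moreover have "0 \<in> ?S" using assms by simp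
  ultimately have "\<not> negligible ?S" using open_not_negligible by blast
  moreover have "?S \<in> null_sets lborel"
  proof (subst AE_iff_null_sets)
    show "?S \<in> sets lborel" using \<open>open ?S\<close> by simp
    show "AE x in lborel. x \<notin> ?S" using ae by eventually_elim simp
  qed
  then have "negligible ?S" unfolding negligible_iff_null_sets by (rule null_sets_completionI)
  ultimately show False by contradiction
qed

text \<open>On the support |x| \<le> 3 / N, so |x \<bullet> \<xi>| \<le> 1 and the cosine is
  nonnegative; the real part of the transform is therefore positive. The bumps for N = 1, 2, ...
  thus form a countable family of test functions whose transforms have no common zero.\<close>

lemma fourier_bump_nonzero:
  assumes "N > 0" "3 * norm \<xi> \<le> N"
  shows "fourier (\<lambda>x. of_real (bump N x)) \<xi> \<noteq> 0"
proof -
  let ?b = "\<lambda>x. complex_of_real (bump N x)"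
  note t = bump_test_function[OF assms(1)]
  have i: "integrable lborel (\<lambda>x. cis (- (x \<bullet> \<xi>)) * ?b x)"
    by (rule fourier_integrable[OF test_function_L2(2)[OF t]])
  have Re: "Re (cis (- (x \<bullet> \<xi>)) * ?b x) = cos (x \<bullet> \<xi>) * bump N x" for x by simp
  have "(LINT x|lborel. cos (x \<bullet> \<xi>) * bump N x) > 0"
  proof (rule integral_continuous_pos)
    show "continuous_on UNIV (\<lambda>x. cos (x \<bullet> \<xi>) * bump N x)"
      by (intro continuous_intros test_function_continuous(1)[OF t])
    show "integrable lborel (\<lambda>x. cos (x \<bullet> \<xi>) * bump N x)"
      using integrable_Re[OF i] by (simp only: Re)
    show "0 \<le> cos (x \<bullet> \<xi>) * bump N x" for x
    proof (cases "bump N x = 0")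
      case False
      then have x: "\<bar>x$i\<bar> < 1 / N" for i using bump_support assms by blast
      then have "(\<Sum>i\<in>UNIV. \<bar>x$i\<bar>) \<le> (\<Sum>i\<in>(UNIV::3 set). 1 / N)" by (intro sum_mono) (simp add: less_imp_le)
      with norm_le_l1_cart[of x] have "norm x \<le> 3 / N" by simp
      then have "norm x * norm \<xi> \<le> 3 / N * norm \<xi>" by (intro mult_right_mono) auto
      also have "\<dots> \<le> 1" using assms by (simp add: field_simps)
      finally have "\<bar>x \<bullet> \<xi>\<bar> \<le> 1" using Cauchy_Schwarz_ineq2[of x \<xi>] by linarith
      then have "cos (x \<bullet> \<xi>) \<ge> 0" using pi_gt3 by (intro cos_ge_zero) auto
      then show ?thesis using bump_nonneg by simp
    qed simp
  qed (use bump_0 in simp)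
  then have "Re (fourier ?b \<xi>) > 0"
    unfolding fourier_def integral_Re[OF i, symmetric] Re .
  then show ?thesis by auto
qed

subsection \<open>The space \<open>H\<^sup>1\<close> on the Fourier side\<close>

abbreviation xi_mult :: "3 \<Rightarrow> (real^3 \<Rightarrow> complex) \<Rightarrow> real^3 \<Rightarrow> complex" where
  "xi_mult j h \<equiv> \<lambda>\<xi>. of_real (\<xi>$j) * h \<xi>"

lemma integral_of_real_eq_l2_inner: "(LINT x|lborel. u x * of_real (\<phi> x)) = l2_inner u (\<lambda>x. of_real (\<phi> x))"
  by (simp add: l2_inner_def)

text \<open>Testing the weak derivative with all translates of one \<phi> says, by Parseval, that
  the Fourier transform of the function W below vanishes identically. W is integrable and square
  integrable, so Plancherel gives W = 0 almost everywhere, and W is a multiple of k - \<i> \<xi>_j h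
  by the conjugate transform of \<phi>.\<close>

lemma weak_pdiff_imp_fourier:
  assumes w: "is_weak_pdiff j u g" and u: "is_fourier_L2 u h" and g: "is_fourier_L2 g k"
  shows "AE \<xi> in lborel. k \<xi> = \<i> * xi_mult j h \<xi>"
proof -
  note L = is_fourier_L2D[OF u] is_fourier_L2D[OF g]
  have [measurable]: "h \<in> borel_measurable borel" "k \<in> borel_measurable borel"
    using L by (auto dest: L2_measurable)
  have z: "AE \<xi> in lborel. (k \<xi> - \<i> * xi_mult j h \<xi>) * cnj (fourier (\<lambda>x. of_real (\<phi> x)) \<xi>) = 0"
    if \<phi>: "\<phi> \<in> test_functions" for \<phi>
  proof -
    let ?\<Phi> = "\<lambda>x. complex_of_real (\<phi> x)" and ?D = "\<lambda>x. complex_of_real (pdiff j \<phi> x)"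
    note t = test_function_L2(1,2)[OF \<phi>] test_function_L2(3,4)[OF \<phi>, of j]
    note F = Plancherel_L1_L2(1)[OF t(2,1)] Plancherel_L1_L2(1)[OF t(4,3)]
    define W where "W = (\<lambda>\<xi>. h \<xi> * cnj (fourier ?D \<xi>) + k \<xi> * cnj (fourier ?\<Phi> \<xi>))"
    have Wi: "integrable lborel W"
      unfolding W_def by (intro Bochner_Integration.integrable_add l2_inner_integrable L F)
    have bL: "(\<lambda>\<xi>. p \<xi> * cnj (fourier q \<xi>)) \<in> L2" if "p \<in> L2" "fourier q \<in> L2" for p q
    proof -
      have "(\<lambda>\<xi>. cnj (fourier q \<xi>) * p \<xi>) \<in> L2"
        using L2_measurable[OF L2_cnj[OF that(2)]] norm_fourier_le[of q]
        by (intro L2_mult_bounded[OF that(1)]) auto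
      then show ?thesis by (simp add: mult.commute)
    qed
    have WL: "W \<in> L2"
      unfolding W_def by (intro L2_add bL L F)
    have "fourier W a = 0" for a
    proof -
      have s: "(\<lambda>x. \<phi> (x + a)) \<in> test_functions" by (rule test_function_shift[OF \<phi>])
      have pd: "pdiff j (\<lambda>x. \<phi> (x + a)) x = pdiff j \<phi> (x + a)" for x
        by (rule pdiff_shift[OF test_function_differentiable[OF \<phi>]])
      have "l2_inner u (\<lambda>x. ?D (x + a)) = - l2_inner g (\<lambda>x. ?\<Phi> (x + a))"
        using w s unfolding is_weak_pdiff_def integral_of_real_eq_l2_inner by (force simp: pd)
      then have hk: "l2_inner h (\<lambda>\<xi>. cis (a \<bullet> \<xi>) * fourier ?D \<xi>) = - l2_inner k (\<lambda>\<xi>. cis (a \<bullet> \<xi>) * fourier ?\<Phi> \<xi>)"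
        using Parseval[OF u is_fourier_L2_translate[OF is_fourier_L2_fourier[OF t(3,4)], of a]]
          Parseval[OF g is_fourier_L2_translate[OF is_fourier_L2_fourier[OF t(1,2)], of a]] by simp
      have cL: "(\<lambda>\<xi>. cis (a \<bullet> \<xi>) * q \<xi>) \<in> L2" if "q \<in> L2" for q
        by (rule L2_mult_bounded[OF that, of _ 1]) auto
      have "fourier W a = (LINT \<xi>|lborel. cis (- (\<xi> \<bullet> a)) * W \<xi>)" by (rule fourier_def)
      also have "\<dots> = (LINT \<xi>|lborel. h \<xi> * cnj (cis (a \<bullet> \<xi>) * fourier ?D \<xi>) + k \<xi> * cnj (cis (a \<bullet> \<xi>) * fourier ?\<Phi> \<xi>))"
        by (intro Bochner_Integration.integral_cong refl) (simp add: W_def cis_cnj inner_commute algebra_simps)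
      also have "\<dots> = l2_inner h (\<lambda>\<xi>. cis (a \<bullet> \<xi>) * fourier ?D \<xi>) + l2_inner k (\<lambda>\<xi>. cis (a \<bullet> \<xi>) * fourier ?\<Phi> \<xi>)"
        unfolding l2_inner_def by (intro Bochner_Integration.integral_add l2_inner_integrable L cL F)
      finally show ?thesis using hk by simp
    qed
    then have "mass (fourier W) = 0" by (simp add: mass_def)
    then have "mass W = 0" using Plancherel_L1_L2(2)[OF Wi WL] by simp
    then have "AE \<xi> in lborel. W \<xi> = 0" using mass_eq_0_iff[OF WL] by simp
    then show ?thesis
      by eventually_elim (simp add: W_def fourier_pdiff[OF \<phi>] algebra_simps)
  qed
  \<comment> \<open>Countably many bumps give one exceptional null set; outside it, at each \<xi>, a
    bump with large index has a nonzero transform and can be cancelled.\<close>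
  have "AE \<xi> in lborel. \<forall>n. (k \<xi> - \<i> * xi_mult j h \<xi>) * cnj (fourier (\<lambda>x. of_real (bump (real (Suc n)) x)) \<xi>) = 0"
    by (intro AE_all_countable[THEN iffD2] allI z bump_test_function) simp
  then show ?thesis
  proof eventually_elim
    case (elim \<xi>)
    obtain n :: nat where "3 * norm \<xi> < real n" using reals_Archimedean2 by blast
    then have "fourier (\<lambda>x. of_real (bump (real (Suc n)) x)) \<xi> \<noteq> 0"
      by (intro fourier_bump_nonzero) auto
    with elim[rule_format, of n] show ?case by simp
  qed
qed

lemma fourier_imp_weak_pdiff:
  assumes u: "is_fourier_L2 u h" and g: "is_fourier_L2 g (\<lambda>\<xi>. \<i> * xi_mult j h \<xi>)"
  shows "is_weak_pdiff j u g"
  unfolding is_weak_pdiff_def integral_of_real_eq_l2_inner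
proof
  fix \<phi> assume \<phi>: "\<phi> \<in> test_functions"
  let ?\<Phi> = "\<lambda>x. complex_of_real (\<phi> x)" and ?D = "\<lambda>x. complex_of_real (pdiff j \<phi> x)"
  note t = test_function_L2(1,2)[OF \<phi>] test_function_L2(3,4)[OF \<phi>, of j]
  have "l2_inner h (fourier ?D) = l2_inner (\<lambda>\<xi>. (-1) * (\<i> * xi_mult j h \<xi>)) (fourier ?\<Phi>)"
    unfolding l2_inner_def
    by (intro Bochner_Integration.integral_cong refl) (simp add: fourier_pdiff[OF \<phi>])
  also have "\<dots> = - l2_inner (\<lambda>\<xi>. \<i> * xi_mult j h \<xi>) (fourier ?\<Phi>)"
    unfolding l2_inner_cmult_left[of "-1"] by simp
  finally have eq: "l2_inner h (fourier ?D) = - l2_inner (\<lambda>\<xi>. \<i> * xi_mult j h \<xi>) (fourier ?\<Phi>)" .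
  have aux: "a = - b" if "A = c * a" "B = c * b" "A = - B" "c \<noteq> 0" for a b c A B :: complex
    using that by (metis mult_cancel_left mult_minus_right)
  show "l2_inner u ?D = - l2_inner g ?\<Phi>"
    by (rule aux[OF Parseval[OF u is_fourier_L2_fourier[OF t(3,4)]] Parseval[OF g is_fourier_L2_fourier[OF t(1,2)]] eq]) simp
qed

lemma H1_fourierI:
  assumes "is_fourier_L2 u h" "\<And>j. xi_mult j h \<in> L2"
  shows "u \<in> H1"
proof -
  have "\<exists>g\<in>L2. is_weak_pdiff j u g" for j
  proof -
    obtain g where "is_fourier_L2 g (\<lambda>\<xi>. \<i> * xi_mult j h \<xi>)"
      using fourier_L2_surj[OF L2_cmult[OF assms(2)[of j], of \<i>]] by blast
    with fourier_imp_weak_pdiff[OF assms(1) this] show ?thesis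
      by (auto dest: is_fourier_L2D)
  qed
  with is_fourier_L2D[OF assms(1)] show ?thesis by (simp add: H1_def)
qed

lemma H1_L2: "u \<in> H1 \<Longrightarrow> u \<in> L2"
  by (simp add: H1_def)

text \<open>\<open>weak_pdiff\<close> is an arbitrary choice, but its transform is forced up to null
  sets. From here on A is computed on the Fourier side.\<close>

lemma H1_weak_pdiff:
  assumes "u \<in> H1" "is_fourier_L2 u h"
  shows "xi_mult j h \<in> L2" "is_fourier_L2 (weak_pdiff j u) (\<lambda>\<xi>. \<i> * xi_mult j h \<xi>)"
proof -
  have "\<exists>g. g \<in> L2 \<and> is_weak_pdiff j u g" using assms(1) by (auto simp: H1_def)
  then have w: "weak_pdiff j u \<in> L2 \<and> is_weak_pdiff j u (weak_pdiff j u)"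
    unfolding weak_pdiff_def by (rule someI_ex)
  then obtain k where k: "is_fourier_L2 (weak_pdiff j u) k" using is_fourier_L2_exists by blast
  have ae: "AE \<xi> in lborel. k \<xi> = \<i> * xi_mult j h \<xi>"
    using weak_pdiff_imp_fourier[OF _ assms(2) k] w by blast
  have [measurable]: "h \<in> borel_measurable borel" using L2_measurable[OF is_fourier_L2D(2)[OF assms(2)]] .
  have m: "(\<lambda>\<xi>. \<i> * xi_mult j h \<xi>) \<in> borel_measurable borel" by measurable
  show f: "is_fourier_L2 (weak_pdiff j u) (\<lambda>\<xi>. \<i> * xi_mult j h \<xi>)"
    by (rule is_fourier_L2_cong_AE[OF k ae m])
  show "xi_mult j h \<in> L2"
    using L2_cmult[OF is_fourier_L2D(2)[OF f], of "- \<i>"] by (simp add: mult.assoc[symmetric])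
qed

lemma weak_pdiff_L2: "u \<in> H1 \<Longrightarrow> weak_pdiff j u \<in> L2"
  using H1_weak_pdiff(2) is_fourier_L2_exists[OF H1_L2] is_fourier_L2D(1) by blast

lemma GP_A_eq: "u \<in> H1 \<Longrightarrow> GP_A u = (\<Sum>j\<in>UNIV. mass (weak_pdiff j u))"
  unfolding GP_A_def mass_def
  by (intro Bochner_Integration.integral_sum L2_integrable weak_pdiff_L2)

lemma mass_weak_pdiff:
  assumes "u \<in> H1" "is_fourier_L2 u h"
  shows "mass (weak_pdiff j u) = mass (xi_mult j h) / (2 * pi)^3"
  using is_fourier_L2_mass[OF H1_weak_pdiff(2)[OF assms, of j]] mass_cmult[of \<i> "xi_mult j h"] by simp

lemma GP_A_nonneg: "u \<in> H1 \<Longrightarrow> 0 \<le> GP_A u"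
  by (simp add: GP_A_eq sum_nonneg)

text \<open>If already the first partial derivative vanishes, the transform of u lives on the
  hyperplane \<xi>_1 = 0, a null set, and u has mass 0.\<close>

lemma GP_A_pos:
  assumes "u \<in> H1" "mass u > 0"
  shows "GP_A u > 0"
proof -
  obtain h where h: "is_fourier_L2 u h" using is_fourier_L2_exists[OF H1_L2[OF assms(1)]] by blast
  have "GP_A u \<noteq> 0"
  proof
    assume "GP_A u = 0"
    then have "mass (weak_pdiff 1 u) = 0" unfolding GP_A_eq[OF assms(1)]
      by (subst (asm) sum_nonneg_eq_0_iff) auto
    then have "mass (xi_mult 1 h) = 0" using mass_weak_pdiff[OF assms(1) h, of 1] by simp
    then have ae: "AE \<xi> in lborel. xi_mult 1 h \<xi> = 0"
      using mass_eq_0_iff[OF H1_weak_pdiff(1)[OF assms(1) h]] by blast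
    have "negligible {\<xi>::real^3. \<xi>$1 = 0}" by (rule negligible_standard_hyperplane_cart)
    then have "{\<xi>::real^3. \<xi>$1 = 0} \<in> null_sets lebesgue" by (simp add: negligible_iff_null_sets)
    then have "AE \<xi> in lebesgue. (\<xi>::real^3)$1 \<noteq> 0"
      using AE_not_in by fastforce
    then have "AE \<xi> in lborel. (\<xi>::real^3)$1 \<noteq> 0" by (simp add: AE_completion_iff)
    with ae have "AE \<xi> in lborel. h \<xi> = 0" by eventually_elim simp
    then have "mass h = 0" using mass_eq_0_iff[OF is_fourier_L2D(2)[OF h]] by simp
    then show False using is_fourier_L2_mass[OF h] assms(2) by simp
  qed
  with GP_A_nonneg[OF assms(1)] show ?thesis by simp
qed

subsection \<open>Difference quotients\<close>

definition shift_diff :: "3 \<Rightarrow> real \<Rightarrow> (real^3 \<Rightarrow> 'a::ab_group_add) \<Rightarrow> real^3 \<Rightarrow> 'a" where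
  "shift_diff j s u x = u (x + s *\<^sub>R axis j 1) - u x"

lemma shift_diff_L2: "u \<in> L2 \<Longrightarrow> shift_diff j s u \<in> L2"
  unfolding shift_diff_def[abs_def] by (intro L2_diff L2_translate)

lemma shift_diff_fourier:
  assumes "is_fourier_L2 u h"
  shows "is_fourier_L2 (shift_diff j s u) (\<lambda>\<xi>. (cis (s * \<xi>$j) - 1) * h \<xi>)"
  using is_fourier_L2_diff[OF is_fourier_L2_translate[OF assms, of "s *\<^sub>R axis j 1"] assms]
  by (simp add: shift_diff_def[abs_def] inner_axis' left_diff_distrib)

text \<open>On the Fourier side the multiplier (cis (s \<xi>_j) - 1) / s tends to \<i> \<xi>_j. Each
  of the two is bounded by |\<xi>_j|, which explains the factor 4 in the majorant.\<close>

lemma difference_quotient_tendsto: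
  assumes u: "u \<in> H1" and s: "s \<longlonglongrightarrow> 0" "\<And>n. s n \<noteq> 0"
  shows "(\<lambda>n. mass (\<lambda>x. shift_diff j (s n) u x / of_real (s n) - weak_pdiff j u x)) \<longlonglongrightarrow> 0"
proof -
  obtain h where h: "is_fourier_L2 u h" using is_fourier_L2_exists[OF H1_L2[OF u]] by blast
  have [measurable]: "h \<in> borel_measurable borel" using L2_measurable[OF is_fourier_L2D(2)[OF h]] .
  let ?m = "\<lambda>n \<xi>. (cis (s n * \<xi>$j) - 1) / of_real (s n) - \<i> * of_real ((\<xi>::real^3)$j)"
  have q: "is_fourier_L2 (\<lambda>x. shift_diff j (s n) u x / of_real (s n) - weak_pdiff j u x) (\<lambda>\<xi>. ?m n \<xi> * h \<xi>)" for n
    using is_fourier_L2_diff[OF is_fourier_L2_cmult[OF shift_diff_fourier[OF h, of j "s n"], of "1 / of_real (s n)"] H1_weak_pdiff(2)[OF u h, of j]]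
    by (simp add: algebra_simps diff_divide_distrib)
  have "(\<lambda>n. LINT \<xi>|lborel. (norm (?m n \<xi> * h \<xi>))\<^sup>2) \<longlonglongrightarrow> (LINT \<xi>::real^3|lborel. 0)"
  proof (rule integral_dominated_convergence[where w="\<lambda>\<xi>. 4 * (norm (xi_mult j h \<xi>))\<^sup>2"])
    show "integrable lborel (\<lambda>\<xi>. 4 * (norm (xi_mult j h \<xi>))\<^sup>2)"
      by (intro integrable_mult_right L2_integrable H1_weak_pdiff(1)[OF u h])
    show "AE \<xi> in lborel. (\<lambda>n. (norm (?m n \<xi> * h \<xi>))\<^sup>2) \<longlonglongrightarrow> 0"
    proof (intro AE_I2)
      fix \<xi> :: "real^3"
      have "(\<lambda>n. (norm (?m n \<xi> * h \<xi>))\<^sup>2) \<longlonglongrightarrow> (norm ((\<i> * of_real (\<xi>$j) - \<i> * of_real (\<xi>$j)) * h \<xi>))\<^sup>2"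
        by (intro tendsto_intros cis_quotient_tendsto s)
      then show "(\<lambda>n. (norm (?m n \<xi> * h \<xi>))\<^sup>2) \<longlonglongrightarrow> 0" by simp
    qed
    show "AE \<xi> in lborel. norm ((norm (?m n \<xi> * h \<xi>))\<^sup>2) \<le> 4 * (norm (xi_mult j h \<xi>))\<^sup>2" for n
    proof (intro AE_I2)
      fix \<xi> :: "real^3"
      have "norm (?m n \<xi>) \<le> norm ((cis (s n * \<xi>$j) - 1) / of_real (s n)) + norm (\<i> * complex_of_real (\<xi>$j))"
        by (rule norm_triangle_ineq4)
      also have "\<dots> \<le> 2 * \<bar>\<xi>$j\<bar>"
        using norm_cis_quotient_le[OF s(2)[of n], of "\<xi>$j"] by (simp add: norm_mult)
      finally have "norm (?m n \<xi>) * norm (h \<xi>) \<le> 2 * \<bar>\<xi>$j\<bar> * norm (h \<xi>)"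
        by (rule mult_right_mono) simp
      then have "norm (?m n \<xi> * h \<xi>) \<le> 2 * norm (xi_mult j h \<xi>)" by (simp only: norm_mult norm_of_real mult.assoc)
      then have "(norm (?m n \<xi> * h \<xi>))\<^sup>2 \<le> (2 * norm (xi_mult j h \<xi>))\<^sup>2" by (rule power_mono) simp
      then show "norm ((norm (?m n \<xi> * h \<xi>))\<^sup>2) \<le> 4 * (norm (xi_mult j h \<xi>))\<^sup>2"
        by (simp only: power_mult_distrib real_norm_def abs_power2) simp
    qed
  qed measurable
  then have lim: "(\<lambda>n. mass (\<lambda>\<xi>. ?m n \<xi> * h \<xi>) / (2 * pi)^3) \<longlonglongrightarrow> 0 / (2 * pi)^3"
    unfolding mass_def by (intro tendsto_intros) simp_all
  have eq: "mass (\<lambda>\<xi>. ?m n \<xi> * h \<xi>) / (2 * pi)^3 = mass (\<lambda>x. shift_diff j (s n) u x / of_real (s n) - weak_pdiff j u x)" for n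
    using is_fourier_L2_mass[OF q[of n]] by simp
  show ?thesis using lim unfolding eq by simp
qed

lemma difference_quotient_mass_tendsto:
  assumes u: "u \<in> H1" and s: "s \<longlonglongrightarrow> 0" "\<And>n. s n \<noteq> 0"
  shows "(\<lambda>n. mass (shift_diff j (s n) u) / (s n)\<^sup>2) \<longlonglongrightarrow> mass (weak_pdiff j u)"
proof -
  have "(\<lambda>x. (1 / of_real (s n)) * shift_diff j (s n) u x) \<in> L2" for n
    by (intro L2_cmult shift_diff_L2 H1_L2 u)
  then have "(\<lambda>n. mass (\<lambda>x. shift_diff j (s n) u x / of_real (s n))) \<longlonglongrightarrow> mass (weak_pdiff j u)"
    by (intro mass_tendsto weak_pdiff_L2 u difference_quotient_tendsto s) simp
  moreover have "mass (\<lambda>x. shift_diff j (s n) u x / of_real (s n)) = mass (shift_diff j (s n) u) / (s n)\<^sup>2" for n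
    using mass_cmult[of "1 / of_real (s n)" "shift_diff j (s n) u"] by (simp add: norm_divide power_divide)
  ultimately show ?thesis by simp
qed

text \<open>Fatou's lemma on the Fourier side: bounds along one sequence of steps suffice. This is
  how |u| and the test functions are seen to lie in H^1, with no chain rule.\<close>

lemma H1_difference_quotientI:
  assumes u: "u \<in> L2" and s: "s \<longlonglongrightarrow> 0" "\<And>n. s n \<noteq> 0"
    and le: "\<And>j n. mass (shift_diff j (s n) u) \<le> C * (s n)\<^sup>2"
  shows "u \<in> H1"
proof -
  obtain h where h: "is_fourier_L2 u h" using is_fourier_L2_exists[OF u] by blast
  have [measurable]: "h \<in> borel_measurable borel" using L2_measurable[OF is_fourier_L2D(2)[OF h]] .
  have "xi_mult j h \<in> L2" for j
  proof -
    let ?G = "\<lambda>n \<xi>. (cis (s n * \<xi>$j) - 1) / of_real (s n) * h \<xi>"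
    have q: "is_fourier_L2 (\<lambda>x. (1 / of_real (s n)) * shift_diff j (s n) u x) (?G n)" for n
      using is_fourier_L2_cmult[OF shift_diff_fourier[OF h, of j "s n"], of "1 / of_real (s n)"] by simp
    have "(\<lambda>\<xi>. \<i> * xi_mult j h \<xi>) \<in> L2"
    proof (rule L2_Fatou(1)[of ?G])
      show "?G n \<in> L2" for n by (rule is_fourier_L2D[OF q])
      show "AE \<xi> in lborel. (\<lambda>n. ?G n \<xi>) \<longlonglongrightarrow> \<i> * xi_mult j h \<xi>"
      proof (intro AE_I2)
        fix \<xi> :: "real^3"
        have "(\<lambda>n. ?G n \<xi>) \<longlonglongrightarrow> \<i> * of_real (\<xi>$j) * h \<xi>"
          by (intro tendsto_intros cis_quotient_tendsto s)
        then show "(\<lambda>n. ?G n \<xi>) \<longlonglongrightarrow> \<i> * xi_mult j h \<xi>" by (simp only: mult.assoc)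
      qed
      show "mass (?G n) \<le> (2 * pi)^3 * C" for n
      proof -
        have "mass (\<lambda>x. (1 / of_real (s n)) * shift_diff j (s n) u x) = mass (shift_diff j (s n) u) / (s n)\<^sup>2"
          unfolding mass_cmult by (simp add: norm_divide power_divide)
        also have "\<dots> \<le> C" using le[of j n] s(2)[of n] by (simp add: divide_le_eq)
        finally show ?thesis
          unfolding is_fourier_L2_mass[OF q] by (rule mult_left_mono) simp
      qed
    qed measurable
    then show ?thesis
      using L2_cmult[of "\<lambda>\<xi>. \<i> * xi_mult j h \<xi>" "- \<i>"] by (simp add: mult.assoc[symmetric])
  qed
  then show ?thesis by (rule H1_fourierI[OF h])
qed

lemma shift_diff_mass_le:
  assumes "u \<in> H1"
  shows "mass (shift_diff j s u) \<le> s\<^sup>2 * mass (weak_pdiff j u)"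
proof -
  obtain h where h: "is_fourier_L2 u h" using is_fourier_L2_exists[OF H1_L2[OF assms]] by blast
  note q = shift_diff_fourier[OF h, of j s]
  have "mass (\<lambda>\<xi>. (cis (s * \<xi>$j) - 1) * h \<xi>) \<le> \<bar>s\<bar>\<^sup>2 * mass (xi_mult j h)"
  proof (rule mass_mono[OF H1_weak_pdiff(1)[OF assms h] L2_measurable[OF is_fourier_L2D(2)[OF q]]])
    fix \<xi> :: "real^3"
    show "norm ((cis (s * \<xi>$j) - 1) * h \<xi>) \<le> \<bar>s\<bar> * norm (xi_mult j h \<xi>)"
      using mult_right_mono[OF norm_cis_minus_1[of "s * \<xi>$j"], of "norm (h \<xi>)"]
      by (simp add: norm_mult abs_mult)
  qed
  then have "mass (\<lambda>\<xi>. (cis (s * \<xi>$j) - 1) * h \<xi>) / (2 * pi)^3 \<le> s\<^sup>2 * mass (xi_mult j h) / (2 * pi)^3"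
    by (intro divide_right_mono) simp_all
  moreover have "mass (\<lambda>\<xi>. (cis (s * \<xi>$j) - 1) * h \<xi>) / (2 * pi)^3 = mass (shift_diff j s u)"
    unfolding is_fourier_L2_mass[OF q] by simp
  ultimately show ?thesis
    unfolding mass_weak_pdiff[OF assms h] by simp
qed

subsection \<open>The embedding of \<open>H\<^sup>1\<close> into \<open>L\<^sup>4\<close>\<close>

text \<open>A geometric sum is comparable with its last term, here at most (64/63) 64^n with 64^n =
  (8^n)^2 < r^2. It sums, for one frequency of modulus r, the weights of all cutoffs 8^k that the
  frequency exceeds.\<close>

lemma sum_powers_64_le:
  fixes r :: real
  assumes "r \<ge> 0"
  shows "(\<Sum>k<n. 64^k * (if 8^k < r then 1 else 0)) \<le> 2 * r\<^sup>2"
proof (induction n)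
  case (Suc n)
  show ?case
  proof (cases "8^n < r")
    case True
    have "63 * (\<Sum>k<m. (64::real)^k) \<le> 64^m" for m by (induction m) auto
    then have "(\<Sum>k<Suc n. (64::real)^k) \<le> 64^Suc n / 63" by (metis mult.commute pos_le_divide_eq zero_less_numeral)
    also have "\<dots> \<le> 2 * 64^n" by simp
    also have "(64::real)^n = (8^n)\<^sup>2" by (simp add: power2_eq_square flip: power_mult_distrib)
    also have "2 * (8^n)\<^sup>2 \<le> 2 * r\<^sup>2" using True by (intro mult_left_mono power_mono) auto
    finally have "(\<Sum>k<Suc n. (64::real)^k) \<le> 2 * r\<^sup>2" .
    moreover have "(\<Sum>k<Suc n. 64^k * (if 8^k < r then 1 else 0)) \<le> (\<Sum>k<Suc n. (64::real)^k)"
      by (intro sum_mono) auto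
    ultimately show ?thesis by linarith
  qed (use Suc in simp)
qed simp

lemma power_8_bracket:
  fixes y T :: real
  assumes "T > 0" "y > T"
  shows "\<exists>k. T * 8^k < y \<and> y \<le> T * 8^Suc k"
proof -
  obtain n where "y / T < 8^n" using real_arch_pow[of 8 "y / T"] by auto
  then have ex: "y \<le> T * 8^n" using assms by (simp add: field_simps)
  define m where "m = (LEAST n. y \<le> T * 8^n)"
  have m: "y \<le> T * 8^m" unfolding m_def by (rule LeastI[of _ n]) (rule ex)
  have "m \<noteq> 0" using m assms by (intro notI) simp
  then obtain k where k: "m = Suc k" using not0_implies_Suc by blast
  have "\<not> y \<le> T * 8^k" using not_less_Least[of k "\<lambda>n. y \<le> T * 8^n"] k unfolding m_def by simp
  then show ?thesis using m k by (intro exI[of _ k]) simp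
qed

lemma measure_cball_scale:
  assumes "r > 0"
  shows "measure lborel (cball (0::real^3) r) = r^3 * measure lborel (cball (0::real^3) 1)"
proof -
  have "(LINT x|lborel. indicat_real (cball (0::real^3) 1) ((1 / r) *\<^sub>R x)) = r^3 * measure lborel (cball (0::real^3) 1)"
    using assms by (subst integral_dilate) (auto simp: power_one_over)
  moreover have "indicat_real (cball (0::real^3) 1) ((1 / r) *\<^sub>R x) = indicat_real (cball 0 r) x" for x
    using assms by (auto simp: indicator_def field_simps)
  ultimately show ?thesis by simp
qed

lemma integrable_indicator_cball [simp]: "integrable lborel (indicat_real (cball (a::real^3) r))"
  using emeasure_bounded_finite[of "cball a r"] by (auto simp: integrable_indicator_iff)

lemma norm_vec_square_sum: "(norm (\<xi>::real^3))\<^sup>2 = (\<Sum>j\<in>UNIV. (\<xi>$j)\<^sup>2)"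
  by (simp add: norm_vec3_square sum_3)

text \<open>Bounds the integral of 1 / (1 + |\<xi>|^2) over the ball of radius 8^k by volumes of
  balls alone: the inner ball has volume of order 64^k, and on the rest the weight 16^-k times
  volume 512^k gives 32^k. The exact order is 8^k, but 64^k is all that the estimate needs.\<close>

lemma low_frequency_weight:
  assumes "norm \<xi> \<le> 8^k"
  shows "1 / (1 + (norm (\<xi>::real^3))\<^sup>2) \<le> indicator (cball 0 (4^k)) \<xi> + (1/16)^k * indicator (cball 0 (8^k)) \<xi>"
proof (cases "norm \<xi> \<le> 4^k")
  case True
  have "1 / (1 + (norm \<xi>)\<^sup>2) \<le> 1" by (simp add: divide_le_eq_1 add_pos_nonneg)
  then show ?thesis using True by (simp add: add_increasing2)
next
  case False
  then have "(4^k)\<^sup>2 \<le> (norm \<xi>)\<^sup>2" by (intro power_mono) auto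
  then have "16^k \<le> 1 + (norm \<xi>)\<^sup>2" by (simp add: power2_eq_square flip: power_mult_distrib)
  then have "1 / (1 + (norm \<xi>)\<^sup>2) \<le> 1 / 16^k" by (intro divide_left_mono) (auto intro!: mult_pos_pos add_pos_nonneg)
  then show ?thesis using assms False by (simp add: power_one_over)
qed

text \<open>
  Cut \<open>u\<close> at frequency \<open>8\<^sup>k\<close>. The low frequency part is bounded by \<open>C 8\<^sup>k\<close>, so on the set where
  \<open>|u|\<close> is of size \<open>2 C 8\<^sup>k\<close> it is controlled by the high frequency part, whose weighted \<open>L\<^sup>2\<close> norms
  are summable.
\<close>

theorem H1_L4:
  assumes u: "u \<in> H1"
  shows "integrable lborel (\<lambda>x. (norm (u x))^4)"
proof -
  obtain h where h: "is_fourier_L2 u h" using is_fourier_L2_exists[OF H1_L2[OF u]] by blast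
  have hL: "h \<in> L2" and uL: "u \<in> L2" using is_fourier_L2D[OF h] by auto
  have [measurable]: "h \<in> borel_measurable borel" "u \<in> borel_measurable borel"
    using hL uL by (auto dest: L2_measurable)
  define w where "w = (\<lambda>\<xi>. (norm \<xi>)\<^sup>2 * (norm (h \<xi>))\<^sup>2)"
  have w_eq: "w = (\<lambda>\<xi>. \<Sum>j\<in>UNIV. (norm (xi_mult j h \<xi>))\<^sup>2)"
    by (simp add: w_def norm_vec_square_sum sum_distrib_right norm_mult power_mult_distrib)
  have wi: "integrable lborel w"
    unfolding w_eq by (intro Bochner_Integration.integrable_sum L2_integrable H1_weak_pdiff(1)[OF u h])
  define N where "N = mass h + (LINT \<xi>|lborel. w \<xi>)"
  define V where "V = measure lborel (cball (0::real^3) 1)"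
  \<comment> \<open>N / 2 and V come from the two halves of the bound for the L^1 norm of the low
    frequencies; the + 1 keeps C positive.\<close>
  define C where "C = N / 2 + V + 1"
  have w0: "w \<xi> \<ge> 0" for \<xi> by (simp add: w_def)
  have "N \<ge> 0" "V \<ge> 0" unfolding N_def V_def using w0 by auto
  then have C: "C > 0" unfolding C_def by simp
  define hl where "hl = (\<lambda>k \<xi>. indicator (cball 0 (8^k)) \<xi> *\<^sub>R h \<xi>)"
  have hlL: "hl k \<in> L2" for k unfolding hl_def by (intro L2_indicator hL) simp
  have hli: "integrable lborel (hl k)" for k unfolding hl_def by (intro L2_integrable_on_bounded hL) auto
  define ul where "ul = (\<lambda>k x. fourier (hl k) (- x) / (2 * pi)^3)"
  have ulF: "is_fourier_L2 (ul k) (hl k)" for k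
    unfolding ul_def by (rule fourier_L2_inversion[OF is_fourier_L2_fourier[OF hlL hli]])
  define uh where "uh = (\<lambda>k x. u x - ul k x)"
  have uhF: "is_fourier_L2 (uh k) (\<lambda>\<xi>. h \<xi> - hl k \<xi>)" for k
    unfolding uh_def by (rule is_fourier_L2_diff[OF h ulF])
  have [measurable]: "uh k \<in> borel_measurable borel" for k
    using is_fourier_L2D(1)[OF uhF] by (rule L2_measurable)
  have hl_int: "(LINT \<xi>|lborel. norm (hl k \<xi>)) \<le> C * 8^k" for k
  proof -
    let ?B = "\<lambda>r. indicat_real (cball (0::real^3) r)"
    let ?g = "\<lambda>\<xi>. (8^k * ((norm (h \<xi>))\<^sup>2 + w \<xi>) + (1/8)^k * (?B (4^k) \<xi> + (1/16)^k * ?B (8^k) \<xi>)) / 2"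
    have le: "norm (hl k \<xi>) \<le> ?g \<xi>" for \<xi>
    proof (cases "norm \<xi> \<le> 8^k")
      case True
      let ?a = "norm (h \<xi>)" and ?t = "1 + (norm \<xi>)\<^sup>2"
      have t: "?t > 0" by (simp add: add_pos_nonneg)
      \<comment> \<open>Young's inequality with weight 8^k (1 + |\<xi>|^2): one term is the H^1
        density, the other the weight of \<open>low_frequency_weight\<close>. After integration both
        are of order 8^k.\<close>
      have "2 * (sqrt (8^k * ?t) * ?a) * sqrt (1 / (8^k * ?t)) \<le> (sqrt (8^k * ?t) * ?a)\<^sup>2 + (sqrt (1 / (8^k * ?t)))\<^sup>2"
        by (rule sum_squares_bound)
      moreover have "sqrt (8^k * ?t) * sqrt (1 / (8^k * ?t)) = 1"
        using t by (simp flip: real_sqrt_mult)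
      then have "2 * (sqrt (8^k * ?t) * ?a) * sqrt (1 / (8^k * ?t)) = 2 * ?a"
        by (simp only: mult.assoc mult.left_commute[of "sqrt (8^k * ?t)" ?a] mult.right_neutral)
      moreover have "(sqrt (8^k * ?t) * ?a)\<^sup>2 = 8^k * ?t * ?a\<^sup>2"
        using t by (simp add: power_mult_distrib)
      moreover have "(sqrt (1 / (8^k * ?t)))\<^sup>2 = (1/8)^k * (1 / ?t)"
        using t by (simp add: power_one_over)
      ultimately have "2 * ?a \<le> 8^k * ?t * ?a\<^sup>2 + (1/8)^k * (1 / ?t)" by linarith
      also have "\<dots> \<le> 8^k * ?t * ?a\<^sup>2 + (1/8)^k * (?B (4^k) \<xi> + (1/16)^k * ?B (8^k) \<xi>)"
        using low_frequency_weight[OF True] by (intro add_left_mono mult_left_mono) auto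
      also have "8^k * ?t * ?a\<^sup>2 = 8^k * (?a\<^sup>2 + w \<xi>)" by (simp add: w_def algebra_simps)
      finally show ?thesis using True by (simp add: hl_def)
    next
      case False
      then show ?thesis using w0[of \<xi>] by (auto simp: hl_def intro!: mult_nonneg_nonneg add_nonneg_nonneg)
    qed
    have i1: "integrable lborel (\<lambda>\<xi>. 8^k * ((norm (h \<xi>))\<^sup>2 + w \<xi>))"
      by (intro integrable_mult_right Bochner_Integration.integrable_add L2_integrable hL wi)
    have i2: "integrable lborel (\<lambda>\<xi>. (1/8)^k * (?B (4^k) \<xi> + (1/16)^k * ?B (8^k) \<xi>))"
      by (intro integrable_mult_right Bochner_Integration.integrable_add integrable_indicator_cball)
    have "(LINT \<xi>|lborel. norm (hl k \<xi>)) \<le> (LINT \<xi>|lborel. ?g \<xi>)"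
      by (rule integral_mono[OF integrable_norm[OF hli] integrable_divide[OF Bochner_Integration.integrable_add[OF i1 i2]] le])
    also have "\<dots> = ((LINT \<xi>|lborel. 8^k * ((norm (h \<xi>))\<^sup>2 + w \<xi>)) + (LINT \<xi>|lborel. (1/8)^k * (?B (4^k) \<xi> + (1/16)^k * ?B (8^k) \<xi>))) / 2"
      by (simp only: integral_divide_zero Bochner_Integration.integral_add[OF i1 i2])
    also have "(LINT \<xi>|lborel. 8^k * ((norm (h \<xi>))\<^sup>2 + w \<xi>)) = 8^k * N"
      using L2_integrable[OF hL] wi by (simp add: N_def mass_def)
    also have "(LINT \<xi>|lborel. (1/8)^k * (?B (4^k) \<xi> + (1/16)^k * ?B (8^k) \<xi>)) = (1/8)^k * ((4^k)^3 * V + (1/16)^k * ((8^k)^3 * V))"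
      using measure_cball_scale[of "4^k"] measure_cball_scale[of "8^k"] by (simp add: V_def)
    also have "\<dots> \<le> (1/8)^k * (64^k * V + 64^k * V)"
    proof -
      have "((a::real)^k)^3 = (a^3)^k" for a by (simp only: power_mult[symmetric] mult.commute)
      from this[of 4] this[of 8] have 1: "((4::real)^k)^3 = 64^k" and "((8::real)^k)^3 = 512^k" by simp_all
      then have "(1/16::real)^k * (8^k)^3 = 32^k" by (simp flip: power_mult_distrib)
      also have "\<dots> \<le> (64::real)^k" by (intro power_mono) auto
      finally have "(1/16::real)^k * (8^k)^3 * V \<le> 64^k * V" using \<open>V \<ge> 0\<close> by (intro mult_right_mono) auto
      then show ?thesis unfolding 1 by (intro mult_left_mono add_left_mono) (auto simp: mult.assoc)
    qed
    also have "(1/8)^k * (64^k * V + 64^k * V) = 8^k * (2 * V)"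
    proof -
      have "(1/8::real)^k * 64^k = 8^k" by (simp flip: power_mult_distrib)
      moreover have "a * (b * V + b * V) = a * b * (2 * V)" for a b by simp
      ultimately show ?thesis by (simp only:)
    qed
    also have "(8^k * N + 8^k * (2 * V)) / 2 = 8^k * (N / 2 + V)" by (simp add: algebra_simps)
    also have "\<dots> \<le> C * 8^k" by (simp add: C_def)
    finally show ?thesis by simp
  qed
  have ul_le: "norm (ul k x) \<le> C * 8^k" for k x
  proof -
    have "1 \<le> (2 * pi)^3" using pi_gt3 by (intro one_le_power) simp
    then have "norm (fourier (hl k) (- x)) / (2 * pi)^3 \<le> norm (fourier (hl k) (- x))"
      by (simp add: divide_le_eq mult_le_cancel_left1)
    also have "\<dots> \<le> (LINT \<xi>|lborel. norm (hl k \<xi>))" by (rule norm_fourier_le)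
    also have "\<dots> \<le> C * 8^k" by (rule hl_int)
    finally show ?thesis by (simp add: ul_def norm_divide norm_power)
  qed
  \<comment> \<open>Where |u| exceeds T 8^k, the low frequency part is at most half of |u|, so the
    high frequency part is at least the other half.\<close>
  define T where "T = 2 * C"
  have T: "T > 0" using C by (simp add: T_def)
  have p4: "a^4 = a\<^sup>2 * a\<^sup>2" for a :: real by (simp add: power4_eq_xxxx power2_eq_square)
  have pw: "ennreal ((norm (u x))^4) \<le> ennreal (T\<^sup>2 * (norm (u x))\<^sup>2) + (\<Sum>k. ennreal (256 * T\<^sup>2 * 64^k * (norm (uh k x))\<^sup>2))" for x
  proof (cases "norm (u x) \<le> T")
    case True
    then have "(norm (u x))\<^sup>2 * (norm (u x))\<^sup>2 \<le> T\<^sup>2 * (norm (u x))\<^sup>2" by (intro mult_right_mono power_mono) auto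
    then have "(norm (u x))^4 \<le> T\<^sup>2 * (norm (u x))\<^sup>2" unfolding p4 .
    then show ?thesis by (intro add_increasing2 ennreal_leI) auto
  next
    case False
    then obtain k where k: "T * 8^k < norm (u x)" "norm (u x) \<le> T * 8^Suc k"
      using power_8_bracket[OF T, of "norm (u x)"] by auto
    have "norm (u x) \<le> norm (ul k x) + norm (uh k x)"
      using norm_triangle_ineq[of "ul k x" "uh k x"] by (simp add: uh_def)
    then have "norm (u x) \<le> 2 * norm (uh k x)" using ul_le[of k x] k(1) by (simp add: T_def)
    then have "(norm (u x))\<^sup>2 * (norm (u x))\<^sup>2 \<le> (T * 8^Suc k)\<^sup>2 * (2 * norm (uh k x))\<^sup>2"
      using k(2) by (intro mult_mono power_mono) auto
    \<comment> \<open>256 = 64 * 4: one factor 8^2 from \<open>Suc k\<close> and 2^2 from |u| \<le>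
      2 |uh k|.\<close>
    also have "\<dots> = 256 * T\<^sup>2 * 64^k * (norm (uh k x))\<^sup>2"
    proof -
      have e: "(64::real)^k = 8^k * 8^k" by (simp flip: power_mult_distrib)
      show ?thesis unfolding e by (simp only: power_Suc power2_eq_square) simp
    qed
    finally have "(norm (u x))^4 \<le> 256 * T\<^sup>2 * 64^k * (norm (uh k x))\<^sup>2" unfolding p4 .
    then have "ennreal ((norm (u x))^4) \<le> ennreal (256 * T\<^sup>2 * 64^k * (norm (uh k x))\<^sup>2)" by (rule ennreal_leI)
    also have "\<dots> \<le> (\<Sum>k. ennreal (256 * T\<^sup>2 * 64^k * (norm (uh k x))\<^sup>2))"
    proof -
      have "f k \<le> suminf f" for f :: "nat \<Rightarrow> ennreal"
        using sum_le_suminf[OF summableI, of "{k}" f] by simp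
      then show ?thesis .
    qed
    finally show ?thesis by (rule add_increasing[rotated]) simp
  qed
  have "(\<Sum>k<n. 256 * T\<^sup>2 * 64^k * mass (uh k)) \<le> 512 * T\<^sup>2 * N" for n
  proof -
    have uhm: "mass (uh k) \<le> mass (\<lambda>\<xi>. h \<xi> - hl k \<xi>)" for k
    proof -
      have "1 \<le> (2 * pi)^3" using pi_gt3 by (intro one_le_power) simp
      then have "1 * mass (uh k) \<le> (2 * pi)^3 * mass (uh k)" by (intro mult_right_mono) auto
      then show ?thesis using is_fourier_L2_mass[OF uhF[of k]] by simp
    qed
    have hL': "(\<lambda>\<xi>. h \<xi> - hl k \<xi>) \<in> L2" for k by (intro L2_diff hL hlL)
    have "(\<Sum>k<n. 64^k * mass (uh k)) \<le> (\<Sum>k<n. 64^k * mass (\<lambda>\<xi>. h \<xi> - hl k \<xi>))"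
      by (intro sum_mono mult_left_mono uhm) auto
    also have "\<dots> = (LINT \<xi>|lborel. (\<Sum>k<n. 64^k * (norm (h \<xi> - hl k \<xi>))\<^sup>2))"
      unfolding mass_def using L2_integrable[OF hL'] by simp
    also have "\<dots> \<le> (LINT \<xi>|lborel. 2 * w \<xi>)"
    proof (rule integral_mono)
      show "integrable lborel (\<lambda>\<xi>. \<Sum>k<n. 64^k * (norm (h \<xi> - hl k \<xi>))\<^sup>2)"
        using L2_integrable[OF hL'] by simp
      show "integrable lborel (\<lambda>\<xi>. 2 * w \<xi>)" using wi by simp
      fix \<xi> :: "real^3"
      have "(\<Sum>k<n. 64^k * (norm (h \<xi> - hl k \<xi>))\<^sup>2) = (\<Sum>k<n. 64^k * (if 8^k < norm \<xi> then 1 else 0)) * (norm (h \<xi>))\<^sup>2"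
        unfolding sum_distrib_right by (intro sum.cong) (auto simp: hl_def indicator_def)
      also have "\<dots> \<le> 2 * (norm \<xi>)\<^sup>2 * (norm (h \<xi>))\<^sup>2"
        by (intro mult_right_mono sum_powers_64_le) auto
      finally show "(\<Sum>k<n. 64^k * (norm (h \<xi> - hl k \<xi>))\<^sup>2) \<le> 2 * w \<xi>" by (simp add: w_def)
    qed
    also have "\<dots> \<le> 2 * N" using mass_nonneg[of h] by (simp add: N_def)
    finally have "256 * T\<^sup>2 * (\<Sum>k<n. 64^k * mass (uh k)) \<le> 256 * T\<^sup>2 * (2 * N)"
      by (intro mult_left_mono) auto
    then show ?thesis by (simp add: sum_distrib_left mult.assoc)
  qed
  then have sb: "(\<Sum>k<n. ennreal (256 * T\<^sup>2 * 64^k * mass (uh k))) \<le> ennreal (512 * T\<^sup>2 * N)" for n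
    by (subst sum_ennreal) (auto intro: ennreal_leI)
  have "(\<integral>\<^sup>+x. ennreal ((norm (u x))^4) \<partial>lborel) \<le> (\<integral>\<^sup>+x. ennreal (T\<^sup>2 * (norm (u x))\<^sup>2) + (\<Sum>k. ennreal (256 * T\<^sup>2 * 64^k * (norm (uh k x))\<^sup>2)) \<partial>lborel)"
    by (intro nn_integral_mono pw)
  also have "\<dots> = (\<integral>\<^sup>+x. ennreal (T\<^sup>2 * (norm (u x))\<^sup>2) \<partial>lborel) + (\<Sum>k. \<integral>\<^sup>+x. ennreal (256 * T\<^sup>2 * 64^k * (norm (uh k x))\<^sup>2) \<partial>lborel)"
    by (subst nn_integral_add) (auto simp: nn_integral_suminf)
  also have "(\<integral>\<^sup>+x. ennreal (T\<^sup>2 * (norm (u x))\<^sup>2) \<partial>lborel) = ennreal (T\<^sup>2 * mass u)"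
    by (simp add: ennreal_mult nn_integral_cmult nn_integral_mass[OF uL])
  also have "(\<lambda>k. \<integral>\<^sup>+x. ennreal (256 * T\<^sup>2 * 64^k * (norm (uh k x))\<^sup>2) \<partial>lborel) = (\<lambda>k. ennreal (256 * T\<^sup>2 * 64^k * mass (uh k)))"
  proof (rule ext)
    fix k
    have "(\<integral>\<^sup>+x. ennreal (b * (norm (f x))\<^sup>2) \<partial>lborel) = ennreal (b * mass f)" if "b \<ge> 0" "f \<in> L2" for b f
      using that(1) L2_measurable[OF that(2)]
      by (simp add: ennreal_mult nn_integral_cmult nn_integral_mass[OF that(2)])
    then show "(\<integral>\<^sup>+x. ennreal (256 * T\<^sup>2 * 64^k * (norm (uh k x))\<^sup>2) \<partial>lborel) = ennreal (256 * T\<^sup>2 * 64^k * mass (uh k))"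
      by this (use is_fourier_L2D(1)[OF uhF[of k]] in simp_all)
  qed
  also have "ennreal (T\<^sup>2 * mass u) + (\<Sum>k. ennreal (256 * T\<^sup>2 * 64^k * mass (uh k))) \<le> ennreal (T\<^sup>2 * mass u) + ennreal (512 * T\<^sup>2 * N)"
    by (intro add_left_mono suminf_le_const sb summableI)
  also have "\<dots> < \<infinity>" by simp
  finally show ?thesis by (intro integrableI_bounded) (auto simp: power_abs)
qed

subsection \<open>The energy functionals\<close>

text \<open>The symmetric bilinear form with B(u) as its value at the pair |u|^2, |u|^2. Bilinearity
  makes B(v + t \<psi>) a polynomial in t for real v and \<psi>.\<close>

definition quartic_form :: "real \<Rightarrow> real \<Rightarrow> (real^3 \<Rightarrow> complex) \<Rightarrow> (real^3 \<Rightarrow> complex) \<Rightarrow> real" where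
  "quartic_form lam1 lam2 f g = lam1 * Re (l2_inner f g) + lam2 * dipolar_form f g"

lemma quartic_form_commute:
  assumes "f \<in> L2" "g \<in> L2"
  shows "quartic_form lam1 lam2 f g = quartic_form lam1 lam2 g f"
proof -
  have "Re (l2_inner f g) = Re (l2_inner g f)"
    unfolding l2_inner_cnj[of g f, symmetric] by simp
  then show ?thesis
    by (simp add: quartic_form_def dipolar_form_commute[OF assms])
qed

lemma quartic_form_add_left:
  assumes "f \<in> L2" "g \<in> L2" "w \<in> L2"
  shows "quartic_form lam1 lam2 (\<lambda>x. f x + g x) w = quartic_form lam1 lam2 f w + quartic_form lam1 lam2 g w"
  by (simp add: quartic_form_def l2_inner_add_left[OF assms] dipolar_form_add_left[OF assms] algebra_simps)

lemma quartic_form_cmult_left: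
  assumes "f \<in> L2" "g \<in> L2"
  shows "quartic_form lam1 lam2 (\<lambda>x. of_real t * f x) g = t * quartic_form lam1 lam2 f g"
  by (simp add: quartic_form_def l2_inner_cmult_left dipolar_form_cmult_left[OF assms] algebra_simps)

lemma quartic_form_add_square:
  assumes "f \<in> L2" "g \<in> L2"
  shows "quartic_form lam1 lam2 (\<lambda>x. f x + of_real t * g x) (\<lambda>x. f x + of_real t * g x) =
    quartic_form lam1 lam2 f f + 2 * t * quartic_form lam1 lam2 f g + t\<^sup>2 * quartic_form lam1 lam2 g g"
proof -
  let ?q = "quartic_form lam1 lam2"
  have tg: "(\<lambda>x. of_real t * g x) \<in> L2" by (rule L2_cmult[OF assms(2)])
  have s: "(\<lambda>x. f x + of_real t * g x) \<in> L2" by (rule L2_add[OF assms(1) tg])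
  have left: "?q (\<lambda>x. f x + of_real t * g x) w = ?q f w + t * ?q g w" if "w \<in> L2" for w
    by (simp add: quartic_form_add_left[OF assms(1) tg that] quartic_form_cmult_left[OF assms(2) that])
  have "?q (\<lambda>x. f x + of_real t * g x) (\<lambda>x. f x + of_real t * g x)
     = ?q (\<lambda>x. f x + of_real t * g x) f + t * ?q (\<lambda>x. f x + of_real t * g x) g"
    unfolding left[OF s] quartic_form_commute[OF assms(1) s] quartic_form_commute[OF assms(2) s] ..
  then show ?thesis
    unfolding left[OF assms(1)] left[OF assms(2)] quartic_form_commute[OF assms(2,1)]
    by (simp add: power2_eq_square algebra_simps)
qed

lemma quartic_form_bound:
  assumes "f \<in> L2" "g \<in> L2"
  shows "\<bar>quartic_form lam1 lam2 f g\<bar> \<le> (\<bar>lam1\<bar> + 8 / 3 * pi * \<bar>lam2\<bar>) * (sqrt (mass f) * sqrt (mass g))"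
proof -
  have "\<bar>Re (l2_inner f g)\<bar> \<le> sqrt (mass f) * sqrt (mass g)"
    using abs_Re_le_cmod l2_inner_Cauchy_Schwarz[OF assms] by (rule order_trans)
  then have "\<bar>lam1\<bar> * \<bar>Re (l2_inner f g)\<bar> \<le> \<bar>lam1\<bar> * (sqrt (mass f) * sqrt (mass g))"
    by (rule mult_left_mono) simp
  moreover have "\<bar>lam2\<bar> * \<bar>dipolar_form f g\<bar> \<le> \<bar>lam2\<bar> * (8 / 3 * pi * (sqrt (mass f) * sqrt (mass g)))"
    by (rule mult_left_mono[OF dipolar_form_bound[OF assms]]) simp
  moreover have "\<bar>quartic_form lam1 lam2 f g\<bar> \<le> \<bar>lam1\<bar> * \<bar>Re (l2_inner f g)\<bar> + \<bar>lam2\<bar> * \<bar>dipolar_form f g\<bar>"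
    unfolding quartic_form_def abs_mult[symmetric] by (rule abs_triangle_ineq)
  ultimately show ?thesis by (simp add: algebra_simps)
qed

lemma quartic_form_dilate:
  assumes "f \<in> L2" "t > 0"
  shows "quartic_form lam1 lam2 (\<lambda>x. f (t *\<^sub>R x)) (\<lambda>x. f (t *\<^sub>R x)) = quartic_form lam1 lam2 f f / t^3"
  using assms mass_dilate[of t f]
  by (simp add: quartic_form_def l2_inner_self dipolar_form_dilate[OF assms] add_divide_distrib)

definition modulus_square :: "(real^3 \<Rightarrow> complex) \<Rightarrow> real^3 \<Rightarrow> complex" where
  "modulus_square u x = of_real ((norm (u x))\<^sup>2)"

lemma modulus_square_L2: "u \<in> H1 \<Longrightarrow> modulus_square u \<in> L2"
proof (rule L2I)
  assume u: "u \<in> H1"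
  then have [measurable]: "u \<in> borel_measurable borel" by (intro L2_measurable H1_L2)
  show "modulus_square u \<in> borel_measurable borel" unfolding modulus_square_def[abs_def] by measurable
  have "(norm (modulus_square u x))\<^sup>2 = (norm (u x))^4" for x
    by (simp add: modulus_square_def norm_power)
  then show "integrable lborel (\<lambda>x. (norm (modulus_square u x))\<^sup>2)" using H1_L4[OF u] by simp
qed

lemma GP_B_eq:
  assumes "u \<in> H1"
  shows "GP_B lam1 lam2 u = quartic_form lam1 lam2 (modulus_square u) (modulus_square u)"
proof -
  have L: "modulus_square u \<in> L2" by (rule modulus_square_L2[OF assms])
  obtain h where h: "is_fourier_L2 (modulus_square u) h" using is_fourier_L2_exists[OF L] by blast
  have "is_fourier_L2 (dipolar_conv (modulus_square u)) (\<lambda>\<xi>. of_real (dipolar_symbol \<xi>) * h \<xi>)"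
    unfolding dipolar_conv_def
    by (rule fourier_multiplier_spec[OF dipolar_symbol_measurable dipolar_symbol_bounded h])
  then have K: "dipolar_conv (modulus_square u) \<in> L2" by (rule is_fourier_L2D)
  have "dipolar_form (modulus_square u) (modulus_square u) = (LINT x|lborel. Re (dipolar_conv (modulus_square u) x * cnj (modulus_square u x)))"
    unfolding dipolar_form_def l2_inner_def by (rule integral_Re[OF l2_inner_integrable[OF K L], symmetric])
  also have "\<dots> = (LINT x|lborel. Re (dipolar_conv (modulus_square u) x) * (norm (u x))\<^sup>2)"
    by (simp add: modulus_square_def)
  finally have "dipolar_form (modulus_square u) (modulus_square u) = (LINT x|lborel. Re (dipolar_conv (\<lambda>y. of_real ((norm (u y))\<^sup>2)) x) * (norm (u x))\<^sup>2)"
    by (simp only: modulus_square_def[abs_def])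
  moreover have "Re (l2_inner (modulus_square u) (modulus_square u)) = (LINT x|lborel. (norm (u x))^4)"
    by (simp add: l2_inner_self mass_def modulus_square_def norm_power)
  ultimately show ?thesis by (simp only: GP_B_def quartic_form_def)
qed

subsection \<open>Scaling\<close>

lemma xi_mult_dilate_L2:
  assumes "xi_mult j h \<in> L2" "t > 0"
  shows "xi_mult j (\<lambda>\<xi>. of_real a * (h ((1 / t) *\<^sub>R \<xi>) / \<bar>t\<bar>^3)) \<in> L2"
    and "mass (xi_mult j (\<lambda>\<xi>. of_real a * (h ((1 / t) *\<^sub>R \<xi>) / \<bar>t\<bar>^3))) = a\<^sup>2 / t * mass (xi_mult j h)"
proof -
  have eq: "xi_mult j (\<lambda>\<xi>. of_real a * (h ((1 / t) *\<^sub>R \<xi>) / \<bar>t\<bar>^3)) = (\<lambda>\<xi>. of_real (a / t\<^sup>2) * xi_mult j h ((1 / t) *\<^sub>R \<xi>))"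
    using assms(2) by (auto simp: fun_eq_iff power2_eq_square power3_eq_cube)
  show "xi_mult j (\<lambda>\<xi>. of_real a * (h ((1 / t) *\<^sub>R \<xi>) / \<bar>t\<bar>^3)) \<in> L2"
    unfolding eq by (rule L2_cmult[OF L2_dilate[OF assms(1)]]) (use assms(2) in simp)
  have m: "mass (\<lambda>\<xi>. xi_mult j h ((1 / t) *\<^sub>R \<xi>)) = mass (xi_mult j h) * t^3"
    using mass_dilate[of "1 / t" "xi_mult j h"] assms(2) by (simp add: power_one_over)
  have "mass (\<lambda>\<xi>. of_real (a / t\<^sup>2) * xi_mult j h ((1 / t) *\<^sub>R \<xi>)) = (a / t\<^sup>2)\<^sup>2 * (mass (xi_mult j h) * t^3)"
    by (simp only: mass_cmult[of "of_real (a / t\<^sup>2)" "\<lambda>\<xi>. xi_mult j h ((1 / t) *\<^sub>R \<xi>)"] norm_of_real power2_abs m)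
  also have "\<dots> = a\<^sup>2 / t * mass (xi_mult j h)"
    using assms(2) by (simp add: power2_eq_square power3_eq_cube field_simps)
  finally show "mass (xi_mult j (\<lambda>\<xi>. of_real a * (h ((1 / t) *\<^sub>R \<xi>) / \<bar>t\<bar>^3))) = a\<^sup>2 / t * mass (xi_mult j h)"
    unfolding eq .
qed

lemma scaling:
  fixes a t :: real
  assumes w: "w \<in> H1" and t: "t > 0"
  defines "w' \<equiv> \<lambda>x. of_real a * w (t *\<^sub>R x)"
  shows "w' \<in> H1" "mass w' = a\<^sup>2 / t^3 * mass w" "GP_A w' = a\<^sup>2 / t * GP_A w"
    "GP_B lam1 lam2 w' = a^4 / t^3 * GP_B lam1 lam2 w"
proof -
  obtain h where h: "is_fourier_L2 w h" using is_fourier_L2_exists[OF H1_L2[OF w]] by blast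
  have t0: "t \<noteq> 0" using t by simp
  have F: "is_fourier_L2 w' (\<lambda>\<xi>. of_real a * (h ((1 / t) *\<^sub>R \<xi>) / \<bar>t\<bar>^3))"
    unfolding w'_def by (rule is_fourier_L2_cmult[OF is_fourier_L2_dilate[OF h t0]])
  show w': "w' \<in> H1"
    by (rule H1_fourierI[OF F]) (rule xi_mult_dilate_L2(1)[OF H1_weak_pdiff(1)[OF w h] t])
  show "mass w' = a\<^sup>2 / t^3 * mass w"
    unfolding w'_def mass_cmult mass_dilate[OF t0, of w] using t by simp
  have "mass (weak_pdiff j w') = a\<^sup>2 / t * mass (weak_pdiff j w)" for j
    unfolding mass_weak_pdiff[OF w' F] mass_weak_pdiff[OF w h] xi_mult_dilate_L2(2)[OF H1_weak_pdiff(1)[OF w h] t] by simp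
  then show "GP_A w' = a\<^sup>2 / t * GP_A w"
    by (simp add: GP_A_eq w w' sum_distrib_left)
  have d: "modulus_square w' = (\<lambda>x. of_real (a\<^sup>2) * modulus_square w (t *\<^sub>R x))"
    by (auto simp: modulus_square_def w'_def norm_mult power_mult_distrib fun_eq_iff)
  have L: "(\<lambda>x. modulus_square w (t *\<^sub>R x)) \<in> L2" by (rule L2_dilate[OF modulus_square_L2[OF w] t0])
  have "quartic_form lam1 lam2 (modulus_square w') (modulus_square w') = a\<^sup>2 * (a\<^sup>2 * (quartic_form lam1 lam2 (modulus_square w) (modulus_square w) / t^3))"
    unfolding d quartic_form_cmult_left[OF L L2_cmult[OF L]] quartic_form_commute[OF L L2_cmult[OF L]]
      quartic_form_cmult_left[OF L L] quartic_form_dilate[OF modulus_square_L2[OF w] t] ..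
  then show "GP_B lam1 lam2 w' = a^4 / t^3 * GP_B lam1 lam2 w"
    unfolding GP_B_eq[OF w] GP_B_eq[OF w'] by (simp add: power2_eq_square power4_eq_xxxx)
qed

lemma GP_V_energy:
  assumes "v \<in> GP_V lam1 lam2 c"
  shows "v \<in> H1" "mass v = c" "GP_B lam1 lam2 v = - 2 / 3 * GP_A v" "GP_E lam1 lam2 v = GP_A v / 6"
  using assms by (auto simp: GP_V_def GP_S_def GP_Q_def GP_E_def)

lemma minimizer_energy_le:
  assumes "u \<in> minimizers lam1 lam2 c" "v \<in> GP_V lam1 lam2 c"
  shows "GP_A u \<le> GP_A v"
proof -
  have "GP_E lam1 lam2 u = (INF v\<in>GP_V lam1 lam2 c. GP_E lam1 lam2 v)"
    using assms(1) by (simp add: minimizers_def)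
  also have "\<dots> \<le> GP_E lam1 lam2 v"
  proof (rule cINF_lower[OF _ assms(2)])
    \<comment> \<open>An infimum of reals without a lower bound would be a default value; on the
      constraint set E = A / 6 is nonnegative.\<close>
    show "bdd_below (GP_E lam1 lam2 ` GP_V lam1 lam2 c)"
      by (rule bdd_belowI[of _ 0]) (auto simp: GP_V_energy GP_A_nonneg)
  qed
  finally have "GP_E lam1 lam2 u \<le> GP_E lam1 lam2 v" .
  moreover have "u \<in> GP_V lam1 lam2 c" using assms(1) by (simp add: minimizers_def)
  ultimately show ?thesis
    by (simp only: GP_V_energy(4)[OF assms(2)] GP_V_energy(4))
qed

text \<open>
  Every function with negative interaction energy can be scaled into the constraint set, so that a
  minimizer of the constrained problem minimizes \<open>A\<^sup>3 M / B\<^sup>2\<close> without constraints.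
\<close>

lemma minimizer_scaling:
  assumes u: "u \<in> minimizers lam1 lam2 c" and c: "c > 0"
    and w: "w \<in> H1" "mass w > 0" "GP_B lam1 lam2 w < 0"
  shows "9 * c * GP_A u * (GP_B lam1 lam2 w)\<^sup>2 \<le> 4 * (GP_A w)^3 * mass w"
proof -
  define A B M where "A = GP_A w" and "B = GP_B lam1 lam2 w" and "M = mass w"
  have pos: "A > 0" "B < 0" "M > 0" using w GP_A_pos by (auto simp: A_def B_def M_def)
  \<comment> \<open>Given t, the choice of a fixes the mass at c. The condition Q = 0 then reads A +
    3/2 (c t B / M) = 0, which determines t; it is positive because B < 0. Its square brings the
    constants 4 and 9 into the conclusion.\<close>
  define t where "t = - 2 * A * M / (3 * c * B)"
  define a where "a = sqrt (c * t^3 / M)"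
  have "- 2 * A * M < 0" using mult_pos_pos[OF pos(1,3)] by simp
  moreover have "3 * c * B < 0" using c pos(2) by (intro mult_pos_neg) auto
  ultimately have t: "t > 0" unfolding t_def by (rule divide_neg_neg)
  have a2: "a\<^sup>2 = c * t^3 / M" unfolding a_def using t c pos by simp
  let ?w = "\<lambda>x. of_real a * w (t *\<^sub>R x)"
  note s = scaling[OF w(1) t, where a=a]
  have m: "mass ?w = c" unfolding s(2) a2 using t pos by (simp add: M_def)
  have A': "GP_A ?w = c * t\<^sup>2 / M * A"
    unfolding s(3) a2 A_def[symmetric] using t by (simp add: power2_eq_square power3_eq_cube)
  have B': "GP_B lam1 lam2 ?w = (c * t^3 / M) * (c / M) * B"
  proof -
    have "a^4 = (c * t^3 / M)\<^sup>2" unfolding a2[symmetric] by simp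
    then show ?thesis unfolding s(4) B_def[symmetric] using t by (simp add: power2_eq_square)
  qed
  have "GP_Q lam1 lam2 ?w = c * t\<^sup>2 / M * (A + 3 / 2 * (c * t * B / M))"
    unfolding GP_Q_def A' B' by (simp add: power2_eq_square power3_eq_cube algebra_simps)
  also have "c * t * B / M = - 2 / 3 * A"
    unfolding t_def using pos c by (simp add: field_simps)
  finally have Q: "GP_Q lam1 lam2 ?w = 0" by simp
  have "?w \<in> GP_V lam1 lam2 c" unfolding GP_V_def GP_S_def using s(1) m Q by simp
  from minimizer_energy_le[OF u this] have "GP_A u \<le> c * t\<^sup>2 / M * A" unfolding A' .
  then have "9 * c * GP_A u * B\<^sup>2 \<le> 9 * c * (c * t\<^sup>2 / M * A) * B\<^sup>2"
    using c by (intro mult_right_mono mult_left_mono) auto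
  also have "\<dots> = 4 * A^3 * M"
    unfolding t_def using pos c by (simp add: field_simps power2_eq_square power3_eq_cube)
  finally show ?thesis unfolding A_def B_def M_def .
qed

subsection \<open>The modulus of a minimizer\<close>

abbreviation cmodulus :: "(real^3 \<Rightarrow> complex) \<Rightarrow> real^3 \<Rightarrow> complex" where
  "cmodulus u \<equiv> \<lambda>x. complex_of_real (norm (u x))"

definition step :: "nat \<Rightarrow> real" where "step n = 1 / real (Suc n)"

lemma step_pos: "step n > 0" and step_le_1: "step n \<le> 1" and step_nonzero: "step n \<noteq> 0"
  by (simp_all add: step_def)

lemma step_tendsto: "step \<longlonglongrightarrow> 0"
  unfolding step_def[abs_def] using LIMSEQ_inverse_real_of_nat by (simp add: inverse_eq_divide)

lemma cmodulus_L2: "u \<in> L2 \<Longrightarrow> cmodulus u \<in> L2"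
proof -
  assume u: "u \<in> L2"
  have [measurable]: "u \<in> borel_measurable borel" by (rule L2_measurable[OF u])
  show ?thesis by (rule L2_bound[OF u, of _ 1]) auto
qed

lemma shift_diff_cmodulus_le:
  assumes "u \<in> L2"
  shows "mass (shift_diff j s (cmodulus u)) \<le> mass (shift_diff j s u)"
proof -
  have "mass (shift_diff j s (cmodulus u)) \<le> 1\<^sup>2 * mass (shift_diff j s u)"
  proof (rule mass_mono[OF shift_diff_L2[OF assms] L2_measurable[OF shift_diff_L2[OF cmodulus_L2[OF assms]]]])
    fix x
    have "norm (shift_diff j s (cmodulus u) x) = \<bar>norm (u (x + s *\<^sub>R axis j 1)) - norm (u x)\<bar>"
      unfolding shift_diff_def of_real_diff[symmetric] norm_of_real ..
    also have "\<dots> \<le> norm (shift_diff j s u x)"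
      unfolding shift_diff_def by (rule norm_triangle_ineq3)
    finally show "norm (shift_diff j s (cmodulus u) x) \<le> 1 * norm (shift_diff j s u x)" by simp
  qed
  then show ?thesis by simp
qed

lemma mass_weak_pdiff_le_GP_A: "u \<in> H1 \<Longrightarrow> mass (weak_pdiff j u) \<le> GP_A u"
  unfolding GP_A_eq by (rule member_le_sum) auto

lemma cmodulus_H1:
  assumes "u \<in> H1"
  shows "cmodulus u \<in> H1" "mass (weak_pdiff j (cmodulus u)) \<le> mass (weak_pdiff j u)" "GP_A (cmodulus u) \<le> GP_A u"
proof -
  note L = H1_L2[OF assms]
  show v: "cmodulus u \<in> H1"
  proof (rule H1_difference_quotientI[OF cmodulus_L2[OF L] step_tendsto step_nonzero])
    fix j n
    have "mass (shift_diff j (step n) (cmodulus u)) \<le> (step n)\<^sup>2 * mass (weak_pdiff j u)"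
      using shift_diff_cmodulus_le[OF L] shift_diff_mass_le[OF assms] by (rule order_trans)
    also have "\<dots> \<le> (step n)\<^sup>2 * GP_A u"
      by (intro mult_left_mono mass_weak_pdiff_le_GP_A assms) simp
    finally show "mass (shift_diff j (step n) (cmodulus u)) \<le> GP_A u * (step n)\<^sup>2" by (simp only: mult.commute)
  qed
  have le: "mass (weak_pdiff j (cmodulus u)) \<le> mass (weak_pdiff j u)" for j
    by (rule LIMSEQ_le[OF difference_quotient_mass_tendsto[OF v step_tendsto step_nonzero, of j]
          difference_quotient_mass_tendsto[OF assms step_tendsto step_nonzero, of j]])
      (intro exI allI impI divide_right_mono shift_diff_cmodulus_le[OF L] zero_le_power2)
  show "mass (weak_pdiff j (cmodulus u)) \<le> mass (weak_pdiff j u)" by (rule le)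
  show "GP_A (cmodulus u) \<le> GP_A u"
    unfolding GP_A_eq[OF v] GP_A_eq[OF assms] by (rule sum_mono) (rule le)
qed

lemma minimizer_facts:
  assumes "u \<in> minimizers lam1 lam2 c" "c > 0"
  shows "u \<in> H1" "mass u = c" "GP_B lam1 lam2 u = - 2 / 3 * GP_A u" "GP_A u > 0"
proof -
  have "u \<in> GP_V lam1 lam2 c" using assms(1) by (simp add: minimizers_def)
  note V = GP_V_energy[OF this]
  show "u \<in> H1" "mass u = c" "GP_B lam1 lam2 u = - 2 / 3 * GP_A u" by (fact V)+
  show "GP_A u > 0" using GP_A_pos[OF V(1)] V(2) assms(2) by simp
qed

theorem cmodulus_minimizer:
  assumes u: "u \<in> minimizers lam1 lam2 c" and c: "c > 0"
  shows "GP_A (cmodulus u) = GP_A u" "cmodulus u \<in> minimizers lam1 lam2 c"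
proof -
  note U = minimizer_facts[OF u c]
  note V = cmodulus_H1[OF U(1)]
  have m: "mass (cmodulus u) = c" using U(2) by (simp add: mass_def)
  have B: "GP_B lam1 lam2 (cmodulus u) = GP_B lam1 lam2 u" by (simp add: GP_B_def)
  \<comment> \<open>9 times the square of 2/3 is 4, so the two sides reduce to the cubes of A(u) and
    A(|u|).\<close>
  have "9 * c * GP_A u * (- 2 / 3 * GP_A u)\<^sup>2 \<le> 4 * (GP_A (cmodulus u))^3 * c"
    using minimizer_scaling[OF u c V(1)] unfolding m B U(3) using c U(4) by simp
  then have "4 * c * (GP_A u)^3 \<le> 4 * c * (GP_A (cmodulus u))^3"
    by (simp add: power2_eq_square power3_eq_cube algebra_simps)
  then have "(GP_A u)^3 \<le> (GP_A (cmodulus u))^3" using c by simp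
  then have "GP_A u \<le> GP_A (cmodulus u)"
    using power_le_imp_le_base[of "GP_A u" 2 "GP_A (cmodulus u)"] GP_A_nonneg[OF V(1)]
    by (simp add: numeral_3_eq_3 numeral_2_eq_2)
  with V(3) show A: "GP_A (cmodulus u) = GP_A u" by simp
  show "cmodulus u \<in> minimizers lam1 lam2 c"
    using u V(1) m by (simp add: minimizers_def GP_V_def GP_S_def GP_Q_def GP_E_def A B)
qed

subsection \<open>First variation\<close>

lemma H1_add_cmult:
  assumes "f \<in> H1" "g \<in> H1"
  shows "(\<lambda>x. f x + c * g x) \<in> H1"
proof -
  obtain h where h: "is_fourier_L2 f h" using is_fourier_L2_exists[OF H1_L2[OF assms(1)]] by blast
  obtain k where k: "is_fourier_L2 g k" using is_fourier_L2_exists[OF H1_L2[OF assms(2)]] by blast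
  have F: "is_fourier_L2 (\<lambda>x. f x + c * g x) (\<lambda>\<xi>. h \<xi> + c * k \<xi>)"
    by (rule is_fourier_L2_add[OF h is_fourier_L2_cmult[OF k]])
  show ?thesis
  proof (rule H1_fourierI[OF F])
    fix j
    have "(\<lambda>\<xi>. xi_mult j h \<xi> + c * xi_mult j k \<xi>) \<in> L2"
      by (intro L2_add L2_cmult H1_weak_pdiff(1)[OF assms(1) h] H1_weak_pdiff(1)[OF assms(2) k])
    then show "xi_mult j (\<lambda>\<xi>. h \<xi> + c * k \<xi>) \<in> L2" by (simp add: algebra_simps)
  qed
qed

lemma difference_quotient_inner_tendsto:
  assumes f: "f \<in> H1" and g: "g \<in> H1" and s: "s \<longlonglongrightarrow> 0" "\<And>n. s n \<noteq> 0"
  shows "(\<lambda>n. Re (l2_inner (shift_diff j (s n) f) (shift_diff j (s n) g)) / (s n)\<^sup>2)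
     \<longlonglongrightarrow> Re (l2_inner (weak_pdiff j f) (weak_pdiff j g))"
proof -
  have q: "(\<lambda>x. shift_diff j (s n) u x / of_real (s n)) \<in> L2" if "u \<in> H1" for u n
    using L2_cmult[OF shift_diff_L2[OF H1_L2[OF that]], of "1 / of_real (s n)" j "s n"] by simp
  have "(\<lambda>n. l2_inner (\<lambda>x. shift_diff j (s n) f x / of_real (s n)) (\<lambda>x. shift_diff j (s n) g x / of_real (s n)))
     \<longlonglongrightarrow> l2_inner (weak_pdiff j f) (weak_pdiff j g)"
    by (rule l2_inner_tendsto[OF q[OF f] q[OF g] weak_pdiff_L2[OF f] weak_pdiff_L2[OF g]
          difference_quotient_tendsto[OF f s] difference_quotient_tendsto[OF g s]])
  moreover have "l2_inner (\<lambda>x. shift_diff j (s n) f x / of_real (s n)) (\<lambda>x. shift_diff j (s n) g x / of_real (s n))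
     = of_real (1 / (s n)\<^sup>2) * l2_inner (shift_diff j (s n) f) (shift_diff j (s n) g)" for n
    using l2_inner_cmult_left[of "1 / of_real (s n)" "shift_diff j (s n) f" "\<lambda>x. (1 / of_real (s n)) * shift_diff j (s n) g x"]
      l2_inner_cmult_right[of "shift_diff j (s n) f" "1 / of_real (s n)" "shift_diff j (s n) g"]
    by (simp add: power2_eq_square)
  ultimately have "(\<lambda>n. of_real (1 / (s n)\<^sup>2) * l2_inner (shift_diff j (s n) f) (shift_diff j (s n) g))
     \<longlonglongrightarrow> l2_inner (weak_pdiff j f) (weak_pdiff j g)" by simp
  from tendsto_Re[OF this] show ?thesis by simp
qed

text \<open>The chosen weak derivatives are linear only up to null sets; the expansion is done for
  differences, which are linear pointwise, and passed to the limit.\<close>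

lemma GP_A_add_square:
  assumes f: "f \<in> H1" and g: "g \<in> H1"
  shows "GP_A (\<lambda>x. f x + of_real t * g x) =
    GP_A f + 2 * t * (\<Sum>j\<in>UNIV. Re (l2_inner (weak_pdiff j f) (weak_pdiff j g))) + t\<^sup>2 * GP_A g"
proof -
  have fg: "(\<lambda>x. f x + of_real t * g x) \<in> H1" by (rule H1_add_cmult[OF f g])
  have "mass (weak_pdiff j (\<lambda>x. f x + of_real t * g x)) =
      mass (weak_pdiff j f) + 2 * t * Re (l2_inner (weak_pdiff j f) (weak_pdiff j g)) + t\<^sup>2 * mass (weak_pdiff j g)" for j
  proof (rule LIMSEQ_unique)
    show "(\<lambda>n. mass (shift_diff j (step n) (\<lambda>x. f x + of_real t * g x)) / (step n)\<^sup>2)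
        \<longlonglongrightarrow> mass (weak_pdiff j (\<lambda>x. f x + of_real t * g x))"
      by (rule difference_quotient_mass_tendsto[OF fg step_tendsto step_nonzero])
    have "mass (shift_diff j (step n) (\<lambda>x. f x + of_real t * g x)) = mass (shift_diff j (step n) f)
       + 2 * t * Re (l2_inner (shift_diff j (step n) f) (shift_diff j (step n) g)) + t\<^sup>2 * mass (shift_diff j (step n) g)" for n
    proof -
      have L: "shift_diff j (step n) f \<in> L2" "shift_diff j (step n) g \<in> L2"
        using shift_diff_L2 H1_L2 f g by auto
      have "shift_diff j (step n) (\<lambda>x. f x + of_real t * g x) = (\<lambda>x. shift_diff j (step n) f x + of_real t * shift_diff j (step n) g x)"
        by (simp add: shift_diff_def fun_eq_iff algebra_simps)
      then show ?thesis
        using mass_add[OF L(1) L2_cmult[OF L(2), of "of_real t"]]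
        by (simp add: l2_inner_cmult_right mass_cmult)
    qed
    then have eq: "mass (shift_diff j (step n) (\<lambda>x. f x + of_real t * g x)) / (step n)\<^sup>2 = mass (shift_diff j (step n) f) / (step n)\<^sup>2
       + 2 * t * (Re (l2_inner (shift_diff j (step n) f) (shift_diff j (step n) g)) / (step n)\<^sup>2) + t\<^sup>2 * (mass (shift_diff j (step n) g) / (step n)\<^sup>2)" for n
      by (simp add: add_divide_distrib)
    show "(\<lambda>n. mass (shift_diff j (step n) (\<lambda>x. f x + of_real t * g x)) / (step n)\<^sup>2) \<longlonglongrightarrow>
      mass (weak_pdiff j f) + 2 * t * Re (l2_inner (weak_pdiff j f) (weak_pdiff j g)) + t\<^sup>2 * mass (weak_pdiff j g)"
      unfolding eq
      by (intro tendsto_intros difference_quotient_mass_tendsto difference_quotient_inner_tendsto f g step_tendsto step_nonzero)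
  qed
  then show ?thesis
    by (simp add: GP_A_eq f g fg sum.distrib sum_distrib_left)
qed

text \<open>The scaling inequality holds for v + t \<psi> with small t > 0 and is an equality at t =
  0, so the right derivative of the difference of its sides is nonnegative. The coefficient A / (3
  c) comes from differentiating the mass, and 2 v \<psi> is the linear part of (v + t
  \<psi>)^2.\<close>

lemma minimizer_first_variation:
  fixes v \<psi> :: "real^3 \<Rightarrow> real"
  defines "vc \<equiv> \<lambda>x. complex_of_real (v x)" and "pc \<equiv> \<lambda>x. complex_of_real (\<psi> x)"
  assumes min: "vc \<in> minimizers lam1 lam2 c" and c: "c > 0" and p: "pc \<in> H1"
  shows "(\<lambda>x. complex_of_real (2 * (v x * \<psi> x))) \<in> L2"
    and "0 \<le> (\<Sum>j\<in>UNIV. Re (l2_inner (weak_pdiff j vc) (weak_pdiff j pc))) + GP_A vc / (3 * c) * Re (l2_inner vc pc)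
       + quartic_form lam1 lam2 (modulus_square vc) (\<lambda>x. complex_of_real (2 * (v x * \<psi> x)))"
proof -
  note V = minimizer_facts[OF min c]
  define A0 where "A0 = GP_A vc"
  define a where "a = (\<Sum>j\<in>UNIV. Re (l2_inner (weak_pdiff j vc) (weak_pdiff j pc)))"
  define m1 where "m1 = Re (l2_inner vc pc)"
  define f1 where "f1 = (\<lambda>x. complex_of_real (2 * (v x * \<psi> x)))"
  have vL: "vc \<in> L2" and pL: "pc \<in> L2" using V(1) p by (auto intro: H1_L2)
  have dL: "modulus_square vc \<in> L2" "modulus_square pc \<in> L2" using V(1) p by (auto intro: modulus_square_L2)
  show f1L: "(\<lambda>x. complex_of_real (2 * (v x * \<psi> x))) \<in> L2"
  proof (rule L2_bound[OF L2_add[OF dL], of _ 1])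
    have "(\<lambda>x. 2 * (vc x * pc x)) \<in> borel_measurable borel"
      using vL[THEN L2_measurable] pL[THEN L2_measurable] by measurable
    then show "(\<lambda>x. complex_of_real (2 * (v x * \<psi> x))) \<in> borel_measurable borel"
      by (simp add: vc_def pc_def)
    fix x
    have "modulus_square vc x + modulus_square pc x = complex_of_real ((v x)\<^sup>2 + (\<psi> x)\<^sup>2)"
      by (simp add: modulus_square_def vc_def pc_def)
    moreover have "\<bar>2 * (v x * \<psi> x)\<bar> \<le> (v x)\<^sup>2 + (\<psi> x)\<^sup>2"
      using sum_squares_bound[of "v x" "\<psi> x"] sum_squares_bound[of "- v x" "\<psi> x"] by (simp add: abs_le_iff)
    ultimately show "norm (complex_of_real (2 * (v x * \<psi> x))) \<le> 1 * norm (modulus_square vc x + modulus_square pc x)"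
      by (simp only: norm_of_real mult_1)
  qed
  define b0 where "b0 = GP_B lam1 lam2 vc"
  define q01 q02 q11 q12 q22 where
    "q01 = quartic_form lam1 lam2 (modulus_square vc) f1" and "q02 = quartic_form lam1 lam2 (modulus_square vc) (modulus_square pc)" and
    "q11 = quartic_form lam1 lam2 f1 f1" and "q12 = quartic_form lam1 lam2 f1 (modulus_square pc)" and
    "q22 = quartic_form lam1 lam2 (modulus_square pc) (modulus_square pc)"
  note f1L' = f1L[folded f1_def]
  let ?w = "\<lambda>t x. vc x + of_real t * pc x"
  have wH: "?w t \<in> H1" for t by (rule H1_add_cmult[OF V(1) p])
  have At: "GP_A (?w t) = A0 + 2 * t * a + t\<^sup>2 * GP_A pc" for t
    unfolding A0_def a_def by (rule GP_A_add_square[OF V(1) p])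
  have Mt: "mass (?w t) = c + 2 * t * m1 + t\<^sup>2 * mass pc" for t
    using mass_add[OF vL L2_cmult[OF pL, of "of_real t"]] V(2)
    by (simp add: l2_inner_cmult_right mass_cmult m1_def)
  \<comment> \<open>The square is grouped as v^2 + t g with g = 2 v \<psi> + t \<psi>^2, so the
    expansion of the bilinear form on a sum is used twice.\<close>
  have Bt: "GP_B lam1 lam2 (?w t) = b0 + 2 * t * (q01 + t * q02) + t\<^sup>2 * (q11 + 2 * t * q12 + t\<^sup>2 * q22)" for t
  proof -
    let ?g = "\<lambda>x. f1 x + of_real t * modulus_square pc x"
    have gL: "?g \<in> L2" by (intro L2_add L2_cmult f1L' dL)
    have "modulus_square (?w t) = (\<lambda>x. modulus_square vc x + of_real t * ?g x)"
    proof
      fix x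
      have "?w t x = complex_of_real (v x + t * \<psi> x)" by (simp add: vc_def pc_def)
      then have "modulus_square (?w t) x = complex_of_real ((v x + t * \<psi> x)\<^sup>2)"
        unfolding modulus_square_def by (simp only: norm_of_real power2_abs)
      also have "(v x + t * \<psi> x)\<^sup>2 = (v x)\<^sup>2 + t * (2 * (v x * \<psi> x) + t * (\<psi> x)\<^sup>2)"
        by (simp add: power2_eq_square algebra_simps)
      finally show "modulus_square (?w t) x = modulus_square vc x + of_real t * ?g x"
        by (simp add: modulus_square_def vc_def pc_def f1_def)
    qed
    then have "GP_B lam1 lam2 (?w t) = quartic_form lam1 lam2 (modulus_square vc) (modulus_square vc) + 2 * t * quartic_form lam1 lam2 (modulus_square vc) ?g
        + t\<^sup>2 * quartic_form lam1 lam2 ?g ?g"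
      unfolding GP_B_eq[OF wH] using quartic_form_add_square[OF dL(1) gL] by simp
    also have "quartic_form lam1 lam2 (modulus_square vc) ?g = q01 + t * q02"
      unfolding quartic_form_commute[OF dL(1) gL] quartic_form_add_left[OF f1L' L2_cmult[OF dL(2)] dL(1)]
        quartic_form_cmult_left[OF dL(2,1)] q01_def q02_def
        quartic_form_commute[OF f1L' dL(1)] quartic_form_commute[OF dL(2,1)] ..
    also have "quartic_form lam1 lam2 ?g ?g = q11 + 2 * t * q12 + t\<^sup>2 * q22"
      unfolding q11_def q12_def q22_def by (rule quartic_form_add_square[OF f1L' dL(2)])
    finally show ?thesis by (simp add: b0_def GP_B_eq[OF V(1)])
  qed
  \<comment> \<open>The difference of the two sides of \<open>minimizer_scaling\<close> at v + t
    \<psi>. It vanishes at 0 because B = -2/3 A there, and its derivative at 0 is 24 c A^2 times the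
    expression to be bounded.\<close>
  define P where "P = (\<lambda>t. 4 * (A0 + 2 * t * a + t\<^sup>2 * GP_A pc)^3 * (c + 2 * t * m1 + t\<^sup>2 * mass pc)
     - 9 * c * A0 * (b0 + 2 * t * (q01 + t * q02) + t\<^sup>2 * (q11 + 2 * t * q12 + t\<^sup>2 * q22))\<^sup>2)"
  have b0: "b0 = - 2 / 3 * A0" unfolding b0_def A0_def by (rule V(3))
  have A0: "A0 > 0" unfolding A0_def by (rule V(4))
  have P0: "P 0 = 0" unfolding P_def b0 by (simp add: power2_eq_square power3_eq_cube)
  have dA: "((\<lambda>t. A0 + 2 * t * a + t\<^sup>2 * GP_A pc) has_real_derivative 2 * a) (at 0)"
    and dM: "((\<lambda>t. c + 2 * t * m1 + t\<^sup>2 * mass pc) has_real_derivative 2 * m1) (at 0)"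
    and dB: "((\<lambda>t. b0 + 2 * t * (q01 + t * q02) + t\<^sup>2 * (q11 + 2 * t * q12 + t\<^sup>2 * q22)) has_real_derivative 2 * q01) (at 0)"
    by (auto intro!: derivative_eq_intros)
  have "(P has_real_derivative 4 * (3 * A0\<^sup>2 * (2 * a)) * c + 4 * A0^3 * (2 * m1) - 9 * c * A0 * (2 * b0 * (2 * q01))) (at 0)"
    unfolding P_def
  proof (rule derivative_eq_intros DERIV_power DERIV_mult DERIV_diff DERIV_cmult dA dM dB refl)+
  qed simp
  moreover have "4 * (3 * A0\<^sup>2 * (2 * a)) * c + 4 * A0^3 * (2 * m1) - 9 * c * A0 * (2 * b0 * (2 * q01))
      = 24 * c * A0\<^sup>2 * (a + A0 / (3 * c) * m1 + q01)"
    unfolding b0 using c by (simp add: field_simps power2_eq_square power3_eq_cube)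
  ultimately have dP: "(P has_real_derivative 24 * c * A0\<^sup>2 * (a + A0 / (3 * c) * m1 + q01)) (at 0)"
    by simp
  \<comment> \<open>B < 0 and positive mass are open conditions, so they persist for small t and the
    scaling inequality remains applicable.\<close>
  have inc: "\<exists>d>0. \<forall>h>0. h < d \<longrightarrow> P 0 \<le> P (0 + h)"
  proof -
    have "((\<lambda>t. b0 + 2 * t * (q01 + t * q02) + t\<^sup>2 * (q11 + 2 * t * q12 + t\<^sup>2 * q22)) \<longlongrightarrow>
        b0 + 2 * 0 * (q01 + 0 * q02) + 0\<^sup>2 * (q11 + 2 * 0 * q12 + 0\<^sup>2 * q22)) (at_right 0)"
      by (intro tendsto_intros)
    then have "\<forall>\<^sub>F t in at_right 0. b0 + 2 * t * (q01 + t * q02) + t\<^sup>2 * (q11 + 2 * t * q12 + t\<^sup>2 * q22) < 0"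
      by (rule order_tendstoD) (use b0 A0 in simp)
    moreover have "((\<lambda>t. c + 2 * t * m1 + t\<^sup>2 * mass pc) \<longlongrightarrow> c + 2 * 0 * m1 + 0\<^sup>2 * mass pc) (at_right 0)"
      by (intro tendsto_intros)
    then have "\<forall>\<^sub>F t in at_right 0. c + 2 * t * m1 + t\<^sup>2 * mass pc > 0"
      by (rule order_tendstoD) (use c in simp)
    ultimately have "\<forall>\<^sub>F t in at_right 0. P 0 \<le> P (0 + t)"
    proof eventually_elim
      case (elim t)
      have "9 * c * A0 * (GP_B lam1 lam2 (?w t))\<^sup>2 \<le> 4 * (GP_A (?w t))^3 * mass (?w t)"
        unfolding A0_def by (rule minimizer_scaling[OF min c wH]) (use elim in \<open>simp_all only: Mt Bt\<close>)
      then show ?case unfolding P0 Mt Bt At by (simp add: P_def)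
    qed
    then show ?thesis unfolding eventually_at_right_field by auto
  qed
  have "0 \<le> 24 * c * A0\<^sup>2 * (a + A0 / (3 * c) * m1 + q01)"
  proof (rule ccontr)
    assume "\<not> ?thesis"
    then have "24 * c * A0\<^sup>2 * (a + A0 / (3 * c) * m1 + q01) < 0" by simp
    from DERIV_neg_dec_right[OF dP this] obtain d1 where d1: "d1 > 0" "\<forall>h>0. h < d1 \<longrightarrow> P (0 + h) < P 0"
      by blast
    obtain d2 where d2: "d2 > 0" "\<forall>h>0. h < d2 \<longrightarrow> P 0 \<le> P (0 + h)" using inc by blast
    let ?h = "min d1 d2 / 2"
    have "?h > 0" "?h < d1" "?h < d2" using d1(1) d2(1) by auto
    then show False using d1(2) d2(2) by (meson not_less)
  qed
  moreover have "24 * c * A0\<^sup>2 > 0" using c A0 by simp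
  ultimately have "0 \<le> a + A0 / (3 * c) * m1 + q01"
    by (metis mult_le_cancel_left_pos mult_zero_right)
  then show "0 \<le> (\<Sum>j\<in>UNIV. Re (l2_inner (weak_pdiff j vc) (weak_pdiff j pc))) + GP_A vc / (3 * c) * Re (l2_inner vc pc)
       + quartic_form lam1 lam2 (modulus_square vc) (\<lambda>x. complex_of_real (2 * (v x * \<psi> x)))"
    unfolding a_def m1_def q01_def f1_def A0_def .
qed

subsection \<open>Cutoff functions\<close>

text \<open>A Lipschitz cutoff, equal to 1 on the ball of radius R and to 0 from radius R + 1 on.
  Smoothness is of no concern, since H^1 is tested by differences.\<close>

definition cutoff :: "real \<Rightarrow> real^3 \<Rightarrow> real" where
  "cutoff R x = max 0 (min 1 (R + 1 - norm x))"

lemma cutoff_bounds: "0 \<le> cutoff R x" "cutoff R x \<le> 1"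
  by (auto simp: cutoff_def)

lemma cutoff_eq_1: "norm x \<le> R \<Longrightarrow> cutoff R x = 1"
  by (simp add: cutoff_def)

lemma cutoff_eq_0: "norm x \<ge> R + 1 \<Longrightarrow> cutoff R x = 0"
  by (simp add: cutoff_def)

lemma cutoff_Lipschitz: "\<bar>cutoff R x - cutoff R y\<bar> \<le> norm (x - y)"
  using norm_triangle_ineq3[of x y] by (auto simp: cutoff_def max_def min_def)

lemma cutoff_measurable [measurable]: "cutoff R \<in> borel_measurable borel"
  unfolding cutoff_def[abs_def] by measurable

lemma cutoff_le_indicator: "cutoff R x \<le> indicator (cball 0 (R + 1)) x"
  using cutoff_bounds[of R x] cutoff_eq_0[of R x] by (auto simp: indicator_def)

lemma mass_indicator: "bounded A \<Longrightarrow> A \<in> sets borel \<Longrightarrow> mass (\<lambda>x. indicator A x) = measure lborel A"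
proof -
  assume "bounded A" "A \<in> sets borel"
  then have "(LINT x|lborel. indicat_real A x) = measure lborel A" by simp
  moreover have "(norm (indicator A x :: complex))\<^sup>2 = indicat_real A x" for x :: "real^3"
    by (simp add: indicator_def)
  ultimately show ?thesis by (simp add: mass_def)
qed

lemma cutoff_L2: "(\<lambda>x. complex_of_real (cutoff R x)) \<in> L2"
proof (rule L2_bound[OF L2_indicator_bounded[of "cball 0 (R + 1)"], of _ 1])
  show "norm (complex_of_real (cutoff R x)) \<le> 1 * norm (indicator (cball 0 (R + 1)) x :: complex)" for x
    using cutoff_le_indicator[of R x] cutoff_bounds[of R x] by (auto simp: indicator_def)
qed auto

text \<open>The Lipschitz constant is 1, and a shift of length at most 1 keeps the difference inside
  radius R + 2.\<close>

lemma shift_diff_cutoff: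
  assumes "\<bar>s\<bar> \<le> 1"
  shows "mass (shift_diff j s (\<lambda>x. complex_of_real (cutoff R x))) \<le> s\<^sup>2 * measure lborel (cball (0::real^3) (R + 2))"
proof -
  have "mass (shift_diff j s (\<lambda>x. complex_of_real (cutoff R x))) \<le> \<bar>s\<bar>\<^sup>2 * mass (\<lambda>x. indicator (cball (0::real^3) (R + 2)) x)"
  proof (rule mass_mono[OF L2_indicator_bounded])
    show "shift_diff j s (\<lambda>x. complex_of_real (cutoff R x)) \<in> borel_measurable borel"
      by (rule L2_measurable[OF shift_diff_L2[OF cutoff_L2]])
    fix x :: "real^3"
    let ?y = "x + s *\<^sub>R axis j 1"
    have n: "norm (shift_diff j s (\<lambda>x. complex_of_real (cutoff R x)) x) = \<bar>cutoff R ?y - cutoff R x\<bar>"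
      unfolding shift_diff_def of_real_diff[symmetric] norm_of_real ..
    show "norm (shift_diff j s (\<lambda>x. complex_of_real (cutoff R x)) x) \<le> \<bar>s\<bar> * norm (indicator (cball (0::real^3) (R + 2)) x :: complex)"
    proof (cases "norm x \<le> R + 2")
      case True
      then show ?thesis using cutoff_Lipschitz[of R ?y x] by (simp add: n)
    next
      case False
      have "norm x \<le> norm ?y + norm (s *\<^sub>R axis j 1 :: real^3)"
        using norm_triangle_ineq4[of ?y "s *\<^sub>R axis j 1"] by simp
      then have "norm ?y \<ge> R + 1" using False assms by simp
      then show ?thesis unfolding n using False by (simp add: cutoff_eq_0)
    qed
  qed auto
  also have "mass (\<lambda>x. indicator (cball (0::real^3) (R + 2)) x) = measure lborel (cball (0::real^3) (R + 2))"
    by (rule mass_indicator) auto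
  finally show ?thesis by simp
qed

subsection \<open>A logarithmic estimate\<close>

text \<open>The defect in the first inequality is the square (p b - q a)^2 / (a b). With a, b values
  of v + \<delta> and p, q values of the cutoff \<phi>, this is the difference form of \<nabla>v
  \<bullet> \<nabla>(\<phi>^2 / v) \<le> |\<nabla>\<phi>|^2. Where \<phi> = 1 the left side is
  exactly minus the difference form of |\<nabla> ln v|^2.\<close>

lemma discrete_Picone:
  fixes a b p q :: real
  assumes "a > 0" "b > 0"
  shows "(a - b) * (p\<^sup>2 / a - q\<^sup>2 / b) \<le> (p - q)\<^sup>2"
    and "p = 1 \<Longrightarrow> q = 1 \<Longrightarrow> (a - b) * (p\<^sup>2 / a - q\<^sup>2 / b) = - ((a - b)\<^sup>2 / (a * b))"
proof -
  have "(p - q)\<^sup>2 - (a - b) * (p\<^sup>2 / a - q\<^sup>2 / b) = (p * b - q * a)\<^sup>2 / (a * b)"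
    using assms by (simp add: field_simps power2_eq_square)
  moreover have "(p * b - q * a)\<^sup>2 / (a * b) \<ge> 0" using assms by simp
  ultimately show "(a - b) * (p\<^sup>2 / a - q\<^sup>2 / b) \<le> (p - q)\<^sup>2" by linarith
  show "(a - b) * (p\<^sup>2 / a - q\<^sup>2 / b) = - ((a - b)\<^sup>2 / (a * b))" if "p = 1" "q = 1"
    using assms that by (simp add: field_simps power2_eq_square)
qed

text \<open>Transfers difference bounds from the cutoff and v to the test function; the constants
  blow up as d tends to 0, which is harmless because they serve only to show membership in
  H^1.\<close>

lemma quotient_difference_le:
  fixes a b p q :: real
  assumes "a \<ge> d" "b \<ge> d" "d > 0" "0 \<le> p" "p \<le> 1" "0 \<le> q" "q \<le> 1"
  shows "\<bar>p\<^sup>2 / a - q\<^sup>2 / b\<bar> \<le> 2 / d * \<bar>p - q\<bar> + 1 / d\<^sup>2 * \<bar>a - b\<bar>"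
proof -
  have ab: "a > 0" "b > 0" using assms by auto
  have "p\<^sup>2 / a - q\<^sup>2 / b = (p + q) / a * (p - q) + q\<^sup>2 / (a * b) * (b - a)"
    using ab by (simp add: field_simps power2_eq_square)
  then have "\<bar>p\<^sup>2 / a - q\<^sup>2 / b\<bar> \<le> \<bar>(p + q) / a\<bar> * \<bar>p - q\<bar> + \<bar>q\<^sup>2 / (a * b)\<bar> * \<bar>b - a\<bar>"
    by (simp only: abs_mult[symmetric] abs_triangle_ineq)
  moreover have "\<bar>(p + q) / a\<bar> * \<bar>p - q\<bar> \<le> 2 / d * \<bar>p - q\<bar>"
    using assms ab by (intro mult_right_mono) (auto intro!: frac_le)
  moreover have "q\<^sup>2 / (a * b) \<le> 1 / (d * d)"
    using assms ab by (intro frac_le mult_mono) (auto simp: power_le_one)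
  then have "\<bar>q\<^sup>2 / (a * b)\<bar> * \<bar>b - a\<bar> \<le> 1 / d\<^sup>2 * \<bar>a - b\<bar>"
    using ab by (simp only: power2_eq_square abs_minus_commute[of b a], intro mult_right_mono) auto
  ultimately show ?thesis by linarith
qed

lemma ball_in_sets_borel [measurable]: "ball (a::'a::metric_space) r \<in> sets borel"
  by simp

text \<open>The difference form of s^2 times the squared j-th derivative of ln (v + d), with both
  ends of the shift confined to the ball.\<close>

definition log_density :: "real \<Rightarrow> 3 \<Rightarrow> real \<Rightarrow> (real^3 \<Rightarrow> real) \<Rightarrow> real \<Rightarrow> real^3 \<Rightarrow> real" where
  "log_density R j s v d x = indicator (ball 0 R) x * indicator (ball 0 R) (x + s *\<^sub>R axis j 1) *
     ((v (x + s *\<^sub>R axis j 1) - v x)\<^sup>2 / ((v (x + s *\<^sub>R axis j 1) + d) * (v x + d)))"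

text \<open>The third claim integrates \<open>discrete_Picone\<close>. Unlike the bounds behind the
  first two, it carries no constant that depends on d.\<close>

lemma test_function_choice:
  fixes v :: "real^3 \<Rightarrow> real" and R :: real
  assumes v: "(\<lambda>x. complex_of_real (v x)) \<in> H1" "\<And>x. v x \<ge> 0" and d: "d > 0"
  defines "\<psi> \<equiv> \<lambda>x. (cutoff R x)\<^sup>2 / (v x + d)"
  shows "(\<lambda>x. complex_of_real (\<psi> x)) \<in> H1"
    and "\<bar>s\<bar> \<le> 1 \<Longrightarrow> integrable lborel (log_density R j s v d)"
    and "\<bar>s\<bar> \<le> 1 \<Longrightarrow> (LINT x|lborel. log_density R j s v d x) \<le> mass (shift_diff j s (\<lambda>x. complex_of_real (cutoff R x)))
      - Re (l2_inner (shift_diff j s (\<lambda>x. complex_of_real (v x))) (shift_diff j s (\<lambda>x. complex_of_real (\<psi> x))))"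
proof -
  let ?vc = "\<lambda>x. complex_of_real (v x)" and ?pc = "\<lambda>x. complex_of_real (\<psi> x)" and ?cc = "\<lambda>x. complex_of_real (cutoff R x)"
  have vL: "?vc \<in> L2" by (rule H1_L2[OF v(1)])
  have "(\<lambda>x. Re (?vc x)) \<in> borel_measurable borel" using L2_measurable[OF vL] by measurable
  then have [measurable]: "v \<in> borel_measurable borel" by simp
  have [measurable]: "\<psi> \<in> borel_measurable borel" unfolding \<psi>_def by measurable
  have vd: "v x + d > 0" "v x + d \<ge> d" for x using v(2)[of x] d by auto
  have pL: "?pc \<in> L2"
  proof (rule L2_bound[OF cutoff_L2[of R], of _ "1 / d"])
    fix x
    have "(cutoff R x)\<^sup>2 \<le> cutoff R x" using cutoff_bounds[of R x] by (simp add: power2_eq_square mult_left_le)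
    then have "(cutoff R x)\<^sup>2 / (v x + d) \<le> cutoff R x / d"
      using vd[of x] d cutoff_bounds(1)[of R x] by (intro frac_le) auto
    then show "norm (?pc x) \<le> 1 / d * norm (?cc x)"
      using vd[of x] cutoff_bounds(1)[of R x] unfolding norm_of_real by (simp add: \<psi>_def abs_mult abs_divide)
  qed measurable
  have sd: "norm (shift_diff j s (\<lambda>x. complex_of_real (f x)) x) = \<bar>f (x + s *\<^sub>R axis j 1) - f x\<bar>" for f s j x
    unfolding shift_diff_def of_real_diff[symmetric] norm_of_real ..
  have le: "mass (shift_diff j s ?pc) \<le> 2 * ((2 / d)\<^sup>2 * mass (shift_diff j s ?cc)) + 2 * ((1 / d\<^sup>2)\<^sup>2 * mass (shift_diff j s ?vc))" for j s
  proof -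
    let ?F = "\<lambda>x. complex_of_real (2 / d * norm (shift_diff j s ?cc x))" and ?G = "\<lambda>x. complex_of_real (1 / d\<^sup>2 * norm (shift_diff j s ?vc x))"
    have cL: "cmodulus (shift_diff j s ?cc) \<in> L2" "cmodulus (shift_diff j s ?vc) \<in> L2"
      by (intro cmodulus_L2 shift_diff_L2 cutoff_L2 vL)+
    have L: "?F \<in> L2" "?G \<in> L2"
      unfolding of_real_mult by (intro L2_cmult cL)+
    have "mass (shift_diff j s ?pc) \<le> 1\<^sup>2 * mass (\<lambda>x. ?F x + ?G x)"
    proof (rule mass_mono[OF L2_add[OF L] L2_measurable[OF shift_diff_L2[OF pL]]])
      fix x
      have "\<bar>\<psi> (x + s *\<^sub>R axis j 1) - \<psi> x\<bar> \<le> 2 / d * norm (shift_diff j s ?cc x) + 1 / d\<^sup>2 * norm (shift_diff j s ?vc x)"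
        unfolding \<psi>_def sd
        using quotient_difference_le[OF vd(2)[of "x + s *\<^sub>R axis j 1"] vd(2)[of x] d
            cutoff_bounds[of R "x + s *\<^sub>R axis j 1"] cutoff_bounds[of R x]] by simp
      moreover have "?F x + ?G x = complex_of_real (2 / d * norm (shift_diff j s ?cc x) + 1 / d\<^sup>2 * norm (shift_diff j s ?vc x))"
        by (rule of_real_add[symmetric])
      ultimately show "norm (shift_diff j s ?pc x) \<le> 1 * norm (?F x + ?G x)"
        unfolding sd[of j s \<psi>] mult_1 by (simp only: norm_of_real)
    qed
    also have "mass (\<lambda>x. ?F x + ?G x) \<le> 2 * mass ?F + 2 * mass ?G" by (rule mass_add_le[OF L])
    also have "mass ?F = (2 / d)\<^sup>2 * mass (shift_diff j s ?cc)"
      unfolding mass_def norm_of_real power2_abs by (simp only: power_mult_distrib integral_mult_right_zero)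
    also have "mass ?G = (1 / d\<^sup>2)\<^sup>2 * mass (shift_diff j s ?vc)"
      unfolding mass_def norm_of_real power2_abs by (simp only: power_mult_distrib integral_mult_right_zero)
    finally show ?thesis by simp
  qed
  show pH: "?pc \<in> H1"
  proof (rule H1_difference_quotientI[OF pL step_tendsto step_nonzero])
    fix j n
    let ?C = "2 * ((2 / d)\<^sup>2 * measure lborel (cball (0::real^3) (R + 2))) + 2 * ((1 / d\<^sup>2)\<^sup>2 * GP_A ?vc)"
    have "mass (shift_diff j (step n) ?cc) \<le> (step n)\<^sup>2 * measure lborel (cball (0::real^3) (R + 2))"
      by (rule shift_diff_cutoff) (use step_pos[of n] step_le_1[of n] in simp)
    then have 1: "(2 / d)\<^sup>2 * mass (shift_diff j (step n) ?cc) \<le> (2 / d)\<^sup>2 * ((step n)\<^sup>2 * measure lborel (cball (0::real^3) (R + 2)))"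
      by (rule mult_left_mono) simp
    have "mass (shift_diff j (step n) ?vc) \<le> (step n)\<^sup>2 * GP_A ?vc"
      by (rule order_trans[OF shift_diff_mass_le[OF v(1)]]) (intro mult_left_mono mass_weak_pdiff_le_GP_A v zero_le_power2)
    then have 2: "(1 / d\<^sup>2)\<^sup>2 * mass (shift_diff j (step n) ?vc) \<le> (1 / d\<^sup>2)\<^sup>2 * ((step n)\<^sup>2 * GP_A ?vc)"
      by (rule mult_left_mono) simp
    have "mass (shift_diff j (step n) ?pc) \<le> 2 * ((2 / d)\<^sup>2 * ((step n)\<^sup>2 * measure lborel (cball (0::real^3) (R + 2))))
       + 2 * ((1 / d\<^sup>2)\<^sup>2 * ((step n)\<^sup>2 * GP_A ?vc))"
      using le[of j "step n"] 1 2 by linarith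
    also have "\<dots> = ?C * (step n)\<^sup>2" by (simp add: algebra_simps)
    finally show "mass (shift_diff j (step n) ?pc) \<le> ?C * (step n)\<^sup>2" .
  qed
  have [measurable]: "log_density R j s v d \<in> borel_measurable borel"
    unfolding log_density_def[abs_def] by measurable
  show li: "integrable lborel (log_density R j s v d)"
  proof (rule Bochner_Integration.integrable_bound)
    show "integrable lborel (\<lambda>x. 1 / d\<^sup>2 * (norm (shift_diff j s ?vc x))\<^sup>2)"
      by (intro integrable_mult_right L2_integrable shift_diff_L2 vL)
    show "AE x in lborel. norm (log_density R j s v d x) \<le> norm (1 / d\<^sup>2 * (norm (shift_diff j s ?vc x))\<^sup>2)"
    proof (intro AE_I2)
      fix x :: "real^3"
      let ?y = "x + s *\<^sub>R axis j 1"
      have "(v ?y - v x)\<^sup>2 / ((v ?y + d) * (v x + d)) \<le> (v ?y - v x)\<^sup>2 / (d * d)"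
        using vd[of x] vd[of ?y] d by (intro divide_left_mono mult_mono mult_pos_pos) auto
      moreover have "0 \<le> (v ?y - v x)\<^sup>2 / ((v ?y + d) * (v x + d))"
        using vd[of x] vd[of ?y] by simp
      ultimately have "norm (log_density R j s v d x) \<le> (v ?y - v x)\<^sup>2 / (d * d)"
        unfolding log_density_def using abs_of_pos[OF mult_pos_pos[OF vd(1)[of ?y] vd(1)[of x]]] by (auto simp: indicator_def)
      then show "norm (log_density R j s v d x) \<le> norm (1 / d\<^sup>2 * (norm (shift_diff j s ?vc x))\<^sup>2)"
        unfolding sd by (simp add: power2_eq_square)
    qed
  qed measurable
  have eq: "Re (l2_inner (shift_diff j s ?vc) (shift_diff j s ?pc)) = (LINT x|lborel. Re (shift_diff j s ?vc x * cnj (shift_diff j s ?pc x)))"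
    unfolding l2_inner_def
    by (rule integral_Re[symmetric]) (intro l2_inner_integrable shift_diff_L2 vL pL)
  have i2: "integrable lborel (\<lambda>x. Re (shift_diff j s ?vc x * cnj (shift_diff j s ?pc x)))"
    by (rule integrable_Re) (intro l2_inner_integrable shift_diff_L2 vL pL)
  have "(LINT x|lborel. log_density R j s v d x) + Re (l2_inner (shift_diff j s ?vc) (shift_diff j s ?pc))
     = (LINT x|lborel. log_density R j s v d x + Re (shift_diff j s ?vc x * cnj (shift_diff j s ?pc x)))"
    unfolding eq by (rule Bochner_Integration.integral_add[OF li i2, symmetric])
  also have "\<dots> \<le> mass (shift_diff j s ?cc)"
    unfolding mass_def
  proof (rule integral_mono[OF Bochner_Integration.integrable_add[OF li i2] L2_integrable[OF shift_diff_L2[OF cutoff_L2]]])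
    fix x :: "real^3"
    let ?y = "x + s *\<^sub>R axis j 1"
    have r: "Re (shift_diff j s ?vc x * cnj (shift_diff j s ?pc x)) = ((v ?y + d) - (v x + d)) * ((cutoff R ?y)\<^sup>2 / (v ?y + d) - (cutoff R x)\<^sup>2 / (v x + d))"
      by (simp add: shift_diff_def \<psi>_def)
    have c: "(norm (shift_diff j s ?cc x))\<^sup>2 = (cutoff R ?y - cutoff R x)\<^sup>2" by (simp add: sd)
    \<comment> \<open>With both ends in the ball the cutoff is 1 and the two terms on the left
      cancel; otherwise the density is 0 and the general Picone inequality applies.\<close>
    show "log_density R j s v d x + Re (shift_diff j s ?vc x * cnj (shift_diff j s ?pc x)) \<le> (norm (shift_diff j s ?cc x))\<^sup>2"
    proof (cases "x \<in> ball 0 R \<and> ?y \<in> ball 0 R")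
      case True
      then have 1: "cutoff R ?y = 1" "cutoff R x = 1" by (auto intro: cutoff_eq_1)
      show ?thesis
        unfolding r c discrete_Picone(2)[OF vd(1) vd(1) 1] log_density_def using True by simp
    next
      case False
      then have "log_density R j s v d x = 0" by (auto simp: log_density_def)
      then show ?thesis unfolding r c using discrete_Picone(1)[OF vd(1)[of ?y] vd(1)[of x], of "cutoff R ?y" "cutoff R x"] by simp
    qed
  qed
  finally show "(LINT x|lborel. log_density R j s v d x) \<le> mass (shift_diff j s ?cc)
      - Re (l2_inner (shift_diff j s ?vc) (shift_diff j s ?pc))" by simp
qed

text \<open>The order of quantifiers matters: K serves all d, j and s, because v \<psi> is at most
  the indicator of a ball whatever d is. How small the step must be may depend on d, since the first
  variation speaks only about limits of difference quotients.\<close>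

lemma log_estimate:
  fixes v :: "real^3 \<Rightarrow> real"
  assumes min: "(\<lambda>x. complex_of_real (v x)) \<in> minimizers lam1 lam2 c" and c: "c > 0" and v0: "\<And>x. v x \<ge> 0"
  shows "\<exists>K\<ge>0. \<forall>d>0. \<forall>j s. s \<noteq> 0 \<longrightarrow>
    (\<forall>\<^sub>F n in sequentially. (LINT x|lborel. log_density R j (s * step n) v d x) \<le> K * (s * step n)\<^sup>2)"
proof -
  let ?vc = "\<lambda>x. complex_of_real (v x)" and ?cc = "\<lambda>x. complex_of_real (cutoff R x)"
  note V = minimizer_facts[OF min c]
  define W where "W = measure lborel (cball (0::real^3) (R + 1))"
  define W' where "W' = measure lborel (cball (0::real^3) (R + 2))"
  \<comment> \<open>K1 bounds the mass and interaction terms of the first variation. The 4 under the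
    root is the square of the factor in 2 v \<psi>.\<close>
  define K1 where "K1 = GP_A ?vc / (3 * c) * W + (\<bar>lam1\<bar> + 8 / 3 * pi * \<bar>lam2\<bar>) * (sqrt (mass (modulus_square ?vc)) * sqrt (4 * W))"
  have "0 \<le> W" "0 \<le> W'" unfolding W_def W'_def by auto
  then have K1: "K1 \<ge> 0" unfolding K1_def using V(4) c by (intro add_nonneg_nonneg mult_nonneg_nonneg) auto
  \<comment> \<open>Three coordinate directions each contribute the cutoff term W'; the + 1 is the
    slack for passing from the limit to small steps.\<close>
  let ?K = "3 * W' + K1 + 1"
  have "\<forall>\<^sub>F n in sequentially. (LINT x|lborel. log_density R j (s * step n) v d x) \<le> ?K * (s * step n)\<^sup>2"
    if d: "d > 0" and s: "s \<noteq> 0" for d s j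
  proof -
    define \<psi> where "\<psi> = (\<lambda>x. (cutoff R x)\<^sup>2 / (v x + d))"
    let ?pc = "\<lambda>x. complex_of_real (\<psi> x)"
    have eq: "(\<lambda>x. complex_of_real ((cutoff R x)\<^sup>2 / (v x + d))) = ?pc" by (simp only: \<psi>_def)
    note T = test_function_choice[OF V(1) v0 d, where R=R, unfolded eq]
    note E = minimizer_first_variation[OF min c T(1)]
    have vd: "v x + d > 0" for x using v0[of x] d by simp
    have vp: "0 \<le> v x * \<psi> x" "v x * \<psi> x \<le> indicator (cball 0 (R + 1)) x" for x
    proof -
      show "0 \<le> v x * \<psi> x" using v0[of x] vd[of x] by (simp add: \<psi>_def)
      have "v x * \<psi> x = (cutoff R x)\<^sup>2 * (v x / (v x + d))" by (simp add: \<psi>_def)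
      also have "\<dots> \<le> (cutoff R x)\<^sup>2 * 1" using v0[of x] vd[of x] d by (intro mult_left_mono) auto
      also have "\<dots> \<le> cutoff R x" using cutoff_bounds[of R x] by (simp add: power2_eq_square mult_left_le)
      also have "\<dots> \<le> indicator (cball 0 (R + 1)) x" by (rule cutoff_le_indicator)
      finally show "v x * \<psi> x \<le> indicator (cball 0 (R + 1)) x" .
    qed
    have m: "Re (l2_inner ?vc ?pc) \<le> W"
    proof -
      have i: "integrable lborel (\<lambda>x. ?vc x * cnj (?pc x))"
        by (intro l2_inner_integrable H1_L2 V(1) T(1))
      have eq: "Re (?vc x * cnj (?pc x)) = v x * \<psi> x" for x by simp
      have "Re (l2_inner ?vc ?pc) = (LINT x|lborel. v x * \<psi> x)"
        unfolding l2_inner_def integral_Re[OF i, symmetric] eq ..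
      also have "\<dots> \<le> (LINT x|lborel. indicat_real (cball (0::real^3) (R + 1)) x)"
        using integrable_Re[OF i] unfolding eq by (intro integral_mono vp integrable_indicator_cball)
      finally show ?thesis by (simp add: W_def)
    qed
    have "mass (\<lambda>x. complex_of_real (2 * (v x * \<psi> x))) \<le> 2\<^sup>2 * mass (\<lambda>x. indicator (cball (0::real^3) (R + 1)) x)"
    proof (rule mass_mono[OF L2_indicator_bounded L2_measurable[OF E(1)]])
      fix x
      have "norm (complex_of_real (2 * (v x * \<psi> x))) = 2 * (v x * \<psi> x)"
        unfolding norm_of_real using vp(1)[of x] by simp
      also have "\<dots> \<le> 2 * norm (indicator (cball 0 (R + 1)) x :: complex)" using vp(2)[of x] by (cases "norm x \<le> R + 1") (auto simp: mult.commute)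
      finally show "norm (complex_of_real (2 * (v x * \<psi> x))) \<le> 2 * norm (indicator (cball 0 (R + 1)) x :: complex)" .
    qed auto
    also have "mass (\<lambda>x. indicator (cball (0::real^3) (R + 1)) x) = W" unfolding W_def by (rule mass_indicator) auto
    finally have m4: "mass (\<lambda>x. complex_of_real (2 * (v x * \<psi> x))) \<le> 4 * W" by simp
    have "\<bar>quartic_form lam1 lam2 (modulus_square ?vc) (\<lambda>x. complex_of_real (2 * (v x * \<psi> x)))\<bar>
       \<le> (\<bar>lam1\<bar> + 8 / 3 * pi * \<bar>lam2\<bar>) * (sqrt (mass (modulus_square ?vc)) * sqrt (mass (\<lambda>x. complex_of_real (2 * (v x * \<psi> x)))))"
      by (rule quartic_form_bound[OF modulus_square_L2[OF V(1)] E(1)])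
    also have "\<dots> \<le> (\<bar>lam1\<bar> + 8 / 3 * pi * \<bar>lam2\<bar>) * (sqrt (mass (modulus_square ?vc)) * sqrt (4 * W))"
      by (intro mult_left_mono real_sqrt_le_mono m4 add_nonneg_nonneg mult_nonneg_nonneg) auto
    finally have qb: "quartic_form lam1 lam2 (modulus_square ?vc) (\<lambda>x. complex_of_real (2 * (v x * \<psi> x)))
       \<le> (\<bar>lam1\<bar> + 8 / 3 * pi * \<bar>lam2\<bar>) * (sqrt (mass (modulus_square ?vc)) * sqrt (4 * W))" by linarith
    have "GP_A ?vc / (3 * c) * Re (l2_inner ?vc ?pc) \<le> GP_A ?vc / (3 * c) * W"
      using m V(4) c by (intro mult_left_mono) auto
    with E(2) qb have low: "(\<Sum>i\<in>UNIV. Re (l2_inner (weak_pdiff i ?vc) (weak_pdiff i ?pc))) \<ge> - K1"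
      unfolding K1_def by linarith
    let ?h = "\<lambda>n. s * step n"
    have h: "?h \<longlonglongrightarrow> 0" "?h n \<noteq> 0" for n
      using tendsto_mult_left[OF step_tendsto, of s] s step_nonzero by auto
    have "(\<lambda>n. \<Sum>i\<in>UNIV. Re (l2_inner (shift_diff i (?h n) ?vc) (shift_diff i (?h n) ?pc)) / (?h n)\<^sup>2)
       \<longlonglongrightarrow> (\<Sum>i\<in>UNIV. Re (l2_inner (weak_pdiff i ?vc) (weak_pdiff i ?pc)))"
      by (intro tendsto_sum difference_quotient_inner_tendsto V(1) T(1) h)
    then have "\<forall>\<^sub>F n in sequentially. - K1 - 1 < (\<Sum>i\<in>UNIV. Re (l2_inner (shift_diff i (?h n) ?vc) (shift_diff i (?h n) ?pc)) / (?h n)\<^sup>2)"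
      by (rule order_tendstoD) (use low in simp)
    moreover have "\<forall>\<^sub>F n in sequentially. \<bar>?h n\<bar> < 1"
      using order_tendstoD(2)[OF tendsto_rabs_zero[OF h(1)], of 1] by simp
    ultimately show ?thesis
    proof eventually_elim
      case (elim n)
      then have h1: "\<bar>?h n\<bar> \<le> 1" by simp
      have h2: "(?h n)\<^sup>2 > 0" using h(2)[of n] by simp
      let ?L = "\<lambda>i. LINT x|lborel. log_density R i (?h n) v d x"
      let ?X = "\<lambda>i. Re (l2_inner (shift_diff i (?h n) ?vc) (shift_diff i (?h n) ?pc))"
      have Lle: "?L i \<le> (?h n)\<^sup>2 * W' - ?X i" for i
        using T(3)[OF h1, of i] shift_diff_cutoff[OF h1, of i R] unfolding W'_def by linarith
      have L0: "0 \<le> ?L i" for i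
        using vd by (intro Bochner_Integration.integral_nonneg) (auto simp: log_density_def intro!: mult_nonneg_nonneg divide_nonneg_nonneg less_imp_le[OF vd])
      \<comment> \<open>The first variation controls only the sum over all directions; the densities
        being nonnegative, it bounds each one.\<close>
      have "?L j \<le> (\<Sum>i\<in>UNIV. ?L i)" by (rule member_le_sum) (use L0 in auto)
      also have "\<dots> \<le> (\<Sum>i\<in>UNIV. (?h n)\<^sup>2 * W' - ?X i)" by (intro sum_mono Lle)
      also have "\<dots> = 3 * ((?h n)\<^sup>2 * W') - (\<Sum>i\<in>UNIV. ?X i)" by (simp add: sum_subtractf)
      also have "(\<Sum>i\<in>UNIV. ?X i) \<ge> (- K1 - 1) * (?h n)\<^sup>2"
        using elim(1) h2 unfolding sum_divide_distrib[symmetric] by (simp add: less_divide_eq less_imp_le)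
      then have "3 * ((?h n)\<^sup>2 * W') - (\<Sum>i\<in>UNIV. ?X i) \<le> ?K * (?h n)\<^sup>2" by (simp add: algebra_simps)
      finally show ?case .
    qed
  qed
  moreover have "?K \<ge> 0" using K1 \<open>0 \<le> W'\<close> by simp
  ultimately show ?thesis by (intro exI[of _ ?K] conjI allI impI)
qed

subsection \<open>Translation invariant functions\<close>

lemma AE_lborel_ex:
  assumes "AE x in lborel. P (x::'a::euclidean_space)"
  shows "\<exists>x. P x"
proof (rule ccontr)
  assume "\<nexists>x. P x"
  with assms have "AE x in (lborel::'a measure). False" by simp
  then have "ae_filter (lborel::'a measure) = bot" by (simp only: trivial_limit_def)
  then show False by (simp add: ae_filter_eq_bot_iff)
qed

text \<open>The exceptional null set depends on the shift k. Exchanging the two almost everywhere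
  quantifiers by Fubini yields one point x with f (x + k) = f x for almost all k, that is, f = f x
  almost everywhere.\<close>

lemma translation_invariant_AE_const:
  fixes f :: "real^3 \<Rightarrow> complex"
  assumes [measurable]: "f \<in> borel_measurable borel"
    and inv: "\<And>j s. AE x in lborel. f (x + s *\<^sub>R axis j 1) = f x"
  shows "\<exists>c. AE x in lborel. f x = c"
proof -
  have shift: "AE x in lborel. f (x + k) = f x" for k
  proof -
    let ?e = "\<lambda>i. (k$i) *\<^sub>R axis i 1 :: real^3"
    have k: "x + k = ((x + ?e 1) + ?e 2) + ?e 3" for x
      by (simp add: vec_eq_iff forall_3 axis_def)
    have "AE x in lborel. f ((x + (?e 1 + ?e 2)) + ?e 3) = f (x + (?e 1 + ?e 2))"
      by (rule AE_translate[OF inv])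
    moreover have "AE x in lborel. f ((x + ?e 1) + ?e 2) = f (x + ?e 1)"
      by (rule AE_translate[OF inv])
    moreover have "AE x in lborel. f (x + ?e 1) = f x"
      by (rule inv)
    ultimately show ?thesis
      by eventually_elim (simp add: k add.assoc)
  qed
  have "AE k in lborel. AE x in lborel. f (x + k) = f x" by (intro AE_I2 shift)
  moreover have "(AE k in lborel. AE x in lborel. f (x + k) = f x) \<longleftrightarrow> (AE x in lborel. AE k in lborel. f (x + k) = f x)"
    by (rule lborel_pair.AE_commute) measurable
  ultimately have "AE x in lborel. AE k in lborel. f (x + k) = f x" by blast
  then obtain x where "AE k in lborel. f (x + k) = f x"
    using AE_lborel_ex by blast
  from AE_translate[OF this, of "- x"] have "AE y in lborel. f y = f x" by simp
  then show ?thesis ..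
qed

subsection \<open>Mean square oscillation along a coordinate direction\<close>

text \<open>A nonnegative integral, meaningful before integrability is known and stable under
  Fatou's lemma. Both end points are confined to the ball, as in \<open>log_density\<close>.\<close>

definition oscillation :: "real \<Rightarrow> 3 \<Rightarrow> real \<Rightarrow> (real^3 \<Rightarrow> complex) \<Rightarrow> ennreal" where
  "oscillation R j s w = (\<integral>\<^sup>+x. ennreal (indicator (ball 0 R) x * indicator (ball 0 R) (x + s *\<^sub>R axis j 1) *
     (norm (w (x + s *\<^sub>R axis j 1) - w x))\<^sup>2) \<partial>lborel)"

lemma norm_telescope_square_le:
  fixes a :: "nat \<Rightarrow> complex"
  shows "(norm (a n - a 0))\<^sup>2 \<le> real n * (\<Sum>i<n. (norm (a (Suc i) - a i))\<^sup>2)"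
proof -
  have "norm (a n - a 0) = norm (\<Sum>i<n. a (Suc i) - a i)"
    by (subst sum_lessThan_telescope) simp
  also have "\<dots> \<le> (\<Sum>i<n. norm (a (Suc i) - a i))" by (rule norm_sum)
  finally have "(norm (a n - a 0))\<^sup>2 \<le> (\<Sum>i<n. norm (a (Suc i) - a i))\<^sup>2" by (rule power_mono) simp
  also have "\<dots> \<le> (\<Sum>i<n. (norm (a (Suc i) - a i))\<^sup>2) * card {..<n}"
    by (rule sum_squared_le_sum_of_squares)
  finally show ?thesis by (simp add: mult.commute)
qed

text \<open>The ball is convex, so a long shift can be subdivided into \<open>n\<close> short ones.\<close>

lemma oscillation_subdivide:
  assumes [measurable]: "w \<in> borel_measurable borel" and n: "n > 0"
  shows "oscillation R j (real n * h) w \<le> ennreal ((real n)\<^sup>2) * oscillation R j h w"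
proof -
  let ?e = "axis j 1 :: real^3"
  let ?I = "indicat_real (ball (0::real^3) R)"
  define F where "F = (\<lambda>y. ?I y * ?I (y + h *\<^sub>R ?e) * (norm (w (y + h *\<^sub>R ?e) - w y))\<^sup>2)"
  have [measurable]: "F \<in> borel_measurable borel" unfolding F_def by measurable
  have F0: "0 \<le> F y" for y by (simp add: F_def)
  have le: "?I x * ?I (x + (real n * h) *\<^sub>R ?e) * (norm (w (x + (real n * h) *\<^sub>R ?e) - w x))\<^sup>2
      \<le> real n * (\<Sum>i<n. F (x + (real i * h) *\<^sub>R ?e))" for x
  proof (cases "x \<in> ball 0 R \<and> x + (real n * h) *\<^sub>R ?e \<in> ball 0 R")
    case True
    have mem: "x + (real i * h) *\<^sub>R ?e \<in> ball 0 R" if "i \<le> n" for i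
    proof -
      have "(1 - real i / real n) *\<^sub>R x + (real i / real n) *\<^sub>R (x + (real n * h) *\<^sub>R ?e) \<in> ball 0 R"
        using True that n by (intro convexD[OF convex_ball]) auto
      moreover have "(1 - real i / real n) *\<^sub>R x + (real i / real n) *\<^sub>R (x + (real n * h) *\<^sub>R ?e) = x + (real i * h) *\<^sub>R ?e"
        using n by (simp add: algebra_simps)
      ultimately show ?thesis by simp
    qed
    have "(norm (w (x + (real n * h) *\<^sub>R ?e) - w (x + (real 0 * h) *\<^sub>R ?e)))\<^sup>2
      \<le> real n * (\<Sum>i<n. (norm (w (x + (real (Suc i) * h) *\<^sub>R ?e) - w (x + (real i * h) *\<^sub>R ?e)))\<^sup>2)"
      by (rule norm_telescope_square_le[where a="\<lambda>i. w (x + (real i * h) *\<^sub>R ?e)"])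
    also have "(\<Sum>i<n. (norm (w (x + (real (Suc i) * h) *\<^sub>R ?e) - w (x + (real i * h) *\<^sub>R ?e)))\<^sup>2) = (\<Sum>i<n. F (x + (real i * h) *\<^sub>R ?e))"
    proof (rule sum.cong[OF refl])
      fix i assume "i \<in> {..<n}"
      then have "x + (real i * h) *\<^sub>R ?e \<in> ball 0 R" "x + (real (Suc i) * h) *\<^sub>R ?e \<in> ball 0 R"
        using mem[of i] mem[of "Suc i"] by auto
      moreover have z: "x + (real (Suc i) * h) *\<^sub>R ?e = x + (real i * h) *\<^sub>R ?e + h *\<^sub>R ?e"
        by (simp add: algebra_simps)
      ultimately show "(norm (w (x + (real (Suc i) * h) *\<^sub>R ?e) - w (x + (real i * h) *\<^sub>R ?e)))\<^sup>2 = F (x + (real i * h) *\<^sub>R ?e)"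
        unfolding F_def z[symmetric] by simp
    qed
    finally show ?thesis using True by simp
  next
    case False
    then have z: "?I x * ?I (x + (real n * h) *\<^sub>R ?e) = 0" by auto
    have "0 \<le> real n * (\<Sum>i<n. F (x + (real i * h) *\<^sub>R ?e))" by (intro mult_nonneg_nonneg sum_nonneg F0) simp
    then show ?thesis unfolding z mult_zero_left .
  qed
  have "oscillation R j (real n * h) w \<le> (\<integral>\<^sup>+x. ennreal (real n * (\<Sum>i<n. F (x + (real i * h) *\<^sub>R ?e))) \<partial>lborel)"
    unfolding oscillation_def by (intro nn_integral_mono ennreal_leI le)
  also have "\<dots> = (\<integral>\<^sup>+x. ennreal (real n) * (\<Sum>i<n. ennreal (F (x + (real i * h) *\<^sub>R ?e))) \<partial>lborel)"
    by (intro nn_integral_cong) (simp add: ennreal_mult sum_nonneg F0 sum_ennreal)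
  also have "\<dots> = ennreal (real n) * (\<Sum>i<n. \<integral>\<^sup>+x. ennreal (F (x + (real i * h) *\<^sub>R ?e)) \<partial>lborel)"
    by (simp add: nn_integral_cmult nn_integral_sum)
  also have "\<dots> = ennreal (real n) * (\<Sum>i<n. oscillation R j h w)"
    by (subst nn_integral_translate) (simp_all add: oscillation_def F_def)
  also have "\<dots> = ennreal ((real n)\<^sup>2) * oscillation R j h w"
    by (simp add: power2_eq_square ennreal_mult ennreal_of_nat_eq_real_of_nat mult.assoc)
  finally show ?thesis .
qed

text \<open>Bounds quadratic in the shift survive subdivision: the factor n^2 is cancelled by the
  square of the step s / n. One single short step therefore suffices to control the full shift s
  with the same constant.\<close>

lemma oscillation_scale:
  assumes "w \<in> borel_measurable borel" "b \<ge> 0"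
    and le: "oscillation R j (s * step n) w \<le> ennreal (b * (s * step n)\<^sup>2)"
  shows "oscillation R j s w \<le> ennreal (b * s\<^sup>2)"
proof -
  have s: "real (Suc n) * (s * step n) = s" by (simp add: step_def)
  have "oscillation R j s w \<le> ennreal ((real (Suc n))\<^sup>2) * oscillation R j (s * step n) w"
    using oscillation_subdivide[OF assms(1), of "Suc n" R j "s * step n"] unfolding s by simp
  also have "\<dots> \<le> ennreal ((real (Suc n))\<^sup>2) * ennreal (b * (s * step n)\<^sup>2)"
    by (rule mult_left_mono[OF le]) simp
  also have "\<dots> = ennreal (b * (real (Suc n) * (s * step n))\<^sup>2)"
    using assms(2) by (subst ennreal_mult[symmetric]) (auto simp: power_mult_distrib mult_ac)
  finally show ?thesis unfolding s .
qed

lemma oscillation_0_AE: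
  assumes [measurable]: "w \<in> borel_measurable borel" and "\<And>R. oscillation R j s w = 0"
  shows "AE x in lborel. w (x + s *\<^sub>R axis j 1) = w x"
proof -
  let ?e = "s *\<^sub>R axis j 1 :: real^3"
  have "AE x in lborel. ennreal (indicator (ball 0 (real m)) x * indicator (ball 0 (real m)) (x + ?e) * (norm (w (x + ?e) - w x))\<^sup>2) = 0" for m
  proof (subst nn_integral_0_iff_AE[symmetric])
    show "(\<integral>\<^sup>+x. ennreal (indicator (ball 0 (real m)) x * indicator (ball 0 (real m)) (x + ?e) * (norm (w (x + ?e) - w x))\<^sup>2) \<partial>lborel) = 0"
      using assms(2)[of "real m"] by (simp only: oscillation_def)
  qed measurable
  then have "AE x in lborel. \<forall>m. ennreal (indicator (ball 0 (real m)) x * indicator (ball 0 (real m)) (x + ?e) * (norm (w (x + ?e) - w x))\<^sup>2) = 0"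
    by (subst AE_all_countable) blast
  then show ?thesis
  proof eventually_elim
    case (elim x)
    obtain m :: nat where "max (norm x) (norm (x + ?e)) < real m" using reals_Archimedean2 by blast
    then have "x \<in> ball 0 (real m)" "x + ?e \<in> ball 0 (real m)" by auto
    with elim[rule_format, of m] show ?case by (simp add: ennreal_eq_0_iff)
  qed
qed

subsection \<open>Positivity\<close>

text \<open>Applying ln y \<le> y - 1 to the square root of a / b, rather than to a / b, produces
  the geometric mean of a and b in the denominator, as \<open>log_density\<close> requires.\<close>

lemma ln_diff_square_le:
  fixes a b :: real
  assumes "a > 0" "b > 0"
  shows "(ln a - ln b)\<^sup>2 \<le> 4 * ((a - b)\<^sup>2 / (a * b))"
proof -
  have *: "(ln a - ln b)\<^sup>2 \<le> 4 * ((a - b)\<^sup>2 / (a * b))" if "0 < b" "b \<le> a" for a b :: real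
  proof -
    have a: "a > 0" using that by simp
    have "ln a - ln b = 2 * ln (sqrt (a / b))" using a that by (simp add: ln_sqrt ln_div)
    also have "\<dots> \<le> 2 * (sqrt (a / b) - 1)" using ln_le_minus_one[of "sqrt (a / b)"] a that by simp
    also have "sqrt (a / b) - 1 \<le> (a - b) / sqrt (a * b)"
    proof -
      have b': "sqrt b > 0" "sqrt a > 0" "sqrt b \<le> sqrt a" using a that by auto
      have "(sqrt a - sqrt b) * sqrt a \<le> (sqrt a - sqrt b) * (sqrt a + sqrt b)"
        using b' by (intro mult_left_mono) auto
      also have "\<dots> = a - b" using a that by (simp add: algebra_simps)
      finally have "(sqrt a - sqrt b) * sqrt a / (sqrt a * sqrt b) \<le> (a - b) / (sqrt a * sqrt b)"
        using b' by (intro divide_right_mono) auto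
      then have "(sqrt a - sqrt b) / sqrt b \<le> (a - b) / (sqrt a * sqrt b)"
        using b' by (simp add: mult.commute[of "sqrt a - sqrt b"])
      then show ?thesis using b' by (simp add: real_sqrt_divide real_sqrt_mult diff_divide_distrib)
    qed
    finally have "ln a - ln b \<le> 2 * ((a - b) / sqrt (a * b))" by simp
    then have "(ln a - ln b)\<^sup>2 \<le> (2 * ((a - b) / sqrt (a * b)))\<^sup>2"
      using that a by (intro power_mono) auto
    also have "\<dots> = 4 * ((a - b)\<^sup>2 / (a * b))"
    proof -
      have "(sqrt (a * b))\<^sup>2 = a * b" using that a by simp
      then show ?thesis by (simp only: power_mult_distrib power_divide) simp
    qed
    finally show ?thesis .
  qed
  show ?thesis
  proof (cases "b \<le> a")
    case True
    then show ?thesis using *[of b a] assms by simp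
  next
    case False
    then show ?thesis using *[of a b] assms by (simp add: power2_commute[of a b] power2_commute[of "ln a"] mult.commute)
  qed
qed

lemma log_density_nonneg:
  assumes "\<And>x. v x \<ge> 0" "d > 0"
  shows "0 \<le> log_density R j s v d x"
proof -
  have "v y + d > 0" for y using assms(1)[of y] assms(2) by simp
  then have "0 \<le> (v (x + s *\<^sub>R axis j 1) + d) * (v x + d)" by (simp add: less_imp_le)
  then show ?thesis by (simp add: log_density_def)
qed

text \<open>Converts the bounds of \<open>log_estimate\<close>, valid only for steps that are small
  in terms of d, into bounds at every fixed shift s that are uniform in d. Only in this form can d
  tend to 0.\<close>

lemma log_oscillation:
  fixes v :: "real^3 \<Rightarrow> real"
  assumes min: "(\<lambda>x. complex_of_real (v x)) \<in> minimizers lam1 lam2 c" and c: "c > 0" and v0: "\<And>x. v x \<ge> 0"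
  shows "\<exists>K\<ge>0. \<forall>d>0. \<forall>s. s \<noteq> 0 \<longrightarrow> oscillation R j s (\<lambda>x. complex_of_real (ln (v x + d))) \<le> ennreal (4 * K * s\<^sup>2)"
proof -
  note V = minimizer_facts[OF min c]
  have "(\<lambda>x. Re (complex_of_real (v x))) \<in> borel_measurable borel" using L2_measurable[OF H1_L2[OF V(1)]] by measurable
  then have [measurable]: "v \<in> borel_measurable borel" by simp
  obtain K where K: "K \<ge> 0" "\<And>d j s. d > 0 \<Longrightarrow> s \<noteq> 0 \<Longrightarrow>
    (\<forall>\<^sub>F n in sequentially. (LINT x|lborel. log_density R j (s * step n) v d x) \<le> K * (s * step n)\<^sup>2)"
    using log_estimate[OF min c v0, of R] by blast
  have "oscillation R j s (\<lambda>x. complex_of_real (ln (v x + d))) \<le> ennreal (4 * K * s\<^sup>2)" if d: "d > 0" and s: "s \<noteq> 0" for d s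
  proof -
    let ?w = "\<lambda>x. complex_of_real (ln (v x + d))"
    have "(\<lambda>n. s * step n) \<longlonglongrightarrow> 0" using tendsto_mult_left[OF step_tendsto, of s] by simp
    then have "\<forall>\<^sub>F n in sequentially. \<bar>s * step n\<bar> < 1"
      using order_tendstoD(2)[OF tendsto_rabs_zero, of _ _ 1] by simp
    with K(2)[OF d s, of j] have "\<forall>\<^sub>F n in sequentially. \<bar>s * step n\<bar> < 1 \<and> (LINT x|lborel. log_density R j (s * step n) v d x) \<le> K * (s * step n)\<^sup>2"
      by eventually_elim simp
    \<comment> \<open>One admissible step is enough here, and it may depend on d:
      \<open>oscillation_scale\<close> removes it from the conclusion.\<close>
    then obtain n where n: "\<bar>s * step n\<bar> < 1" "(LINT x|lborel. log_density R j (s * step n) v d x) \<le> K * (s * step n)\<^sup>2"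
      using eventually_happens'[OF sequentially_bot] by blast
    have int: "integrable lborel (log_density R j (s * step n) v d)"
      by (rule test_function_choice(2)[OF V(1) v0 d]) (use n(1) in simp)
    have "oscillation R j (s * step n) ?w \<le> (\<integral>\<^sup>+x. ennreal (4 * log_density R j (s * step n) v d x) \<partial>lborel)"
      unfolding oscillation_def
    proof (intro nn_integral_mono ennreal_leI)
      fix x :: "real^3"
      let ?y = "x + (s * step n) *\<^sub>R axis j 1"
      have "(norm (?w ?y - ?w x))\<^sup>2 = (ln (v ?y + d) - ln (v x + d))\<^sup>2"
        unfolding of_real_diff[symmetric] norm_of_real by simp
      also have "\<dots> \<le> 4 * ((v ?y - v x)\<^sup>2 / ((v ?y + d) * (v x + d)))"
        using ln_diff_square_le[of "v ?y + d" "v x + d"] v0[of x] v0[of ?y] d by simp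
      finally have "indicat_real (ball 0 R) x * indicator (ball 0 R) ?y * (norm (?w ?y - ?w x))\<^sup>2
         \<le> indicator (ball 0 R) x * indicator (ball 0 R) ?y * (4 * ((v ?y - v x)\<^sup>2 / ((v ?y + d) * (v x + d))))"
        by (rule mult_left_mono) simp
      then show "indicat_real (ball 0 R) x * indicator (ball 0 R) ?y * (norm (?w ?y - ?w x))\<^sup>2 \<le> 4 * log_density R j (s * step n) v d x"
        unfolding log_density_def mult.left_commute[of 4] .
    qed
    also have "\<dots> = ennreal (4 * (LINT x|lborel. log_density R j (s * step n) v d x))"
      using int log_density_nonneg[OF v0 d] by (subst nn_integral_eq_integral) auto
    also have "\<dots> \<le> ennreal (4 * K * (s * step n)\<^sup>2)"
      using n(2) by (intro ennreal_leI) simp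
    finally have le: "oscillation R j (s * step n) ?w \<le> ennreal (4 * K * (s * step n)\<^sup>2)" .
    have "?w \<in> borel_measurable borel" by measurable
    then show ?thesis
      by (rule oscillation_scale[OF _ _ le]) (use K(1) in simp)
  qed
  with K(1) show ?thesis by blast
qed

text \<open>At a point with v x = 0 and positive v at the shifted point, the difference of ln (v +
  \<delta>) is ln (1 + v / \<delta>), which increases to infinity as \<delta> decreases to 0.
  Monotone convergence against the uniform bound leaves only a null set of such points.\<close>

lemma zero_set_shift:
  fixes v :: "real^3 \<Rightarrow> real"
  assumes min: "(\<lambda>x. complex_of_real (v x)) \<in> minimizers lam1 lam2 c" and c: "c > 0" and v0: "\<And>x. v x \<ge> 0"
  shows "AE x in lborel. v x = 0 \<longrightarrow> v (x + s *\<^sub>R axis j 1) = 0"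
proof (cases "s = 0")
  case False
  note V = minimizer_facts[OF min c]
  have "(\<lambda>x. Re (complex_of_real (v x))) \<in> borel_measurable borel" using L2_measurable[OF H1_L2[OF V(1)]] by measurable
  then have [measurable]: "v \<in> borel_measurable borel" by simp
  let ?e = "s *\<^sub>R axis j 1 :: real^3"
  have "AE x in lborel. x \<in> ball 0 R \<longrightarrow> x + ?e \<in> ball 0 R \<longrightarrow> v x = 0 \<longrightarrow> v (x + ?e) = 0" for R
  proof -
    let ?L = "\<lambda>n x. ln (1 + real (Suc n) * v (x + ?e))"
    define G where "G = (\<lambda>n x. ennreal (indicator (ball 0 R) x * indicator (ball 0 R) (x + ?e) * indicator {0} (v x) * (?L n x)\<^sup>2))"
    have [measurable]: "G n \<in> borel_measurable borel" for n unfolding G_def by measurable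
    obtain K where K: "K \<ge> 0" "\<And>d. d > 0 \<Longrightarrow> oscillation R j s (\<lambda>x. complex_of_real (ln (v x + d))) \<le> ennreal (4 * K * s\<^sup>2)"
      using log_oscillation[OF min c v0, of R j] False by blast
    have Gle: "(\<integral>\<^sup>+x. G n x \<partial>lborel) \<le> ennreal (4 * K * s\<^sup>2)" for n
    proof -
      have "(\<integral>\<^sup>+x. G n x \<partial>lborel) \<le> oscillation R j s (\<lambda>x. complex_of_real (ln (v x + step n)))"
        unfolding oscillation_def G_def
      proof (intro nn_integral_mono ennreal_leI)
        fix x
        let ?w = "\<lambda>x. complex_of_real (ln (v x + step n))"
        show "indicat_real (ball 0 R) x * indicator (ball 0 R) (x + ?e) * indicator {0} (v x) * (?L n x)\<^sup>2
          \<le> indicator (ball 0 R) x * indicator (ball 0 R) (x + ?e) * (norm (?w (x + ?e) - ?w x))\<^sup>2"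
        proof (cases "v x = 0")
          case True
          have p: "v (x + ?e) + step n > 0" using v0[of "x + ?e"] step_pos[of n] by simp
          have "ln (v (x + ?e) + step n) - ln (step n) = ln ((v (x + ?e) + step n) / step n)"
            using p step_pos[of n] by (simp add: ln_div)
          also have "(v (x + ?e) + step n) / step n = 1 + real (Suc n) * v (x + ?e)"
            by (simp add: step_def field_simps)
          finally have "?w (x + ?e) - ?w x = complex_of_real (?L n x)"
            using True by (simp flip: of_real_diff)
          then show ?thesis using True by simp
        qed simp
      qed
      then show ?thesis using K(2)[OF step_pos[of n]] by (rule order_trans)
    qed
    have "incseq G"
    proof (rule incseq_SucI, rule le_funI)
      fix n x
      have "1 + real (Suc n) * v (x + ?e) \<ge> 1" "1 + real (Suc n) * v (x + ?e) \<le> 1 + real (Suc (Suc n)) * v (x + ?e)"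
        using v0[of "x + ?e"] by (auto intro: mult_right_mono)
      then have "0 \<le> ?L n x" "?L n x \<le> ?L (Suc n) x" by (auto intro: ln_ge_zero)
      then show "G n x \<le> G (Suc n) x"
        unfolding G_def by (intro ennreal_leI mult_left_mono power_mono) auto
    qed
    then have "(\<integral>\<^sup>+x. (SUP n. G n x) \<partial>lborel) = (SUP n. \<integral>\<^sup>+x. G n x \<partial>lborel)"
      by (intro nn_integral_monotone_convergence_SUP) auto
    also have "\<dots> \<le> ennreal (4 * K * s\<^sup>2)" by (rule SUP_least) (rule Gle)
    finally have "(\<integral>\<^sup>+x. (SUP n. G n x) \<partial>lborel) \<noteq> \<infinity>" by (auto simp: top_unique)
    then have "AE x in lborel. (SUP n. G n x) \<noteq> \<infinity>" by (intro nn_integral_PInf_AE) auto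
    then show ?thesis
    proof eventually_elim
      case (elim x)
      show ?case
      proof (intro impI, rule ccontr)
        assume x: "x \<in> ball 0 R" "x + ?e \<in> ball 0 R" "v x = 0" and "v (x + ?e) \<noteq> 0"
        then have p: "v (x + ?e) > 0" using v0[of "x + ?e"] by simp
        obtain M where M: "M \<ge> 0" "(SUP n. G n x) = ennreal M" using elim by (cases "SUP n. G n x") auto
        \<comment> \<open>This n pushes the logarithm above M + 1, and (M + 1)^2 > M contradicts the
          bound M on its square.\<close>
        obtain n :: nat where "exp (M + 1) / v (x + ?e) < real n" using reals_Archimedean2 by blast
        then have "exp (M + 1) < real n * v (x + ?e)" using p by (simp add: field_simps)
        also have "\<dots> \<le> 1 + real (Suc n) * v (x + ?e)" using p by (simp add: algebra_simps)
        finally have "M + 1 < ?L n x" by (metis exp_less_cancel_iff exp_ln exp_gt_zero less_trans)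
        then have "(M + 1)\<^sup>2 \<le> (?L n x)\<^sup>2" using M(1) by (intro power_mono) auto
        moreover have "G n x \<le> ennreal M" unfolding M(2)[symmetric] by (rule SUP_upper) simp
        then have "(?L n x)\<^sup>2 \<le> M" using x M(1) by (simp add: G_def)
        moreover have "(M + 1)\<^sup>2 > M" using M(1) by (simp add: power2_eq_square algebra_simps add_pos_nonneg)
        ultimately show False by simp
      qed
    qed
  qed
  then have "AE x in lborel. \<forall>m::nat. x \<in> ball 0 (real m) \<longrightarrow> x + ?e \<in> ball 0 (real m) \<longrightarrow> v x = 0 \<longrightarrow> v (x + ?e) = 0"
    by (subst AE_all_countable) blast
  then show ?thesis
  proof eventually_elim
    case (elim x)
    obtain m :: nat where "max (norm x) (norm (x + ?e)) < real m" using reals_Archimedean2 by blast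
    with elim[rule_format, of m] show ?case by auto
  qed
qed simp

theorem minimizer_positive:
  fixes v :: "real^3 \<Rightarrow> real"
  assumes min: "(\<lambda>x. complex_of_real (v x)) \<in> minimizers lam1 lam2 c" and c: "c > 0" and v0: "\<And>x. v x \<ge> 0"
  shows "AE x in lborel. v x > 0"
proof -
  note V = minimizer_facts[OF min c]
  have "(\<lambda>x. Re (complex_of_real (v x))) \<in> borel_measurable borel" using L2_measurable[OF H1_L2[OF V(1)]] by measurable
  then have [measurable]: "v \<in> borel_measurable borel" by simp
  define f where "f = (\<lambda>x. if v x = 0 then 1 else 0 :: complex)"
  have "AE x in lborel. f (x + s *\<^sub>R axis j 1) = f x" for j s
  proof -
    have "AE x in lborel. v x = 0 \<longrightarrow> v (x + s *\<^sub>R axis j 1) = 0"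
      by (rule zero_set_shift[OF min c v0])
    \<comment> \<open>The converse implication is the same fact for the shift -s, translated back by
      s.\<close>
    moreover have "AE x in lborel. v (x + s *\<^sub>R axis j 1) = 0 \<longrightarrow> v x = 0"
      using AE_translate[OF zero_set_shift[OF min c v0, of "- s" j], of "s *\<^sub>R axis j 1"] by simp
    ultimately show ?thesis by eventually_elim (auto simp: f_def)
  qed
  moreover have "f \<in> borel_measurable borel" unfolding f_def by measurable
  ultimately obtain k where k: "AE x in lborel. f x = k" using translation_invariant_AE_const by blast
  have "k \<noteq> 1"
  proof
    assume "k = 1"
    from k have "AE x in lborel. complex_of_real (v x) = 0"
      by eventually_elim (use \<open>k = 1\<close> in \<open>auto simp: f_def split: if_splits\<close>)
    then have "mass (\<lambda>x. complex_of_real (v x)) = 0" using mass_eq_0_iff[OF H1_L2[OF V(1)]] by simp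
    then show False using V(2) c by simp
  qed
  from k show ?thesis
  proof eventually_elim
    case (elim x)
    then have "v x \<noteq> 0" using \<open>k \<noteq> 1\<close> by (auto simp: f_def)
    then show ?case using v0[of x] by simp
  qed
qed

subsection \<open>Constancy of the phase\<close>

text \<open>With a = |p| + e and b = |q| + e, the square of p / a - q / b splits exactly into a
  radial part, the square of |p| / a - |q| / b, and an angular part, the excess of |p - q|^2 over
  the square of |p| - |q| divided by a b. The radial difference is e (|p| - |q|) / (a b); the
  angular part is bounded by a b \<ge> e^2.\<close>

lemma regularized_phase_difference:
  fixes p q :: complex
  assumes "e > 0"
  shows "(norm (p / of_real (norm p + e) - q / of_real (norm q + e)))\<^sup>2
    \<le> e\<^sup>2 * (norm p - norm q)\<^sup>2 / ((norm p + e) * (norm q + e))\<^sup>2 + ((norm (p - q))\<^sup>2 - (norm p - norm q)\<^sup>2) / e\<^sup>2"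
proof -
  define a b where "a = norm p + e" and "b = norm q + e"
  have ab: "a > 0" "b > 0" "a \<ge> e" "b \<ge> e" using assms by (auto simp: a_def b_def add_nonneg_pos)
  have ab2: "e\<^sup>2 \<le> a * b" using ab assms by (simp add: power2_eq_square mult_mono)
  have d2: "(norm (z - w))\<^sup>2 = (norm z)\<^sup>2 + (norm w)\<^sup>2 - 2 * Re (z * cnj w)" for z w
    unfolding cmod_power2 by (simp add: power2_eq_square algebra_simps)
  have "(norm (p / of_real a - q / of_real b))\<^sup>2 = (norm p)\<^sup>2 / a\<^sup>2 + (norm q)\<^sup>2 / b\<^sup>2 - 2 * (Re (p * cnj q) / (a * b))"
    unfolding d2 using ab by (simp add: norm_divide power_divide)
  also have "\<dots> = (norm p / a - norm q / b)\<^sup>2 + ((norm (p - q))\<^sup>2 - (norm p - norm q)\<^sup>2) / (a * b)"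
    unfolding d2 using ab by (simp add: power2_diff power_divide field_simps, simp add: power2_eq_square)
  also have "norm p / a - norm q / b = e * (norm p - norm q) / (a * b)"
  proof -
    have "norm p * b - norm q * a = e * (norm p - norm q)" by (simp add: a_def b_def algebra_simps)
    then show ?thesis using ab by (simp add: diff_frac_eq)
  qed
  also have "((norm (p - q))\<^sup>2 - (norm p - norm q)\<^sup>2) / (a * b) \<le> ((norm (p - q))\<^sup>2 - (norm p - norm q)\<^sup>2) / e\<^sup>2"
  proof (rule divide_left_mono[OF ab2])
    have "\<bar>norm p - norm q\<bar>\<^sup>2 \<le> (norm (p - q))\<^sup>2" by (intro power_mono norm_triangle_ineq3) simp
    then show "0 \<le> (norm (p - q))\<^sup>2 - (norm p - norm q)\<^sup>2" by simp
  qed (use ab assms in simp)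
  finally show ?thesis unfolding a_def b_def by (simp add: power_mult_distrib power_divide)
qed

text \<open>Each direction satisfies an inequality and the sums are equal, so equality holds in each
  direction separately; the phase argument works one direction at a time.\<close>

lemma minimizer_weak_pdiff_mass:
  assumes u: "u \<in> minimizers lam1 lam2 c" and c: "c > 0"
  shows "mass (weak_pdiff j (cmodulus u)) = mass (weak_pdiff j u)"
proof -
  note U = minimizer_facts(1)[OF u c]
  note V = cmodulus_H1[OF U]
  have "(\<Sum>j\<in>UNIV. mass (weak_pdiff j (cmodulus u))) = (\<Sum>j\<in>UNIV. mass (weak_pdiff j u))"
    using cmodulus_minimizer(1)[OF u c] by (simp only: GP_A_eq[OF U] GP_A_eq[OF V(1)])
  then show ?thesis by (rule sum_mono_inv) (simp_all add: V(2))
qed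

text \<open>Fatou's lemma in the logarithmic estimate, first in the step size, then in the regularization.\<close>

lemma log_derivative_bound:
  fixes u :: "real^3 \<Rightarrow> complex" and R :: real and j :: 3
  assumes u: "u \<in> minimizers lam1 lam2 c" and c: "c > 0"
  defines "g \<equiv> weak_pdiff j (cmodulus u)"
  shows "integrable lborel (\<lambda>x. indicator (ball 0 R) x * ((norm (g x))\<^sup>2 / (norm (u x))\<^sup>2))"
proof -
  let ?v = "\<lambda>x. norm (u x)" and ?V = "cmodulus u" and ?e = "axis j 1 :: real^3"
  have min: "?V \<in> minimizers lam1 lam2 c" by (rule cmodulus_minimizer(2)[OF u c])
  note V = minimizer_facts[OF min c]
  have VL: "?V \<in> L2" by (rule H1_L2[OF V(1)])
  have uL: "u \<in> L2" by (rule H1_L2[OF minimizer_facts(1)[OF u c]])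
  have gL: "g \<in> L2" unfolding g_def by (rule weak_pdiff_L2[OF V(1)])
  have [measurable]: "u \<in> borel_measurable borel" "g \<in> borel_measurable borel"
    using uL gL by (auto dest: L2_measurable)
  have pos: "AE x in lborel. ?v x > 0" by (rule minimizer_positive[OF min c]) simp
  obtain K where "K \<ge> 0" and K: "\<forall>d>0. \<forall>j s. s \<noteq> 0 \<longrightarrow>
      (\<forall>\<^sub>F n in sequentially. (LINT x|lborel. log_density R j (s * step n) ?v d x) \<le> K * (s * step n)\<^sup>2)"
    using log_estimate[OF min c norm_ge_zero, of R] by blast
  have K: "\<forall>\<^sub>F n in sequentially. (LINT x|lborel. log_density R j (step n) ?v d x) \<le> K * (step n)\<^sup>2" if "d > 0" for d
    using K[rule_format, OF that, of 1 j] by simp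
  let ?G = "\<lambda>d x. indicator (ball 0 R) x * ((norm (g x))\<^sup>2 / (?v x + d)\<^sup>2)"
  have G: "(\<integral>\<^sup>+x. ennreal (?G d x) \<partial>lborel) \<le> ennreal K" if d: "d > 0" for d
  proof -
    have t0: "(\<lambda>n. step n *\<^sub>R ?e) \<longlonglongrightarrow> 0" using tendsto_scaleR[OF step_tendsto tendsto_const[of ?e]] by simp
    obtain r1 :: "nat \<Rightarrow> nat" where r1: "strict_mono r1" "AE x in lborel. (\<lambda>n. ?V (x + step (r1 n) *\<^sub>R ?e)) \<longlonglongrightarrow> ?V x"
      using L2_AE_subseq[OF L2_translate[OF VL] VL L2_translate_continuous[OF VL t0]] by blast
    have q: "(\<lambda>x. shift_diff j (step n) ?V x / of_real (step n)) \<in> L2" for n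
      using L2_cmult[OF shift_diff_L2[OF VL], of "1 / of_real (step n)" j "step n"] by simp
    have "(\<lambda>n. mass (\<lambda>x. shift_diff j (step (r1 n)) ?V x / of_real (step (r1 n)) - g x)) \<longlonglongrightarrow> 0"
      unfolding g_def using LIMSEQ_subseq_LIMSEQ[OF difference_quotient_tendsto[OF V(1) step_tendsto step_nonzero] r1(1)]
      by (simp only: o_def)
    from L2_AE_subseq[OF q gL this] obtain r2 :: "nat \<Rightarrow> nat" where r2: "strict_mono r2"
      "AE x in lborel. (\<lambda>n. shift_diff j (step (r1 (r2 n))) ?V x / of_real (step (r1 (r2 n)))) \<longlonglongrightarrow> g x" by blast
    \<comment> \<open>Two successive subsequences: along the first the translates of v converge
      almost everywhere, along the second also the difference quotients.\<close>
    define r where "r = r1 \<circ> r2"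
    have r: "strict_mono r" unfolding r_def by (rule strict_mono_o[OF r1(1) r2(1)])
    let ?L = "\<lambda>n x. log_density R j (step (r n)) ?v d x / (step (r n))\<^sup>2"
    have lim: "AE x in lborel. x \<in> ball 0 R \<longrightarrow> (\<lambda>n. ?L n x) \<longlonglongrightarrow> (norm (g x))\<^sup>2 / (?v x + d)\<^sup>2"
      using r1(2) r2(2)
    proof eventually_elim
      case (elim x)
      show ?case
      proof
        assume x: "x \<in> ball 0 R"
        let ?y = "\<lambda>n. x + step (r n) *\<^sub>R ?e"
        have y: "(\<lambda>n. ?v (?y n)) \<longlonglongrightarrow> ?v x"
          using tendsto_norm[OF LIMSEQ_subseq_LIMSEQ[OF elim(1) r2(1)]] by (simp add: o_def r_def)
        have "(\<lambda>n. ?y n) \<longlonglongrightarrow> x + 0"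
          using LIMSEQ_subseq_LIMSEQ[OF t0 r] by (intro tendsto_add tendsto_const) (simp add: o_def)
        then have "\<forall>\<^sub>F n in sequentially. ?y n \<in> ball 0 R"
          using x by (intro topological_tendstoD[of "\<lambda>n. ?y n" x]) auto
        then have "\<forall>\<^sub>F n in sequentially. (norm (shift_diff j (step (r n)) ?V x / of_real (step (r n))))\<^sup>2 / ((?v (?y n) + d) * (?v x + d)) = ?L n x"
        proof eventually_elim
          case (elim n)
          have "(norm (shift_diff j (step (r n)) ?V x))\<^sup>2 = (?v (?y n) - ?v x)\<^sup>2"
            unfolding shift_diff_def of_real_diff[symmetric] norm_of_real by simp
          then show ?case using x elim by (simp add: log_density_def norm_divide power_divide)
        qed
        moreover have "(\<lambda>n. (norm (shift_diff j (step (r n)) ?V x / of_real (step (r n))))\<^sup>2 / ((?v (?y n) + d) * (?v x + d)))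
           \<longlonglongrightarrow> (norm (g x))\<^sup>2 / ((?v x + d) * (?v x + d))"
          using elim(2) d unfolding r_def o_def
          by (intro tendsto_intros y[unfolded r_def o_def]) (auto simp: add_nonneg_eq_0_iff)
        ultimately show "(\<lambda>n. ?L n x) \<longlonglongrightarrow> (norm (g x))\<^sup>2 / (?v x + d)\<^sup>2"
          unfolding power2_eq_square[of "?v x + d"] by (rule Lim_transform_eventually[rotated])
      qed
    qed
    have [measurable]: "log_density R j s ?v d \<in> borel_measurable borel" for s
      unfolding log_density_def[abs_def] by measurable
    have "(\<integral>\<^sup>+x. ennreal (?G d x) \<partial>lborel) \<le> (\<integral>\<^sup>+x. liminf (\<lambda>n. ennreal (?L n x)) \<partial>lborel)"
    proof (rule nn_integral_mono_AE)
      show "AE x in lborel. ennreal (?G d x) \<le> liminf (\<lambda>n. ennreal (?L n x))"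
        using lim
      proof eventually_elim
        case (elim x)
        show ?case
        proof (cases "x \<in> ball 0 R")
          case True
          with elim have "(\<lambda>n. ennreal (?L n x)) \<longlonglongrightarrow> ennreal ((norm (g x))\<^sup>2 / (?v x + d)\<^sup>2)"
            by (intro tendsto_ennrealI) auto
          from lim_imp_Liminf[OF _ this] show ?thesis using True by simp
        qed simp
      qed
    qed
    also have "\<dots> \<le> liminf (\<lambda>n. \<integral>\<^sup>+x. ennreal (?L n x) \<partial>lborel)"
      by (rule nn_integral_liminf) measurable
    also have "\<dots> \<le> ennreal K"
    proof (rule Liminf_le)
      have "\<forall>\<^sub>F n in sequentially. (LINT x|lborel. log_density R j (step (r n)) ?v d x) \<le> K * (step (r n))\<^sup>2"
        by (rule eventually_subseq[OF r K[OF d]])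
      then show "\<forall>\<^sub>F n in sequentially. (\<integral>\<^sup>+x. ennreal (?L n x) \<partial>lborel) \<le> ennreal K"
      proof eventually_elim
        case (elim n)
        have int: "integrable lborel (log_density R j (step (r n)) ?v d)"
          by (rule test_function_choice(2)[OF V(1) _ d]) (use step_pos[of "r n"] step_le_1[of "r n"] in auto)
        have "(\<integral>\<^sup>+x. ennreal (?L n x) \<partial>lborel) = ennreal ((LINT x|lborel. log_density R j (step (r n)) ?v d x) / (step (r n))\<^sup>2)"
          using int log_density_nonneg[of ?v d] d by (subst nn_integral_eq_integral) auto
        also have "\<dots> \<le> ennreal K"
          using elim step_nonzero[of "r n"] by (intro ennreal_leI) (simp add: divide_le_eq)
        finally show ?case .
      qed
    qed simp
    finally show ?thesis .
  qed
  have "(\<integral>\<^sup>+x. ennreal (indicator (ball 0 R) x * ((norm (g x))\<^sup>2 / (?v x)\<^sup>2)) \<partial>lborel) \<le> (\<integral>\<^sup>+x. liminf (\<lambda>m. ennreal (?G (step m) x)) \<partial>lborel)"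
  proof (rule nn_integral_mono_AE)
    show "AE x in lborel. ennreal (indicator (ball 0 R) x * ((norm (g x))\<^sup>2 / (?v x)\<^sup>2)) \<le> liminf (\<lambda>m. ennreal (?G (step m) x))"
      using pos
    proof eventually_elim
      case (elim x)
      then have "(\<lambda>m. ?G (step m) x) \<longlonglongrightarrow> indicator (ball 0 R) x * ((norm (g x))\<^sup>2 / (?v x + 0)\<^sup>2)"
        by (intro tendsto_intros step_tendsto) auto
      then have "(\<lambda>m. ennreal (?G (step m) x)) \<longlonglongrightarrow> ennreal (indicator (ball 0 R) x * ((norm (g x))\<^sup>2 / (?v x)\<^sup>2))"
        by (intro tendsto_ennrealI) simp
      from lim_imp_Liminf[OF _ this] show ?case by simp
    qed
  qed
  also have "\<dots> \<le> liminf (\<lambda>m. \<integral>\<^sup>+x. ennreal (?G (step m) x) \<partial>lborel)"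
    by (rule nn_integral_liminf) measurable
  also have "\<dots> \<le> ennreal K"
    by (intro Liminf_le always_eventually allI G step_pos) simp
  also have "\<dots> < \<infinity>" by simp
  finally show ?thesis
    by (intro integrableI_nonneg) auto
qed

text \<open>Here d is fixed and the step tends to 0. The angular part vanishes in the limit because
  u and |u| have the same derivative mass in direction j. What remains is the radial part, in which
  the difference of |u| may be replaced by its derivative g.\<close>

lemma regularized_phase_oscillation:
  fixes u :: "real^3 \<Rightarrow> complex" and R s d :: real and j :: 3
  assumes u: "u \<in> minimizers lam1 lam2 c" and c: "c > 0" and s: "s \<noteq> 0" and d: "d > 0"
  defines "g \<equiv> weak_pdiff j (cmodulus u)"
  shows "oscillation R j s (\<lambda>x. u x / of_real (norm (u x) + d))
    \<le> ennreal (2 * (LINT x|lborel. indicator (ball 0 R) x * (d\<^sup>2 * (norm (g x))\<^sup>2 / ((norm (u x) + d) * (norm (u x) + d))\<^sup>2)) * s\<^sup>2)"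
proof -
  let ?v = "\<lambda>x. norm (u x)" and ?V = "cmodulus u" and ?e = "axis j 1 :: real^3"
  have min: "?V \<in> minimizers lam1 lam2 c" by (rule cmodulus_minimizer(2)[OF u c])
  note V = minimizer_facts[OF min c] and U = minimizer_facts[OF u c]
  have VL: "?V \<in> L2" by (rule H1_L2[OF V(1)])
  have uL: "u \<in> L2" by (rule H1_L2[OF U(1)])
  have gL: "g \<in> L2" unfolding g_def by (rule weak_pdiff_L2[OF V(1)])
  have [measurable]: "u \<in> borel_measurable borel" "g \<in> borel_measurable borel"
    using uL gL by (auto dest: L2_measurable)
  let ?f = "\<lambda>x. u x / of_real (?v x + d)"
  have fm: "?f \<in> borel_measurable borel" by measurable
  let ?h = "\<lambda>n. s * step n"
  have h: "?h \<longlonglongrightarrow> 0" "?h n \<noteq> 0" for n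
    using tendsto_mult_left[OF step_tendsto, of s] s step_nonzero by auto
  \<comment> \<open>The error of the difference quotient of |u| against its L^2 limit g. It is split
    off because the radial weight, taken at two points, converges only pointwise.\<close>
  define E where "E = (\<lambda>n x. shift_diff j (?h n) ?V x / of_real (?h n) - g x)"
  have E0: "(\<lambda>n. mass (E n)) \<longlonglongrightarrow> 0"
    unfolding E_def g_def by (rule difference_quotient_tendsto[OF V(1) h])
  have EL: "E n \<in> L2" for n
    unfolding E_def
    using L2_diff[OF L2_cmult[OF shift_diff_L2[OF VL], of "1 / of_real (?h n)"] gL] by simp
  let ?J = "\<lambda>y x. indicat_real (ball 0 R) x * (d\<^sup>2 * (norm (g x))\<^sup>2 / ((?v y + d) * (?v x + d))\<^sup>2)"
  have J_le: "0 \<le> ?J y x" "?J y x \<le> (norm (g x))\<^sup>2 / d\<^sup>2" for x y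
  proof -
    show "0 \<le> ?J y x" by simp
    have "d * d \<le> (?v y + d) * (?v x + d)" using d by (intro mult_mono) auto
    then have "(d * d)\<^sup>2 \<le> ((?v y + d) * (?v x + d))\<^sup>2" using d by (intro power_mono) auto
    then have "d\<^sup>2 * (norm (g x))\<^sup>2 / ((?v y + d) * (?v x + d))\<^sup>2 \<le> d\<^sup>2 * (norm (g x))\<^sup>2 / (d * d)\<^sup>2"
      using d by (intro divide_left_mono) (auto intro!: mult_pos_pos zero_less_power add_nonneg_pos)
    also have "\<dots> = (norm (g x))\<^sup>2 / d\<^sup>2" using d by (simp add: power2_eq_square)
    finally have *: "d\<^sup>2 * (norm (g x))\<^sup>2 / ((?v y + d) * (?v x + d))\<^sup>2 \<le> (norm (g x))\<^sup>2 / d\<^sup>2" .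
    show "?J y x \<le> (norm (g x))\<^sup>2 / d\<^sup>2"
      using * by (cases "x \<in> ball 0 R") simp_all
  qed
  have gi: "integrable lborel (\<lambda>x. (norm (g x))\<^sup>2 / d\<^sup>2)" using L2_integrable[OF gL] by simp
  have Ji: "integrable lborel (\<lambda>x. ?J (x + a) x)" for a
  proof (rule Bochner_Integration.integrable_bound[OF gi])
    show "AE x in lborel. norm (?J (x + a) x) \<le> norm ((norm (g x))\<^sup>2 / d\<^sup>2)"
      using J_le by (intro AE_I2) (simp only: real_norm_def abs_of_nonneg, simp)
  qed measurable
  \<comment> \<open>Radial part with g, its error term, and angular part. Only the first has a limit
    that may differ from 0.\<close>
  define b where "b = (\<lambda>n. 2 * (LINT x|lborel. ?J (x + ?h n *\<^sub>R ?e) x) + 2 / d\<^sup>2 * mass (E n)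
     + (mass (shift_diff j (?h n) u) / (?h n)\<^sup>2 - mass (shift_diff j (?h n) ?V) / (?h n)\<^sup>2) / d\<^sup>2)"
  have dV: "norm (shift_diff j t ?V x) = \<bar>?v (x + t *\<^sub>R ?e) - ?v x\<bar>" for t x
    unfolding shift_diff_def of_real_diff[symmetric] norm_of_real ..
  have b0: "0 \<le> b n" for n
    unfolding b_def using shift_diff_cmodulus_le[OF uL, of j "?h n"] J_le(1)
    by (intro add_nonneg_nonneg mult_nonneg_nonneg divide_nonneg_nonneg integral_nonneg_AE) (auto intro: divide_right_mono)
  have osc: "oscillation R j (?h n) ?f \<le> ennreal (b n * (?h n)\<^sup>2)" for n
  proof -
    let ?T = "\<lambda>x. (?h n)\<^sup>2 * (2 * ?J (x + ?h n *\<^sub>R ?e) x + 2 / d\<^sup>2 * (norm (E n x))\<^sup>2)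
       + ((norm (shift_diff j (?h n) u x))\<^sup>2 - (norm (shift_diff j (?h n) ?V x))\<^sup>2) / d\<^sup>2"
    have Ti: "integrable lborel ?T"
      by (intro Bochner_Integration.integrable_add Bochner_Integration.integrable_diff integrable_mult_right integrable_divide
          Ji L2_integrable EL shift_diff_L2 uL VL)
    have "oscillation R j (?h n) ?f \<le> (\<integral>\<^sup>+x. ennreal (?T x) \<partial>lborel)"
      unfolding oscillation_def
    proof (intro nn_integral_mono ennreal_leI)
      fix x :: "real^3"
      let ?y = "x + ?h n *\<^sub>R ?e"
      let ?I = "indicat_real (ball 0 R) x * indicat_real (ball 0 R) ?y"
      let ?A = "d\<^sup>2 / ((?v ?y + d) * (?v x + d))\<^sup>2"
      let ?B = "((norm (shift_diff j (?h n) u x))\<^sup>2 - (norm (shift_diff j (?h n) ?V x))\<^sup>2) / d\<^sup>2"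
      have "\<bar>?v ?y - ?v x\<bar>\<^sup>2 \<le> (norm (u ?y - u x))\<^sup>2" by (intro power_mono norm_triangle_ineq3) simp
      then have B0: "0 \<le> ?B" unfolding dV by (simp add: shift_diff_def)
      have A0: "0 \<le> ?A" by simp
      have A1: "?A \<le> 1 / d\<^sup>2"
      proof -
        have "d * d \<le> (?v ?y + d) * (?v x + d)" using d by (intro mult_mono) auto
        then have "(d * d)\<^sup>2 \<le> ((?v ?y + d) * (?v x + d))\<^sup>2" using d by (intro power_mono) auto
        then have "?A \<le> d\<^sup>2 / (d * d)\<^sup>2"
          using d by (intro divide_left_mono) (auto intro!: mult_pos_pos zero_less_power add_nonneg_pos)
        also have "\<dots> = 1 / d\<^sup>2" using d by (simp add: power2_eq_square)
        finally show ?thesis .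
      qed
      have "norm (shift_diff j (?h n) ?V x) = \<bar>?h n\<bar> * norm (g x + E n x)"
      proof -
        have "norm D = \<bar>t\<bar> * norm (G + (D / of_real t - G))" if "t \<noteq> 0" for t :: real and D G :: complex
          using that by (simp add: norm_divide)
        then show ?thesis unfolding E_def by this (rule h(2))
      qed
      then have "(?v ?y - ?v x)\<^sup>2 = (?h n)\<^sup>2 * (norm (g x + E n x))\<^sup>2"
        unfolding dV by (metis power2_abs power_mult_distrib)
      also have "\<dots> \<le> (?h n)\<^sup>2 * (2 * (norm (g x))\<^sup>2 + 2 * (norm (E n x))\<^sup>2)"
        by (intro mult_left_mono norm_sum_square_le) simp
      finally have D: "(?v ?y - ?v x)\<^sup>2 \<le> (?h n)\<^sup>2 * (2 * (norm (g x))\<^sup>2 + 2 * (norm (E n x))\<^sup>2)" .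
      have "(norm (?f ?y - ?f x))\<^sup>2 \<le> ?A * (?v ?y - ?v x)\<^sup>2 + ?B"
        using regularized_phase_difference[OF d, of "u ?y" "u x"] unfolding dV by (simp add: shift_diff_def)
      also have "\<dots> \<le> ?A * ((?h n)\<^sup>2 * (2 * (norm (g x))\<^sup>2 + 2 * (norm (E n x))\<^sup>2)) + ?B"
        by (intro add_right_mono mult_left_mono D A0)
      also have "\<dots> = (?h n)\<^sup>2 * (2 * (?A * (norm (g x))\<^sup>2) + 2 * (?A * (norm (E n x))\<^sup>2)) + ?B"
        by (simp only: distrib_left mult.left_commute)
      also have "\<dots> \<le> (?h n)\<^sup>2 * (2 * (?A * (norm (g x))\<^sup>2) + 2 * (1 / d\<^sup>2 * (norm (E n x))\<^sup>2)) + ?B"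
        by (intro add_right_mono mult_left_mono add_left_mono mult_right_mono A1) auto
      finally have *: "(norm (?f ?y - ?f x))\<^sup>2 \<le> (?h n)\<^sup>2 * (2 * (?A * (norm (g x))\<^sup>2) + 2 * (1 / d\<^sup>2 * (norm (E n x))\<^sup>2)) + ?B" .
      show "?I * (norm (?f ?y - ?f x))\<^sup>2 \<le> ?T x"
      proof (cases "x \<in> ball 0 R \<and> ?y \<in> ball 0 R")
        case True
        then show ?thesis using * by simp
      next
        case False
        then have z: "?I = 0" by auto
        have "0 \<le> ?T x"
          by (intro add_nonneg_nonneg mult_nonneg_nonneg B0 J_le) auto
        then show ?thesis unfolding z mult_zero_left .
      qed
    qed
    also have "\<dots> = ennreal (LINT x|lborel. ?T x)"
    proof (rule nn_integral_eq_integral[OF Ti AE_I2])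
      fix x
      have "\<bar>?v (x + ?h n *\<^sub>R ?e) - ?v x\<bar>\<^sup>2 \<le> (norm (u (x + ?h n *\<^sub>R ?e) - u x))\<^sup>2" by (intro power_mono norm_triangle_ineq3) simp
      then have "0 \<le> ((norm (shift_diff j (?h n) u x))\<^sup>2 - (norm (shift_diff j (?h n) ?V x))\<^sup>2) / d\<^sup>2" unfolding dV by (simp add: shift_diff_def)
      then show "0 \<le> ?T x" by (intro add_nonneg_nonneg mult_nonneg_nonneg J_le) auto
    qed
    also have "(LINT x|lborel. ?T x) = (?h n)\<^sup>2 * (2 * (LINT x|lborel. ?J (x + ?h n *\<^sub>R ?e) x) + 2 / d\<^sup>2 * mass (E n))
       + (mass (shift_diff j (?h n) u) - mass (shift_diff j (?h n) ?V)) / d\<^sup>2"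
    proof -
      note i = Ji[of "?h n *\<^sub>R ?e"] L2_integrable[OF EL[of n]] L2_integrable[OF shift_diff_L2[OF uL, of j "?h n"]] L2_integrable[OF shift_diff_L2[OF VL, of j "?h n"]]
      have i1: "integrable lborel (\<lambda>x. 2 * ?J (x + ?h n *\<^sub>R ?e) x)" "integrable lborel (\<lambda>x. 2 / d\<^sup>2 * (norm (E n x))\<^sup>2)"
        by (intro integrable_mult_right i)+
      have i2: "integrable lborel (\<lambda>x. (?h n)\<^sup>2 * (2 * ?J (x + ?h n *\<^sub>R ?e) x + 2 / d\<^sup>2 * (norm (E n x))\<^sup>2))"
        by (intro integrable_mult_right Bochner_Integration.integrable_add i1)
      have i3: "integrable lborel (\<lambda>x. ((norm (shift_diff j (?h n) u x))\<^sup>2 - (norm (shift_diff j (?h n) ?V x))\<^sup>2) / d\<^sup>2)"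
        by (intro integrable_divide Bochner_Integration.integrable_diff i)
      show ?thesis
        unfolding Bochner_Integration.integral_add[OF i2 i3] integral_mult_right_zero
          Bochner_Integration.integral_add[OF i1] integral_divide_zero Bochner_Integration.integral_diff[OF i(3,4)] mass_def ..
    qed
    also have "\<dots> = b n * (?h n)\<^sup>2"
    proof -
      have "H * (X + Y) + (P - Q) / D = (X + Y + (P / H - Q / H) / D) * H" if "H \<noteq> 0" "D \<noteq> 0" for H X Y P Q D :: real
        using that by (simp add: field_simps)
      then show ?thesis unfolding b_def by this (use h(2)[of n] d in simp_all)
    qed
    finally show ?thesis .
  qed
  \<comment> \<open>The bound at the full shift s holds for every n, so a limit of b along a
    subsequence suffices.\<close>
  have le: "oscillation R j s ?f \<le> ennreal (b n * s\<^sup>2)" for n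
    by (rule oscillation_scale[OF fm b0 osc])
  have t0: "(\<lambda>n. ?h n *\<^sub>R ?e) \<longlonglongrightarrow> 0" using tendsto_scaleR[OF h(1) tendsto_const[of ?e]] by simp
  obtain r :: "nat \<Rightarrow> nat" where r: "strict_mono r" "AE x in lborel. (\<lambda>n. ?V (x + ?h (r n) *\<^sub>R ?e)) \<longlonglongrightarrow> ?V x"
    using L2_AE_subseq[OF L2_translate[OF VL] VL L2_translate_continuous[OF VL t0]] by blast
  have Jlim: "(\<lambda>n. LINT x|lborel. ?J (x + ?h (r n) *\<^sub>R ?e) x) \<longlonglongrightarrow> (LINT x|lborel. ?J x x)"
  proof (rule integral_dominated_convergence[OF _ _ gi])
    show "AE x in lborel. (\<lambda>n. ?J (x + ?h (r n) *\<^sub>R ?e) x) \<longlonglongrightarrow> ?J x x"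
      using r(2)
    proof eventually_elim
      case (elim x)
      then have "(\<lambda>n. ?v (x + ?h (r n) *\<^sub>R ?e)) \<longlonglongrightarrow> ?v x" using tendsto_norm[OF elim] by simp
      moreover have "(?v x + d) * (?v x + d) \<noteq> 0" using d by (simp add: add_nonneg_eq_0_iff)
      ultimately show ?case
        by (intro tendsto_mult tendsto_divide tendsto_power tendsto_add tendsto_const) auto
    qed
    show "AE x in lborel. norm (?J (x + ?h (r n) *\<^sub>R ?e) x) \<le> (norm (g x))\<^sup>2 / d\<^sup>2" for n
      using J_le by (intro AE_I2) (simp only: real_norm_def abs_of_nonneg)
  qed measurable
  have mlim: "(\<lambda>n. mass (shift_diff j (?h n) u) / (?h n)\<^sup>2 - mass (shift_diff j (?h n) ?V) / (?h n)\<^sup>2) \<longlonglongrightarrow> mass (weak_pdiff j u) - mass (weak_pdiff j ?V)"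
    by (intro tendsto_diff difference_quotient_mass_tendsto U V h)
  have "(\<lambda>n. b (r n)) \<longlonglongrightarrow> 2 * (LINT x|lborel. ?J x x) + 2 / d\<^sup>2 * 0 + (mass (weak_pdiff j u) - mass (weak_pdiff j ?V)) / d\<^sup>2"
    unfolding b_def
    using LIMSEQ_subseq_LIMSEQ[OF E0 r(1)] LIMSEQ_subseq_LIMSEQ[OF mlim r(1)] d
    by (intro tendsto_add tendsto_mult tendsto_const tendsto_divide Jlim) (simp_all add: o_def)
  then have "(\<lambda>n. b (r n)) \<longlonglongrightarrow> 2 * (LINT x|lborel. ?J x x)"
    unfolding minimizer_weak_pdiff_mass[OF u c] by simp
  then have "(\<lambda>n. ennreal (b (r n) * s\<^sup>2)) \<longlonglongrightarrow> ennreal (2 * (LINT x|lborel. ?J x x) * s\<^sup>2)"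
    by (intro tendsto_ennrealI tendsto_mult tendsto_const)
  then show ?thesis
    by (rule LIMSEQ_le_const) (use le in blast)
qed

text \<open>Now the shift is fixed and the regularization tends to 0. The radial bound J tends to 0
  pointwise and is dominated by |g|^2 / |u|^2, integrable on balls by
  \<open>log_derivative_bound\<close>; this plays the part of a positive lower bound for |u|. So u /
  |u| does not oscillate.\<close>

theorem phase_constant:
  assumes u: "u \<in> minimizers lam1 lam2 c" and c: "c > 0"
  shows "\<exists>\<theta>. AE x in lborel. u x = cis \<theta> * of_real (norm (u x))"
proof -
  let ?v = "\<lambda>x. norm (u x)" and ?V = "cmodulus u"
  have min: "?V \<in> minimizers lam1 lam2 c" by (rule cmodulus_minimizer(2)[OF u c])
  have pos: "AE x in lborel. ?v x > 0" by (rule minimizer_positive[OF min c]) simp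
  have [measurable]: "u \<in> borel_measurable borel"
    by (rule L2_measurable[OF H1_L2[OF minimizer_facts(1)[OF u c]]])
  define z where "z = (\<lambda>x. u x / of_real (?v x))"
  have zm [measurable]: "z \<in> borel_measurable borel" unfolding z_def by measurable
  have "AE x in lborel. z (x + s *\<^sub>R axis j 1) = z x" for j s
  proof (cases "s = 0")
    case False
    let ?e = "s *\<^sub>R axis j 1 :: real^3"
    define g where "g = weak_pdiff j ?V"
    have [measurable]: "g \<in> borel_measurable borel"
      unfolding g_def by (rule L2_measurable[OF weak_pdiff_L2[OF minimizer_facts(1)[OF min c]]])
    let ?f = "\<lambda>m x. u x / of_real (?v x + step m)"
    \<comment> \<open>The convergence holds at every point: where u vanishes, z is 0 by the
      convention on division by zero, and so are all regularizations.\<close>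
    have flim: "(\<lambda>m. ?f m x) \<longlonglongrightarrow> z x" for x
    proof (cases "u x = 0")
      case False
      then have "(\<lambda>m. ?f m x) \<longlonglongrightarrow> u x / of_real (?v x + 0)"
        by (intro tendsto_intros step_tendsto) simp
      then show ?thesis by (simp add: z_def)
    qed (simp add: z_def)
    have "oscillation R j s z = 0" for R
    proof -
      let ?J = "\<lambda>m x. indicat_real (ball 0 R) x * ((step m)\<^sup>2 * (norm (g x))\<^sup>2 / ((?v x + step m) * (?v x + step m))\<^sup>2)"
      have "(\<lambda>m. LINT x|lborel. ?J m x) \<longlonglongrightarrow> (LINT x::real^3|lborel. 0)"
      proof (rule integral_dominated_convergence[OF _ _ log_derivative_bound[OF u c, of R j, folded g_def]])
        show "AE x in lborel. (\<lambda>m. ?J m x) \<longlonglongrightarrow> 0"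
          using pos
        proof eventually_elim
          case (elim x)
          then have "(\<lambda>m. ?J m x) \<longlonglongrightarrow> indicator (ball 0 R) x * (0\<^sup>2 * (norm (g x))\<^sup>2 / ((?v x + 0) * (?v x + 0))\<^sup>2)"
            by (intro tendsto_intros step_tendsto) auto
          then show ?case by simp
        qed
        show "AE x in lborel. norm (?J m x) \<le> indicator (ball 0 R) x * ((norm (g x))\<^sup>2 / (?v x)\<^sup>2)" for m
          using pos
        proof eventually_elim
          case (elim x)
          let ?s = "step m" and ?a = "?v x"
          have s: "?s > 0" by (rule step_pos)
          have "(?s * ?a)\<^sup>2 \<le> ((?a + ?s) * (?a + ?s))\<^sup>2"
            using s elim by (intro power_mono mult_mono) auto
          then have "?s\<^sup>2 / ((?a + ?s) * (?a + ?s))\<^sup>2 \<le> 1 / ?a\<^sup>2"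
            using s elim by (simp add: divide_le_eq le_divide_eq power_mult_distrib field_simps)
          then have "?s\<^sup>2 / ((?a + ?s) * (?a + ?s))\<^sup>2 * (norm (g x))\<^sup>2 \<le> 1 / ?a\<^sup>2 * (norm (g x))\<^sup>2"
            by (rule mult_right_mono) simp
          then have "indicator (ball 0 R) x * (?s\<^sup>2 * (norm (g x))\<^sup>2 / ((?a + ?s) * (?a + ?s))\<^sup>2) \<le> indicator (ball 0 R) x * ((norm (g x))\<^sup>2 / ?a\<^sup>2)"
            by (intro mult_left_mono) simp_all
          moreover have "0 \<le> ?J m x" by simp
          ultimately show ?case by (simp only: real_norm_def abs_of_nonneg)
        qed
      qed measurable
      then have J0: "(\<lambda>m. ennreal (2 * (LINT x|lborel. ?J m x) * s\<^sup>2)) \<longlonglongrightarrow> ennreal (2 * 0 * s\<^sup>2)"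
        by (intro tendsto_ennrealI tendsto_mult tendsto_const) simp
      have "oscillation R j s z = (\<integral>\<^sup>+x. liminf (\<lambda>m. ennreal (indicator (ball 0 R) x * indicator (ball 0 R) (x + ?e) * (norm (?f m (x + ?e) - ?f m x))\<^sup>2)) \<partial>lborel)"
        unfolding oscillation_def
      proof (rule nn_integral_cong)
        fix x
        have "(\<lambda>m. ennreal (indicator (ball 0 R) x * indicator (ball 0 R) (x + ?e) * (norm (?f m (x + ?e) - ?f m x))\<^sup>2))
          \<longlonglongrightarrow> ennreal (indicator (ball 0 R) x * indicator (ball 0 R) (x + ?e) * (norm (z (x + ?e) - z x))\<^sup>2)"
          by (intro tendsto_ennrealI tendsto_mult tendsto_const tendsto_power tendsto_norm tendsto_diff flim)
        from lim_imp_Liminf[OF _ this]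
        show "ennreal (indicator (ball 0 R) x * indicator (ball 0 R) (x + ?e) * (norm (z (x + ?e) - z x))\<^sup>2)
          = liminf (\<lambda>m. ennreal (indicator (ball 0 R) x * indicator (ball 0 R) (x + ?e) * (norm (?f m (x + ?e) - ?f m x))\<^sup>2))" by simp
      qed
      also have "\<dots> \<le> liminf (\<lambda>m. oscillation R j s (?f m))"
        unfolding oscillation_def by (rule nn_integral_liminf) measurable
      also have "\<dots> \<le> liminf (\<lambda>m. ennreal (2 * (LINT x|lborel. ?J m x) * s\<^sup>2))"
        unfolding g_def
        by (intro Liminf_mono always_eventually allI regularized_phase_oscillation[OF u c False step_pos])
      also have "\<dots> = 0" using lim_imp_Liminf[OF _ J0] by simp
      finally show ?thesis by simp
    qed
    then show ?thesis by (rule oscillation_0_AE[OF zm])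
  qed simp
  from translation_invariant_AE_const[OF zm this] obtain k where k: "AE x in lborel. z x = k" by blast
  with pos have "AE x in lborel. ?v x > 0 \<and> z x = k" by eventually_elim simp
  \<comment> \<open>One point where u does not vanish shows that the constant has modulus 1.\<close>
  then obtain x where "?v x > 0" "z x = k" using AE_lborel_ex by blast
  then have "norm k = 1" by (auto simp: z_def norm_divide)
  then obtain \<theta> where \<theta>: "k = cis \<theta>" using rcis_cmod_Arg[of k] by (metis rcis_def of_real_1 mult_1)
  from k pos have "AE x in lborel. u x = cis \<theta> * of_real (norm (u x))"
    by eventually_elim (auto simp: z_def \<theta> field_simps)
  then show ?thesis ..
qed

theorem lemma1p2:
  fixes lam1 lam2 c :: real
  assumes "unstable_regime lam1 lam2" and "c > 0"
  shows "(\<forall>u\<in>minimizers lam1 lam2 c. (\<lambda>x. complex_of_real (norm (u x))) \<in> minimizers lam1 lam2 c) \<and>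
    (\<forall>u\<in>minimizers lam1 lam2 c.
       (\<exists>\<theta>::real. AE x in lborel. u x = exp (\<i> * of_real \<theta>) * of_real (norm (u x))) \<and>
       (AE x in lborel. norm (u x) > 0))"
proof (intro conjI ballI)
  fix u assume u: "u \<in> minimizers lam1 lam2 c"
  show V: "cmodulus u \<in> minimizers lam1 lam2 c"
    by (rule cmodulus_minimizer(2)[OF u \<open>c > 0\<close>])
  show "\<exists>\<theta>::real. AE x in lborel. u x = exp (\<i> * of_real \<theta>) * of_real (norm (u x))"
    using phase_constant[OF u \<open>c > 0\<close>] by (simp only: cis_conv_exp)
  show "AE x in lborel. norm (u x) > 0"
    by (rule minimizer_positive[OF V \<open>c > 0\<close>]) simp
qed

end
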